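(* Let $(M^n,g)$ be a closed Riemannian manifold, $q$ a symmetric $(0,2)$-tensor field, $X$ a vector field and $\varphi$ a function on $M$ with $$\tfrac12\mathcal{L}_Xg=\tfrac12q+\varphi g$$ (a closed extended $q$-soliton). If $$\mathrm{div}\,q=\tfrac12\nabla\,\mathrm{tr}(q)\qquad\text{and}\qquad\int_M\big(\mathcal{L}_X\mathrm{tr}(q)\big)\,dvol_g=0,$$ then $X$ is a conformal vector field. For $n=2$ the second condition is redundant, i.e. the first condition alone implies that $X$ is conformal.
   Context: All objects are smooth; closed means compact without boundary. $\mathrm{tr}$ is the trace with respect to $g$ and $(\mathrm{div}\,q)_j=\nabla^iq_{ij}$ (so the first condition reads $\nabla^iq_{ij}=\frac12\nabla_j\mathrm{tr}(q)$). $\mathcal{L}_X\mathrm{tr}(q)=X(\mathrm{tr}(q))$. $X$ is a conformal vector field if $\mathcal{L}_Xg=2\sigma g$ for some function $\sigma$ on $M$. *)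

theory Defs
  imports "HOL-Analysis.Analysis"
begin

definition partial_deriv :: "'n::finite \<Rightarrow> (real^'n \<Rightarrow> real) \<Rightarrow> real^'n \<Rightarrow> real" where
  "partial_deriv i f x = frechet_derivative f (at x) (axis i 1)"

primrec Ck_on :: "nat \<Rightarrow> (real^'n::finite) set \<Rightarrow> (real^'n \<Rightarrow> real) \<Rightarrow> bool" where
  "Ck_on 0 S f \<longleftrightarrow> continuous_on S f"
| "Ck_on (Suc k) S f \<longleftrightarrow>
     (\<forall>x\<in>S. f differentiable (at x)) \<and> (\<forall>i. Ck_on k S (partial_deriv i f))"

text \<open>Only used for open sets.\<close>

definition smooth_on :: "(real^'n::finite) set \<Rightarrow> (real^'n \<Rightarrow> real) \<Rightarrow> bool" where
  "smooth_on S f \<longleftrightarrow> (\<forall>k. Ck_on k S f)"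


text \<open>
  A chart is a pair of a domain in the manifold and a coordinate map; the values of the
  coordinate map outside the domain are irrelevant. The dimension of the manifold is
  \<^term>\<open>CARD('n)\<close>.
\<close>

type_synonym ('a, 'n) chart = "'a set \<times> ('a \<Rightarrow> real^'n)"

abbreviation chart_dom :: "('a, 'n::finite) chart \<Rightarrow> 'a set" where
  "chart_dom c \<equiv> fst c"

abbreviation coord :: "('a, 'n::finite) chart \<Rightarrow> 'a \<Rightarrow> real^'n" where
  "coord c \<equiv> snd c"

definition chart_inv :: "('a, 'n::finite) chart \<Rightarrow> real^'n \<Rightarrow> 'a" where
  "chart_inv c = inv_into (chart_dom c) (coord c)"

definition is_chart :: "'a topology \<Rightarrow> ('a, 'n::finite) chart \<Rightarrow> bool" where
  "is_chart M c \<longleftrightarrow>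
     openin M (chart_dom c) \<and> open (coord c ` chart_dom c) \<and>
     homeomorphic_map (subtopology M (chart_dom c))
       (top_of_set (coord c ` chart_dom c)) (coord c)"

definition smooth_atlas :: "'a topology \<Rightarrow> ('a, 'n::finite) chart set \<Rightarrow> bool" where
  "smooth_atlas M A \<longleftrightarrow>
     (\<forall>c\<in>A. is_chart M c) \<and> topspace M = (\<Union>c\<in>A. chart_dom c) \<and>
     (\<forall>c\<in>A. \<forall>d\<in>A. \<forall>i.
        smooth_on (coord c ` (chart_dom c \<inter> chart_dom d)) (\<lambda>x. coord d (chart_inv c x) $ i))"

text \<open>Compact, Hausdorff and locally Euclidean implies second countable.\<close>

definition closed_manifold :: "'a topology \<Rightarrow> ('a, 'n::finite) chart set \<Rightarrow> bool" where
  "closed_manifold M A \<longleftrightarrow> compact_space M \<and> Hausdorff_space M \<and> smooth_atlas M A"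

definition chart_smooth :: "('a, 'n::finite) chart \<Rightarrow> ('a \<Rightarrow> real) \<Rightarrow> bool" where
  "chart_smooth c f \<longleftrightarrow> smooth_on (coord c ` chart_dom c) (\<lambda>x. f (chart_inv c x))"

definition smooth_function :: "('a, 'n::finite) chart set \<Rightarrow> ('a \<Rightarrow> real) \<Rightarrow> bool" where
  "smooth_function A f \<longleftrightarrow> (\<forall>c\<in>A. chart_smooth c f)"

text \<open>The coordinate derivative \<open>\<partial>f/\<partial>x\<^sup>i\<close> at \<open>p\<close>, for \<open>x\<close> the coordinates of the chart \<open>c\<close>.\<close>

definition chart_deriv ::
  "('a, 'n::finite) chart \<Rightarrow> 'n \<Rightarrow> ('a \<Rightarrow> real) \<Rightarrow> 'a \<Rightarrow> real" where
  "chart_deriv c i f p = partial_deriv i (\<lambda>x. f (chart_inv c x)) (coord c p)"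

text \<open>The Jacobian entry \<open>\<partial>y\<^sup>k/\<partial>x\<^sup>i\<close>, for \<open>x\<close> and \<open>y\<close> the coordinates of \<open>c\<close> and \<open>d\<close>.\<close>

definition jac ::
  "('a, 'n::finite) chart \<Rightarrow> ('a, 'n) chart \<Rightarrow> 'a \<Rightarrow> 'n \<Rightarrow> 'n \<Rightarrow> real" where
  "jac c d p k i = chart_deriv c i (\<lambda>p'. coord d p' $ k) p"


text \<open>
  Tensor fields are given by their components with respect to the charts of the atlas, subject
  to the transformation law: \<open>X c p $ i\<close> is \<open>X\<^sup>i\<close> and \<open>q c p $ i $ j\<close> is \<open>q\<^sub>i\<^sub>j\<close>, both at the
  point \<open>p\<close> in the coordinates of \<open>c\<close>.
\<close>

type_synonym ('a, 'n) vfield = "('a, 'n) chart \<Rightarrow> 'a \<Rightarrow> real^'n"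

type_synonym ('a, 'n) tensor2 = "('a, 'n) chart \<Rightarrow> 'a \<Rightarrow> real^'n^'n"

definition vector_field :: "('a, 'n::finite) chart set \<Rightarrow> ('a, 'n) vfield \<Rightarrow> bool" where
  "vector_field A X \<longleftrightarrow>
     (\<forall>c\<in>A. \<forall>i. chart_smooth c (\<lambda>p. X c p $ i)) \<and>
     (\<forall>c\<in>A. \<forall>d\<in>A. \<forall>p \<in> chart_dom c \<inter> chart_dom d. \<forall>k.
        X d p $ k = (\<Sum>i\<in>UNIV. jac c d p k i * X c p $ i))"

definition tensor_field :: "('a, 'n::finite) chart set \<Rightarrow> ('a, 'n) tensor2 \<Rightarrow> bool" where
  "tensor_field A q \<longleftrightarrow>
     (\<forall>c\<in>A. \<forall>i j. chart_smooth c (\<lambda>p. q c p $ i $ j)) \<and>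
     (\<forall>c\<in>A. \<forall>d\<in>A. \<forall>p \<in> chart_dom c \<inter> chart_dom d. \<forall>i j.
        q c p $ i $ j =
          (\<Sum>k\<in>UNIV. \<Sum>l\<in>UNIV. jac c d p k i * jac c d p l j * q d p $ k $ l))"

definition symmetric_tensor_field ::
  "('a, 'n::finite) chart set \<Rightarrow> ('a, 'n) tensor2 \<Rightarrow> bool" where
  "symmetric_tensor_field A q \<longleftrightarrow>
     tensor_field A q \<and> (\<forall>c\<in>A. \<forall>p\<in>chart_dom c. transpose (q c p) = q c p)"

definition riemannian_metric ::
  "('a, 'n::finite) chart set \<Rightarrow> ('a, 'n) tensor2 \<Rightarrow> bool" where
  "riemannian_metric A g \<longleftrightarrow>
     symmetric_tensor_field A g \<and>
     (\<forall>c\<in>A. \<forall>p\<in>chart_dom c. \<forall>v. v \<noteq> 0 \<longrightarrow> v \<bullet> (g c p *v v) > 0)"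


text \<open>
  Scalars computed from components do not depend on the chart around \<open>p\<close>; the choice made here
  turns them into functions on the manifold.
\<close>

definition chart_at :: "('a, 'n::finite) chart set \<Rightarrow> 'a \<Rightarrow> ('a, 'n) chart" where
  "chart_at A p = (SOME c. c \<in> A \<and> p \<in> chart_dom c)"

abbreviation ginv ::
  "('a, 'n::finite) tensor2 \<Rightarrow> ('a, 'n) chart \<Rightarrow> 'a \<Rightarrow> 'n \<Rightarrow> 'n \<Rightarrow> real" where
  "ginv g c p i j \<equiv> matrix_inv (g c p) $ i $ j"

definition tr ::
  "('a, 'n::finite) chart set \<Rightarrow> ('a, 'n) tensor2 \<Rightarrow> ('a, 'n) tensor2 \<Rightarrow> 'a \<Rightarrow> real" where
  "tr A g q p =
     (let c = chart_at A p in \<Sum>i\<in>UNIV. \<Sum>j\<in>UNIV. ginv g c p i j * q c p $ i $ j)"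

definition lie_fun ::
  "('a, 'n::finite) chart set \<Rightarrow> ('a, 'n) vfield \<Rightarrow> ('a \<Rightarrow> real) \<Rightarrow> 'a \<Rightarrow> real" where
  "lie_fun A X f p =
     (let c = chart_at A p in \<Sum>k\<in>UNIV. X c p $ k * chart_deriv c k f p)"

text \<open>
  \<open>(L\<^sub>X q)\<^sub>i\<^sub>j = X\<^sup>k \<partial>\<^sub>k q\<^sub>i\<^sub>j + q\<^sub>k\<^sub>j \<partial>\<^sub>i X\<^sup>k + q\<^sub>i\<^sub>k \<partial>\<^sub>j X\<^sup>k\<close>, which is
  \<open>X (q(Y,Z)) - q([X,Y],Z) - q(Y,[X,Z])\<close> on coordinate fields \<open>Y = \<partial>\<^sub>i\<close>, \<open>Z = \<partial>\<^sub>j\<close>.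
\<close>

definition lie_tensor ::
  "('a, 'n::finite) vfield \<Rightarrow> ('a, 'n) tensor2 \<Rightarrow> ('a, 'n) tensor2" where
  "lie_tensor X q c p = (\<chi> i j. \<Sum>k\<in>UNIV.
       X c p $ k * chart_deriv c k (\<lambda>p'. q c p' $ i $ j) p
     + q c p $ k $ j * chart_deriv c i (\<lambda>p'. X c p' $ k) p
     + q c p $ i $ k * chart_deriv c j (\<lambda>p'. X c p' $ k) p)"

text \<open>\<open>\<Gamma>\<^sup>k\<^sub>i\<^sub>j\<close> is \<open>christoffel g c p k i j\<close>.\<close>

definition christoffel ::
  "('a, 'n::finite) tensor2 \<Rightarrow> ('a, 'n) chart \<Rightarrow> 'a \<Rightarrow> 'n \<Rightarrow> 'n \<Rightarrow> 'n \<Rightarrow> real" where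
  "christoffel g c p k i j = (1/2) * (\<Sum>l\<in>UNIV. ginv g c p k l *
     (chart_deriv c i (\<lambda>p'. g c p' $ j $ l) p
    + chart_deriv c j (\<lambda>p'. g c p' $ i $ l) p
    - chart_deriv c l (\<lambda>p'. g c p' $ i $ j) p))"

text \<open>\<open>\<nabla>\<^sub>k q\<^sub>i\<^sub>j\<close> for the Levi-Civita connection of \<open>g\<close> is \<open>cov_deriv g q c p k i j\<close>.\<close>

definition cov_deriv ::
  "('a, 'n::finite) tensor2 \<Rightarrow> ('a, 'n) tensor2 \<Rightarrow> ('a, 'n) chart \<Rightarrow> 'a
     \<Rightarrow> 'n \<Rightarrow> 'n \<Rightarrow> 'n \<Rightarrow> real" where
  "cov_deriv g q c p k i j =
     chart_deriv c k (\<lambda>p'. q c p' $ i $ j) p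
   - (\<Sum>l\<in>UNIV. christoffel g c p l k i * q c p $ l $ j)
   - (\<Sum>l\<in>UNIV. christoffel g c p l k j * q c p $ i $ l)"

text \<open>\<open>(div q)\<^sub>j = \<nabla>\<^sup>i q\<^sub>i\<^sub>j = g\<^sup>i\<^sup>k \<nabla>\<^sub>k q\<^sub>i\<^sub>j\<close>\<close>

definition div_tensor ::
  "('a, 'n::finite) tensor2 \<Rightarrow> ('a, 'n) tensor2 \<Rightarrow> ('a, 'n) chart \<Rightarrow> 'a \<Rightarrow> real^'n" where
  "div_tensor g q c p =
     (\<chi> j. \<Sum>i\<in>UNIV. \<Sum>k\<in>UNIV. ginv g c p i k * cov_deriv g q c p k i j)"

text \<open>
  The Riemannian measure: the unique Borel measure on \<open>M\<close> which in every chart has density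
  \<open>sqrt (det (g\<^sub>i\<^sub>j))\<close> with respect to Lebesgue measure of the coordinates.
\<close>

definition is_riemannian_volume ::
  "'a topology \<Rightarrow> ('a, 'n::finite) chart set \<Rightarrow> ('a, 'n) tensor2 \<Rightarrow> 'a measure \<Rightarrow> bool" where
  "is_riemannian_volume M A g \<mu> \<longleftrightarrow>
     space \<mu> = topspace M \<and> sets \<mu> = sigma_sets (topspace M) {U. openin M U} \<and>
     (\<forall>c\<in>A. \<forall>E\<in>sets \<mu>. E \<subseteq> chart_dom c \<longrightarrow>
        emeasure \<mu> E =
          (\<integral>\<^sup>+x\<in>coord c ` E. ennreal (sqrt (det (g c (chart_inv c x)))) \<partial>lborel))"

definition dvol ::
  "'a topology \<Rightarrow> ('a, 'n::finite) chart set \<Rightarrow> ('a, 'n) tensor2 \<Rightarrow> 'a measure" where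
  "dvol M A g = (THE \<mu>. is_riemannian_volume M A g \<mu>)"

definition extended_soliton ::
  "('a, 'n::finite) chart set \<Rightarrow> ('a, 'n) tensor2 \<Rightarrow> ('a, 'n) tensor2 \<Rightarrow> ('a, 'n) vfield
     \<Rightarrow> ('a \<Rightarrow> real) \<Rightarrow> bool" where
  "extended_soliton A g q X \<phi> \<longleftrightarrow>
     (\<forall>c\<in>A. \<forall>p\<in>chart_dom c.
        (1/2) *\<^sub>R lie_tensor X g c p = (1/2) *\<^sub>R q c p + \<phi> p *\<^sub>R g c p)"

definition conformal_field ::
  "('a, 'n::finite) chart set \<Rightarrow> ('a, 'n) tensor2 \<Rightarrow> ('a, 'n) vfield \<Rightarrow> bool" where
  "conformal_field A g X \<longleftrightarrow>
     (\<exists>\<sigma>. smooth_function A \<sigma> \<and>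
        (\<forall>c\<in>A. \<forall>p\<in>chart_dom c. lie_tensor X g c p = (2 * \<sigma> p) *\<^sub>R g c p))"

end

theory Submission
  imports Defs
begin

text \<open>
  Let \<open>n\<close> be the dimension, \<open>\<tau> = tr q\<close> and let \<open>q\<^sub>0 = q - (\<tau>/n) g\<close> be the traceless part of \<open>q\<close>.
  The soliton equation says \<open>L\<^sub>X g = q + 2\<phi> g\<close>, so \<open>X\<close> is conformal as soon as \<open>q\<^sub>0 = 0\<close>, with
  \<open>\<sigma> = \<tau>/(2n) + \<phi>\<close>. The vanishing of \<open>q\<^sub>0\<close> comes from integrating the divergence of the vector field \<open>Y\<close>
  that is dual to \<open>q\<^sub>0(X, -)\<close>. Since \<open>q\<^sub>0\<close> is symmetric and traceless, and
  \<open>div q\<^sub>0 = (1/2 - 1/n) \<nabla>\<tau>\<close> by the hypothesis on \<open>div q\<close>,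
  
  \<open>div Y = (div q\<^sub>0)(X) + (1/2) \<langle>q\<^sub>0, L\<^sub>X g\<rangle> = (1/2 - 1/n) X(\<tau>) + (1/2) |q\<^sub>0|\<^sup>2\<close>
  
  (lemma \<open>divergence_Y\<close>). The integral of \<open>div Y\<close> over the closed manifold is zero
  (\<open>divergence_theorem\<close>). The first term integrates to zero by assumption, or has the coefficient
  \<open>0\<close> if \<open>n = 2\<close>; hence the integral of the continuous nonnegative function \<open>|q\<^sub>0|\<^sup>2\<close> is zero and
  \<open>q\<^sub>0 = 0\<close> everywhere.
  
  Tensor fields are families of components in charts, so three ingredients of this argument have to be
  built from coordinates. The volume measure is shown to exist and to be unique: a
  point is weighted by the reciprocal of the number of charts of a finite cover that contain it, and the
  change of variables formula makes the contributions of different charts agree. The divergence theorem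
  follows from a \<open>C\<^sup>1\<close> partition of unity and the fact that the integral of a partial derivative of a
  compactly supported function vanishes. The formula for \<open>div Y\<close> is
  an index computation at one point in one chart, which uses the derivatives of \<open>det g\<close> and of \<open>g\<^sup>-\<^sup>1\<close>; that
  \<open>\<tau>\<close>, \<open>|q\<^sub>0|\<^sup>2\<close> and \<open>Y\<close> do not depend on the chart follows because the endomorphism \<open>g\<^sup>-\<^sup>1 q\<close>
  changes by conjugation with the Jacobian.
\<close>

section \<open>Functions of class \<open>C\<^sup>k\<close> on open sets\<close>

lemma partial_deriv_eq:
  assumes "(f has_derivative f') (at x)"
  shows "partial_deriv i f x = f' (axis i 1)"
  using frechet_derivative_at[OF assms] by (simp add: partial_deriv_def)

lemma has_derivative_partial_deriv:
  fixes f :: "real^'n::finite \<Rightarrow> real"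
  assumes "f differentiable (at x)"
  shows "(f has_derivative (\<lambda>v. \<Sum>i\<in>UNIV. v $ i * partial_deriv i f x)) (at x)"
proof -
  let ?F = "frechet_derivative f (at x)"
  have *: "(f has_derivative ?F) (at x)"
    using assms frechet_derivative_works by blast
  then have lin: "linear ?F" by (rule has_derivative_linear)
  have "?F v = (\<Sum>i\<in>UNIV. v $ i * partial_deriv i f x)" for v
  proof -
    have "?F v = ?F (\<Sum>i\<in>UNIV. v $ i *s axis i 1)"
      by (simp add: basis_expansion)
    also have "\<dots> = (\<Sum>i\<in>UNIV. v $ i * partial_deriv i f x)"
      by (simp add: linear_sum[OF lin] scalar_mult_eq_scaleR linear_cmul[OF lin] partial_deriv_def)
    finally show ?thesis .
  qed
  then have "?F = (\<lambda>v. \<Sum>i\<in>UNIV. v $ i * partial_deriv i f x)" by auto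
  then show ?thesis using * by simp
qed

text \<open>
  Functions that agree near \<open>x\<close> have the same derivatives there, so the choice operator in
  \<^const>\<open>frechet_derivative\<close> picks the same one, whether or not a derivative exists.
\<close>

lemma partial_deriv_cong:
  assumes "open U" "x \<in> U" "\<And>y. y \<in> U \<Longrightarrow> f y = g y"
  shows "partial_deriv i f x = partial_deriv i g x"
proof -
  have "(f has_derivative D) (at x) \<longleftrightarrow> (g has_derivative D) (at x)" for D
    using has_derivative_transform_within_open[of f D x UNIV U g]
      has_derivative_transform_within_open[of g D x UNIV U f] assms by auto
  then show ?thesis by (simp add: partial_deriv_def frechet_derivative_def)
qed

lemma differentiable_cong_open:
  assumes "open U" "x \<in> U" "\<And>y. y \<in> U \<Longrightarrow> f y = g y" "f differentiable (at x)"
  shows "g differentiable (at x)"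
  using assms has_derivative_transform_within_open unfolding differentiable_def by blast

lemma Ck_on_cong:
  assumes "open S" "\<And>x. x \<in> S \<Longrightarrow> f x = g x" "Ck_on k S f"
  shows "Ck_on k S g"
  using assms
proof (induction k arbitrary: f g)
  case 0
  then show ?case by (simp cong: continuous_on_cong)
next
  case (Suc k)
  have "Ck_on k S (partial_deriv i g)" for i
  proof (rule Suc.IH)
    show "partial_deriv i f x = partial_deriv i g x" if "x \<in> S" for x
      using partial_deriv_cong[OF Suc.prems(1) that Suc.prems(2)] .
  qed (use Suc.prems in auto)
  moreover have "g differentiable (at x)" if "x \<in> S" for x
    by (rule differentiable_cong_open[OF Suc.prems(1) that Suc.prems(2)]) (use Suc.prems(3) that in auto)
  ultimately show ?case by simp
qed

lemma Ck_on_local: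
  assumes "\<And>x. x \<in> S \<Longrightarrow> \<exists>U. open U \<and> x \<in> U \<and> Ck_on k U f"
  shows "Ck_on k S f"
  using assms
proof (induction k arbitrary: f)
  case 0
  have "continuous (at x) f" if "x \<in> S" for x
    using 0[OF that] continuous_on_eq_continuous_at by auto
  then show ?case by (auto intro: continuous_at_imp_continuous_on)
next
  case (Suc k)
  have "f differentiable (at x)" if "x \<in> S" for x
    using Suc.prems[OF that] by auto
  moreover have "Ck_on k S (partial_deriv i f)" for i
    by (rule Suc.IH) (use Suc.prems in fastforce)
  ultimately show ?case by auto
qed

lemma Ck_on_continuous:
  assumes "Ck_on k S f"
  shows "continuous_on S f"
proof (cases k)
  case 0
  then show ?thesis using assms by simp
next
  case (Suc m)
  then have "f differentiable (at x)" if "x \<in> S" for x using assms that by auto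
  then show ?thesis
    by (meson continuous_at_imp_continuous_on differentiable_imp_continuous_within)
qed

lemma Ck_on_pred:
  assumes "Ck_on (Suc k) S f"
  shows "Ck_on k S f"
  using assms
proof (induction k arbitrary: f)
  case 0
  then show ?case using Ck_on_continuous[OF 0] by simp
qed auto

lemma Ck_on_const [simp]: "Ck_on k S (\<lambda>x. c)"
proof (induction k arbitrary: c)
  case (Suc k)
  have "partial_deriv i (\<lambda>x. c) = (\<lambda>x. 0)" for i :: 'a
    by (rule ext) (simp add: partial_deriv_def)
  then show ?case using Suc by simp
qed simp

lemma partial_deriv_add:
  assumes "f differentiable (at x)" "g differentiable (at x)"
  shows "partial_deriv i (\<lambda>x. f x + g x) x = partial_deriv i f x + partial_deriv i g x"
  using partial_deriv_eq[OF has_derivative_add[OF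
        assms[THEN frechet_derivative_works[THEN iffD1]]]]
  by (simp add: partial_deriv_def)

lemma partial_deriv_mult:
  fixes f g :: "real^'n::finite \<Rightarrow> real"
  assumes "f differentiable (at x)" "g differentiable (at x)"
  shows "partial_deriv i (\<lambda>x. f x * g x) x = f x * partial_deriv i g x + partial_deriv i f x * g x"
  using partial_deriv_eq[OF has_derivative_mult[OF
        assms[THEN frechet_derivative_works[THEN iffD1]]]]
  by (simp add: partial_deriv_def)

lemma Ck_on_add:
  assumes "open S" "Ck_on k S f" "Ck_on k S g"
  shows "Ck_on k S (\<lambda>x. f x + g x)"
  using assms
proof (induction k arbitrary: f g)
  case 0
  then show ?case by (auto intro: continuous_intros)
next
  case (Suc k)
  have "Ck_on k S (partial_deriv i (\<lambda>x. f x + g x))" for i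
  proof (rule Ck_on_cong[OF Suc.prems(1)])
    show "Ck_on k S (\<lambda>x. partial_deriv i f x + partial_deriv i g x)"
      by (rule Suc.IH) (use Suc.prems in auto)
  qed (use Suc.prems in \<open>auto simp: partial_deriv_add\<close>)
  then show ?case using Suc.prems by (auto intro: differentiable_add)
qed

lemma Ck_on_mult:
  assumes "open S" "Ck_on k S f" "Ck_on k S g"
  shows "Ck_on k S (\<lambda>x. f x * g x)"
  using assms
proof (induction k arbitrary: f g)
  case 0
  then show ?case by (auto intro: continuous_intros)
next
  case (Suc k)
  have "Ck_on k S (partial_deriv i (\<lambda>x. f x * g x))" for i
  proof (rule Ck_on_cong[OF Suc.prems(1)])
    show "Ck_on k S (\<lambda>x. f x * partial_deriv i g x + partial_deriv i f x * g x)"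
      by (intro Ck_on_add Suc.IH) (use Suc.prems Ck_on_pred in auto)
  qed (use Suc.prems in \<open>auto simp: partial_deriv_mult\<close>)
  then show ?case using Suc.prems by (auto intro: differentiable_mult)
qed

lemma Ck_on_uminus:
  assumes "open S" "Ck_on k S f"
  shows "Ck_on k S (\<lambda>x. - f x)"
  using Ck_on_mult[OF assms(1) Ck_on_const[of k S "-1"] assms(2)] by simp

lemma Ck_on_diff:
  assumes "open S" "Ck_on k S f" "Ck_on k S g"
  shows "Ck_on k S (\<lambda>x. f x - g x)"
  using Ck_on_add[OF assms(1,2) Ck_on_uminus[OF assms(1,3)]] by simp

lemma Ck_on_sum:
  assumes "open S" "\<And>i. i \<in> I \<Longrightarrow> Ck_on k S (f i)"
  shows "Ck_on k S (\<lambda>x. \<Sum>i\<in>I. f i x)"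
  using assms(2) by (induction I rule: infinite_finite_induct) (auto intro: Ck_on_add assms(1))

lemma Ck_on_prod:
  assumes "open S" "\<And>i. i \<in> I \<Longrightarrow> Ck_on k S (f i)"
  shows "Ck_on k S (\<lambda>x. \<Prod>i\<in>I. f i x)"
  using assms(2) by (induction I rule: infinite_finite_induct) (auto intro: Ck_on_mult assms(1))

lemma partial_deriv_compose:
  fixes f :: "real^'n::finite \<Rightarrow> real"
  assumes "f differentiable (at x)" "(\<psi> has_real_derivative d) (at (f x))"
  shows "(\<lambda>x. \<psi> (f x)) differentiable (at x)"
    "partial_deriv i (\<lambda>x. \<psi> (f x)) x = d * partial_deriv i f x"
proof -
  have "(f has_derivative frechet_derivative f (at x)) (at x)"
    using assms(1) frechet_derivative_works by blast
  from has_derivative_compose[OF this assms(2)[unfolded has_field_derivative_def]]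
  have *: "((\<lambda>x. \<psi> (f x)) has_derivative (\<lambda>v. d * frechet_derivative f (at x) v)) (at x)" .
  then show "(\<lambda>x. \<psi> (f x)) differentiable (at x)" by (auto simp: differentiable_def)
  from partial_deriv_eq[OF *] show "partial_deriv i (\<lambda>x. \<psi> (f x)) x = d * partial_deriv i f x"
    by (simp add: partial_deriv_def)
qed

text \<open>
  The derivative of \<open>1/f\<close> is \<open>-(1/f)\<^sup>2 f'\<close>, which contains \<open>1/f\<close> only to the order of smoothness
  that the induction has already reached.
\<close>

lemma Ck_on_inverse:
  assumes "open S" "Ck_on k S f" "\<And>x. x \<in> S \<Longrightarrow> f x \<noteq> 0"
  shows "Ck_on k S (\<lambda>x. inverse (f x))"
  using assms(2)
proof (induction k)
  case 0
  then show ?case using assms(3) by (auto intro: continuous_intros)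
next
  case (Suc k)
  have D: "(inverse has_real_derivative - (inverse (f x) * inverse (f x))) (at (f x))" if "x \<in> S" for x
    using DERIV_inverse[OF assms(3)[OF that]] by (simp add: power2_eq_square numeral_2_eq_2)
  have IH: "Ck_on k S (\<lambda>x. inverse (f x))" using Suc Ck_on_pred by blast
  have "Ck_on k S (partial_deriv i (\<lambda>x. inverse (f x)))" for i
  proof (rule Ck_on_cong[OF assms(1)])
    show "Ck_on k S (\<lambda>x. - (inverse (f x) * inverse (f x)) * partial_deriv i f x)"
      by (intro Ck_on_mult Ck_on_uminus IH assms(1)) (use Suc.prems in auto)
    show "- (inverse (f x) * inverse (f x)) * partial_deriv i f x =
        partial_deriv i (\<lambda>x. inverse (f x)) x" if "x \<in> S" for x
      using partial_deriv_compose(2)[of f x inverse, OF _ D[OF that]] Suc.prems that by simp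
  qed
  then show ?case using Suc.prems partial_deriv_compose(1)[of f _ inverse, OF _ D] by auto
qed

lemma Ck_on_divide:
  assumes "open S" "Ck_on k S f" "Ck_on k S g" "\<And>x. x \<in> S \<Longrightarrow> g x \<noteq> 0"
  shows "Ck_on k S (\<lambda>x. f x / g x)"
  using Ck_on_mult[OF assms(1,2) Ck_on_inverse[OF assms(1,3,4)]] by (simp add: divide_inverse)

text \<open>
  Needed for the square root in the volume density and for the radial profile of bump functions.
\<close>

lemma C1_on_compose:
  assumes "open S" "Ck_on 1 S f"
    and "\<And>x. x \<in> S \<Longrightarrow> (\<psi> has_real_derivative d (f x)) (at (f x))" "continuous_on (f ` S) d"
  shows "Ck_on 1 S (\<lambda>x. \<psi> (f x))"
proof -
  have f: "f differentiable (at x)" if "x \<in> S" for x using assms(2) that by simp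
  have "continuous_on S (partial_deriv i (\<lambda>x. \<psi> (f x)))" for i
  proof -
    have "continuous_on S (\<lambda>x. d (f x) * partial_deriv i f x)"
      using assms(2) Ck_on_continuous[OF assms(2)]
      by (auto intro!: continuous_intros continuous_on_compose2[OF assms(4)])
    then show ?thesis
      using partial_deriv_compose(2)[OF f assms(3)] by (simp cong: continuous_on_cong)
  qed
  then show ?thesis using partial_deriv_compose(1)[OF f assms(3)] by simp
qed

section \<open>The integral of a derivative of a compactly supported function\<close>

lemma partial_deriv_zero_outside:
  fixes u :: "real^'n::finite \<Rightarrow> real"
  assumes "closed K" "\<And>x. x \<notin> K \<Longrightarrow> u x = 0" "x \<notin> K"
  shows "partial_deriv i u x = 0"
proof -
  have "partial_deriv i u x = partial_deriv i (\<lambda>x. 0) x"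
    by (rule partial_deriv_cong[of "- K"]) (use assms in auto)
  then show ?thesis by (simp add: partial_deriv_def)
qed

lemma integrable_continuous_compact_support:
  fixes u :: "real^'n::finite \<Rightarrow> real"
  assumes "continuous_on UNIV u" "compact K" "\<And>x. x \<notin> K \<Longrightarrow> u x = 0"
  shows "integrable lborel u"
proof -
  have "integrable lborel (\<lambda>x. indicator K x *\<^sub>R u x)"
    by (rule borel_integrable_compact) (use assms continuous_on_subset[OF assms(1)] in auto)
  also have "(\<lambda>x. indicator K x *\<^sub>R u x) = u"
    using assms(3) by (force simp: indicator_def)
  finally show ?thesis .
qed

text \<open>
  Integration by parts without boundary term. By translation invariance of Lebesgue measure the
  difference quotients \<open>(u(x + w e) - u(x))/w\<close> have integral \<open>0\<close>, and they converge to the partial derivative;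
  the mean value theorem and the compact support provide a dominating function.
\<close>

lemma integral_partial_deriv_compact_support:
  fixes u :: "real^'n::finite \<Rightarrow> real"
  assumes C1: "Ck_on 1 UNIV u" and K: "compact K" and supp: "\<And>x. x \<notin> K \<Longrightarrow> u x = 0"
  shows "integrable lborel (partial_deriv i u)" "integral\<^sup>L lborel (partial_deriv i u) = 0"
proof -
  let ?v = "partial_deriv i u" and ?e = "axis i (1::real) :: real^'n"
  have diff: "u differentiable (at x)" for x using C1 by simp
  have contu: "continuous_on UNIV u" using Ck_on_continuous[OF C1] .
  have contv: "continuous_on UNIV ?v" using C1 by simp
  have suppv: "?v x = 0" if "x \<notin> K" for x
    by (rule partial_deriv_zero_outside[of K]) (use supp that compact_imp_closed[OF K] in auto)
  show "integrable lborel ?v"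
    by (rule integrable_continuous_compact_support[OF contv K suppv])
  have intu: "integrable lborel u"
    by (rule integrable_continuous_compact_support[OF contu K supp])
  have "bounded (?v ` K)"
    by (intro compact_imp_bounded compact_continuous_image K continuous_on_subset[OF contv]) auto
  then obtain B where B: "\<And>x. x \<in> K \<Longrightarrow> norm (?v x) \<le> B" "B > 0"
    using bounded_pos by (metis imageI)
  have vB: "\<bar>?v x\<bar> \<le> B" for x using B suppv[of x] by (cases "x \<in> K") auto
  obtain R where R: "\<And>x. x \<in> K \<Longrightarrow> norm x \<le> R"
    using compact_imp_bounded[OF K] bounded_iff by blast
  have line: "((\<lambda>t. u (x + t *\<^sub>R ?e)) has_real_derivative ?v (x + t *\<^sub>R ?e)) (at t)" for x t
  proof -
    have "((\<lambda>t. x + t *\<^sub>R ?e) has_derivative (\<lambda>s. s *\<^sub>R ?e)) (at t)"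
      by (auto intro!: derivative_eq_intros)
    from has_derivative_compose[OF this has_derivative_partial_deriv[OF diff]]
    have "((\<lambda>t. u (x + t *\<^sub>R ?e)) has_derivative
      (\<lambda>s. \<Sum>j\<in>UNIV. (s *\<^sub>R ?e) $ j * partial_deriv j u (x + t *\<^sub>R ?e))) (at t)" .
    moreover have "(\<Sum>j\<in>UNIV. (s *\<^sub>R ?e) $ j * partial_deriv j u (x + t *\<^sub>R ?e)) = ?v (x + t *\<^sub>R ?e) * s" for s
    proof -
      have "(\<Sum>j\<in>UNIV. (s *\<^sub>R ?e) $ j * partial_deriv j u (x + t *\<^sub>R ?e)) =
          (\<Sum>j\<in>UNIV. if j = i then s * ?v (x + t *\<^sub>R ?e) else 0)"
        by (rule sum.cong) (auto simp: axis_def)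
      then show ?thesis by simp
    qed
    ultimately show ?thesis by (simp add: has_field_derivative_def)
  qed
  define w :: "nat \<Rightarrow> real" where "w n = inverse (real (Suc n))" for n
  have w: "0 < w n" "w n \<le> 1" for n by (auto simp: w_def field_simps)
  have w0: "w \<longlonglongrightarrow> 0" unfolding w_def by (rule LIMSEQ_inverse_real_of_nat)
  define D where "D n x = (u (x + w n *\<^sub>R ?e) - u x) / w n" for n x
  have limD: "(\<lambda>n. D n x) \<longlonglongrightarrow> ?v x" for x
  proof -
    have "((\<lambda>h. (u (x + (0 + h) *\<^sub>R ?e) - u (x + 0 *\<^sub>R ?e)) / h) \<longlongrightarrow> ?v x) (at 0)"
      using line[of x 0] unfolding has_field_derivative_def[symmetric] DERIV_def by simp
    moreover have "filterlim w (at 0) sequentially"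
      using w0 w(1) by (simp add: filterlim_at less_imp_neq[symmetric] eventuallyI)
    ultimately show ?thesis
      unfolding D_def by (auto dest: filterlim_compose)
  qed
  have bound: "norm (D n x) \<le> indicator (cball 0 (R + 1)) x *\<^sub>R B" for n x
  proof (cases "x \<in> cball 0 (R + 1)")
    case True
    obtain z where "u (x + w n *\<^sub>R ?e) - u (x + 0 *\<^sub>R ?e) = (w n - 0) * ?v (x + z *\<^sub>R ?e)"
      using MVT2[of 0 "w n" "\<lambda>t. u (x + t *\<^sub>R ?e)" "\<lambda>t. ?v (x + t *\<^sub>R ?e)"] w line by blast
    then have "D n x = ?v (x + z *\<^sub>R ?e)" using w(1)[of n] by (simp add: D_def)
    then show ?thesis using True vB by simp
  next
    case False
    have "norm x \<le> norm (x + w n *\<^sub>R ?e) + norm (w n *\<^sub>R ?e)"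
      using norm_triangle_ineq4[of "x + w n *\<^sub>R ?e" "w n *\<^sub>R ?e"] by simp
    then have "norm (x + w n *\<^sub>R ?e) > R" "norm x > R"
      using False w[of n] by (auto simp: norm_axis_1)
    then have "u (x + w n *\<^sub>R ?e) = 0" "u x = 0" using supp R by (meson not_le)+
    then show ?thesis using False by (simp add: D_def)
  qed
  have shift: "integrable lborel (\<lambda>x. u (x + c)) \<and> (LINT x|lborel. u (x + c)) = integral\<^sup>L lborel u" for c
  proof -
    have m: "u \<in> borel_measurable borel"
      using contu by (simp add: borel_measurable_continuous_onI)
    have "integrable (distr lborel borel ((+) c)) u"
      using intu lborel_distr_plus[of c] by simp
    then have 1: "integrable lborel (\<lambda>x. u (c + x))" using m by (subst (asm) integrable_distr_eq) auto
    have "integral\<^sup>L (distr lborel borel ((+) c)) u = integral\<^sup>L lborel u"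
      using lborel_distr_plus[of c] by simp
    then have "(LINT x|lborel. u (c + x)) = integral\<^sup>L lborel u"
      using m by (subst (asm) integral_distr) auto
    then show ?thesis using 1 by (simp add: add.commute)
  qed
  have intD: "integral\<^sup>L lborel (D n) = 0" for n
    unfolding D_def using shift[of "w n *\<^sub>R ?e"] intu by (simp add: integral_diff)
  have "(\<lambda>n. integral\<^sup>L lborel (D n)) \<longlonglongrightarrow> integral\<^sup>L lborel ?v"
  proof (rule integral_dominated_convergence[where w = "\<lambda>x. indicator (cball 0 (R + 1)) x *\<^sub>R B"])
    show "?v \<in> borel_measurable lborel"
      using contv by (simp add: borel_measurable_continuous_onI)
    show "D n \<in> borel_measurable lborel" for n
    proof -
      have "continuous_on UNIV (D n)" unfolding D_def
        by (intro continuous_intros continuous_on_compose2[OF contu]) (use w(1)[of n] in auto)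
      then show ?thesis by (simp add: borel_measurable_continuous_onI)
    qed
    \<comment> \<open>the steps \<open>w n\<close> are at most \<open>1\<close>, so all difference quotients vanish outside the ball of radius \<open>R + 1\<close>\<close>
    show "integrable lborel (\<lambda>x. indicator (cball 0 (R + 1)) x *\<^sub>R B :: real)"
      by (rule borel_integrable_compact) auto
  qed (use limD bound in auto)
  then show "integral\<^sup>L lborel ?v = 0" using intD LIMSEQ_unique by (simp add: LIMSEQ_const_iff)
qed

section \<open>Change of variables for nonnegative functions\<close>

text \<open>
  The determinant and the Lebesgue measure do not depend on an order of the coordinates, while the change
  of variables theorem for \<open>real^'m\<close> is about a well-ordered index type \<open>'m\<close>. Numbering the elements of a
  finite type \<open>'n\<close> gives such an index type of the same size, and relabelling coordinates transports the
  theorem to \<open>real^'n\<close>.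
\<close>

typedef ('n::finite) ordered_index = "{..<CARD('n)}"
  morphisms index_nat nat_index
  using zero_less_card_finite by blast

instantiation ordered_index :: (finite) "{finite,wellorder}"
begin

definition less_eq_ordered_index :: "'a ordered_index \<Rightarrow> 'a ordered_index \<Rightarrow> bool" where
  "less_eq_ordered_index i j \<longleftrightarrow> index_nat i \<le> index_nat j"

definition less_ordered_index :: "'a ordered_index \<Rightarrow> 'a ordered_index \<Rightarrow> bool" where
  "less_ordered_index i j \<longleftrightarrow> index_nat i < index_nat j"

instance
proof
  show "finite (UNIV :: 'a ordered_index set)"
    by (subst type_definition.univ[OF type_definition_ordered_index]) simp
  show "P i" if "\<And>i. (\<And>j. j < i \<Longrightarrow> P j) \<Longrightarrow> P i" for P and i :: "'a ordered_index"
  proof (induction i rule: measure_induct_rule[of index_nat])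
    case (less i)
    show ?case by (rule that, rule less) (simp add: less_ordered_index_def)
  qed
qed (auto simp: less_eq_ordered_index_def less_ordered_index_def index_nat_inject)

end

lemma ex_bij_ordered_index: "\<exists>e :: 'n::finite ordered_index \<Rightarrow> 'n. bij e"
proof -
  have "card (UNIV :: 'n ordered_index set) = CARD('n)"
    using type_definition.card[OF type_definition_ordered_index] by simp
  then show ?thesis
    using finite_same_card_bij[of "UNIV :: 'n ordered_index set" "UNIV :: 'n set"]
    by simp
qed

lemma permutes_UNIV_iff_bij: "p permutes UNIV \<longleftrightarrow> bij p"
  by (simp add: permutes_univ bij_iff)

text \<open>
  A bijection conjugates transpositions to transpositions, and these generate the permutations.
\<close>

lemma sign_conjugate_bij:
  fixes e :: "'m::finite \<Rightarrow> 'n::finite"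
  assumes e: "bij e" and p: "p permutes (UNIV :: 'm set)"
  shows "sign (e \<circ> p \<circ> inv e) = sign p"
  using p finite
proof (induction p rule: permutes_induct)
  case id
  have "e \<circ> id \<circ> inv e = id" using bij_is_surj[OF e] by (simp add: surj_iff)
  then show ?case by (simp add: sign_id)
next
  case (swap a b p)
  have bij: "bij (e \<circ> p \<circ> inv e)"
    using swap e by (intro bij_comp bij_imp_bij_inv) (auto simp: permutes_UNIV_iff_bij)
  have perm: "permutation p" "permutation (e \<circ> p \<circ> inv e)"
    using swap bij by (auto intro!: permutes_imp_permutation[of UNIV] simp: permutes_UNIV_iff_bij)
  have ne: "e a \<noteq> e b" using swap e by (metis bij_is_inj injD)
  have "e \<circ> (Transposition.transpose a b \<circ> p) \<circ> inv e = Transposition.transpose (e a) (e b) \<circ> (e \<circ> p \<circ> inv e)"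
    using e by (auto simp: fun_eq_iff Transposition.transpose_def bij_is_inj[THEN inj_eq])
  moreover have "sign (Transposition.transpose (e a) (e b) \<circ> (e \<circ> p \<circ> inv e)) =
      sign (Transposition.transpose a b \<circ> p)"
    unfolding sign_compose[OF permutation_swap_id perm(1)]
      sign_compose[OF permutation_swap_id perm(2)] swap.IH sign_swap_id
    using \<open>a \<noteq> b\<close> ne by simp
  ultimately show ?case by (simp only:)
qed

lemma det_reindex:
  fixes A :: "'a::comm_ring_1^'n::finite^'n" and e :: "'m::finite \<Rightarrow> 'n"
  assumes e: "bij e"
  shows "det (\<chi> i j. A $ e i $ e j) = det A"
proof -
  have inve: "bij (inv e)" using e bij_imp_bij_inv by blast
  have ie [simp]: "inv e (e i) = i" "e (inv e k) = k" for i k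
    using e by (simp_all add: bij_is_inj bij_is_surj surj_f_inv_f)
  have bij: "bij_betw (\<lambda>p. e \<circ> p \<circ> inv e) {p. p permutes UNIV} {p. p permutes UNIV}"
  proof (rule bij_betwI[where g = "\<lambda>p. inv e \<circ> p \<circ> e"])
    show "(\<lambda>p. e \<circ> p \<circ> inv e) \<in> {p. p permutes UNIV} \<rightarrow> {p. p permutes UNIV}"
      using e inve by (auto simp: permutes_UNIV_iff_bij intro!: bij_comp)
    show "(\<lambda>p. inv e \<circ> p \<circ> e) \<in> {p. p permutes UNIV} \<rightarrow> {p. p permutes UNIV}"
      using e inve by (auto simp: permutes_UNIV_iff_bij intro!: bij_comp)
  qed (auto simp: fun_eq_iff)
  have "det A = (\<Sum>p\<in>{p. p permutes UNIV}. of_int (sign p) * (\<Prod>i\<in>UNIV. A $ i $ p i))"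
    by (simp add: det_def)
  also have "\<dots> = (\<Sum>p\<in>{p. p permutes UNIV}.
      of_int (sign (e \<circ> p \<circ> inv e)) * (\<Prod>i\<in>UNIV. A $ i $ (e \<circ> p \<circ> inv e) i))"
    by (rule sum.reindex_bij_betw[OF bij, symmetric])
  also have "\<dots> = (\<Sum>p\<in>{p. p permutes UNIV}. of_int (sign p) * (\<Prod>i\<in>UNIV. A $ e i $ e (p i)))"
  proof (rule sum.cong)
    fix p :: "'m \<Rightarrow> 'm" assume "p \<in> {p. p permutes UNIV}"
    moreover have "(\<Prod>i\<in>UNIV. A $ i $ (e \<circ> p \<circ> inv e) i) = (\<Prod>i\<in>UNIV. A $ e i $ e (p i))"
      using prod.reindex_bij_betw[OF e, of "\<lambda>i. A $ i $ (e \<circ> p \<circ> inv e) i"] by simp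
    ultimately show "of_int (sign (e \<circ> p \<circ> inv e)) * (\<Prod>i\<in>UNIV. A $ i $ (e \<circ> p \<circ> inv e) i) =
        of_int (sign p) * (\<Prod>i\<in>UNIV. A $ e i $ e (p i))"
      using sign_conjugate_bij[OF e] by simp
  qed simp
  finally show ?thesis by (simp add: det_def)
qed

lemma prod_Basis_vec:
  "(\<Prod>b\<in>(Basis :: (real^'n::finite) set). F b) = (\<Prod>i\<in>UNIV. F (axis i 1))"
proof -
  have B: "(Basis :: (real^'n) set) = (\<lambda>i. axis i 1) ` UNIV"
    by (auto simp: Basis_vec_def)
  have inj: "inj (\<lambda>i. axis i 1 :: real^'n)" by (auto simp: inj_def axis_eq_axis)
  show ?thesis unfolding B prod.reindex[OF inj] by simp
qed

definition reindex_vec :: "('n \<Rightarrow> 'm) \<Rightarrow> real^'m::finite \<Rightarrow> real^'n::finite" where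
  "reindex_vec s x = (\<chi> i. x $ s i)"

lemma linear_reindex_vec: "linear (reindex_vec s)"
  by (auto simp: reindex_vec_def linear_iff vec_eq_iff)

lemma bounded_linear_reindex_vec: "bounded_linear (reindex_vec s)"
  by (simp add: linear_reindex_vec linear_conv_bounded_linear[symmetric])

lemma borel_measurable_reindex_vec [measurable]: "reindex_vec s \<in> borel_measurable borel"
  by (intro borel_measurable_continuous_onI linear_continuous_on bounded_linear_reindex_vec)

lemma reindex_vec_inv:
  assumes "bij s"
  shows "reindex_vec s (reindex_vec (inv s) x) = x" "reindex_vec (inv s) (reindex_vec s y) = y"
  using assms by (auto simp: reindex_vec_def vec_eq_iff bij_is_inj bij_is_surj surj_f_inv_f)

lemma lborel_reindex_vec:
  fixes s :: "'n::finite \<Rightarrow> 'm::finite"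
  assumes s: "bij s"
  shows "distr lborel borel (reindex_vec s) = lborel"
proof (rule lborel_eqI[symmetric])
  fix l u :: "real^'n" assume le: "\<And>b. b \<in> Basis \<Longrightarrow> l \<bullet> b \<le> u \<bullet> b"
  have le': "l $ i \<le> u $ i" for i
    using le[of "axis i 1"] by (auto simp: Basis_vec_def inner_axis)
  let ?r = "reindex_vec (inv s) :: real^'n \<Rightarrow> real^'m"
  have s': "s (inv s k) = k" "inv s (s i) = i" for i k
    using s by (simp_all add: bij_is_inj bij_is_surj surj_f_inv_f)
  have *: "(\<forall>i. a $ i < b $ s i) \<longleftrightarrow> (\<forall>k. a $ inv s k < b $ k)"
     "(\<forall>i. b $ s i < a $ i) \<longleftrightarrow> (\<forall>k. b $ k < a $ inv s k)" for a :: "real^'n" and b :: "real^'m"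
    using s' by metis+
  have "reindex_vec s -` box l u = box (?r l) (?r u)"
    by (auto simp: mem_box_cart reindex_vec_def s') (metis s')+
  then have "emeasure (distr lborel borel (reindex_vec s)) (box l u) = emeasure lborel (box (?r l) (?r u))"
    by (subst emeasure_distr) auto
  also have "\<dots> = ennreal (\<Prod>k\<in>UNIV. u $ inv s k - l $ inv s k)"
  proof (subst emeasure_lborel_box)
    show "?r l \<bullet> b \<le> ?r u \<bullet> b" if "b \<in> Basis" for b
      using that le' by (auto simp: Basis_vec_def inner_axis reindex_vec_def)
  qed (simp add: prod_Basis_vec inner_axis, simp add: reindex_vec_def)
  also have "(\<Prod>k\<in>UNIV. u $ inv s k - l $ inv s k) = (\<Prod>i\<in>UNIV. u $ i - l $ i)"
    using prod.reindex_bij_betw[OF bij_imp_bij_inv[OF s], of "\<lambda>i. u $ i - l $ i"] .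
  finally show "emeasure (distr lborel borel (reindex_vec s)) (box l u) = ennreal (\<Prod>b\<in>Basis. (u - l) \<bullet> b)"
    by (simp add: prod_Basis_vec inner_axis)
qed simp

lemma nn_integral_reindex_vec:
  fixes s :: "'n::finite \<Rightarrow> 'm::finite" and f :: "real^'n \<Rightarrow> ennreal"
  assumes s: "bij s" and f: "f \<in> borel_measurable borel"
  shows "(\<integral>\<^sup>+x. f x \<partial>lborel) = (\<integral>\<^sup>+x. f (reindex_vec s x) \<partial>lborel)"
  by (subst lborel_reindex_vec[OF s, symmetric], subst nn_integral_distr) (use f in auto)

text \<open>
  For absolutely integrable functions this is the change of variables theorem for the gauge integral. That
  theorem also says that the two integrands are absolutely integrable simultaneously, so in the remaining
  case both sides are infinite.
\<close>

lemma nn_integral_change_of_variables_wellorder: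
  fixes \<phi> :: "real^'m::{finite,wellorder} \<Rightarrow> real^'m::_" and f :: "real^'m::_ \<Rightarrow> real"
  assumes S: "S \<in> sets borel"
    and der: "\<And>x. x \<in> S \<Longrightarrow> (\<phi> has_derivative \<phi>' x) (at x)" and inj: "inj_on \<phi> S"
    and pos: "\<And>y. y \<in> \<phi> ` S \<Longrightarrow> 0 \<le> f y"
    and mf: "(\<lambda>y. indicator (\<phi> ` S) y * f y) \<in> borel_measurable borel"
    and mg: "(\<lambda>x. indicator S x * (\<bar>det (matrix (\<phi>' x))\<bar> * f (\<phi> x))) \<in> borel_measurable borel"
  shows "(\<integral>\<^sup>+y. ennreal (indicator (\<phi> ` S) y * f y) \<partial>lborel) =
    (\<integral>\<^sup>+x. ennreal (indicator S x * (\<bar>det (matrix (\<phi>' x))\<bar> * f (\<phi> x))) \<partial>lborel)"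
proof -
  let ?D = "\<lambda>x. \<bar>det (matrix (\<phi>' x))\<bar> * f (\<phi> x)"
  have iff: "(?D absolutely_integrable_on S \<and> integral S ?D = b) \<longleftrightarrow>
      (f absolutely_integrable_on (\<phi> ` S) \<and> integral (\<phi> ` S) f = b)" for b
  proof -
    have leb: "S \<in> sets lebesgue" using S by simp
    \<comment> \<open>the theorem is about vector-valued integrands, so \<open>f\<close> is read as a function into \<open>real^1\<close>\<close>
    have scale: "\<bar>det (matrix (\<phi>' x))\<bar> *\<^sub>R (vec (f (\<phi> x)) :: real^1) = vec (?D x)" for x
      by (simp add: vec_eq_iff)
    have "((\<lambda>x. \<bar>det (matrix (\<phi>' x))\<bar> *\<^sub>R (vec (f (\<phi> x)) :: real^1)) absolutely_integrable_on S \<and>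
        integral S (\<lambda>x. \<bar>det (matrix (\<phi>' x))\<bar> *\<^sub>R (vec (f (\<phi> x)) :: real^1)) = vec b) \<longleftrightarrow>
      ((\<lambda>x. vec (f x) :: real^1) absolutely_integrable_on (\<phi> ` S) \<and>
        integral (\<phi> ` S) (\<lambda>x. vec (f x) :: real^1) = vec b)"
      by (rule has_absolute_integral_change_of_variables[OF leb _ inj])
        (rule has_derivative_at_withinI[OF der])
    then have "((\<lambda>x. vec (?D x) :: real^1) absolutely_integrable_on S \<and>
        integral S (\<lambda>x. vec (?D x) :: real^1) = vec b) \<longleftrightarrow>
      ((\<lambda>x. vec (f x) :: real^1) absolutely_integrable_on (\<phi> ` S) \<and>
        integral (\<phi> ` S) (\<lambda>x. vec (f x) :: real^1) = vec b)"
      unfolding scale .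
    then show ?thesis
      by (simp add: absolutely_integrable_on_1_iff[of S] absolutely_integrable_on_1_iff[of "\<phi> ` S"]
          integral_on_1_eq[of S] integral_on_1_eq[of "\<phi> ` S"] vec_eq_iff)
  qed
  have fin: "(\<integral>\<^sup>+y. ennreal (indicator T y * h y) \<partial>lborel) = ennreal (integral T h)"
    if "h absolutely_integrable_on T" "\<And>y. y \<in> T \<Longrightarrow> 0 \<le> h y" for h :: "real^'m::_ \<Rightarrow> real" and T
    using nn_integral_has_integral_lebesgue[of T h "integral T h"] that
      absolutely_integrable_on_def integrable_integral by blast
  have conv: "h absolutely_integrable_on T"
    if m: "(\<lambda>y. indicator T y * h y) \<in> borel_measurable borel" "\<And>y. y \<in> T \<Longrightarrow> 0 \<le> h y"
      and lt: "(\<integral>\<^sup>+y. ennreal (indicator T y * h y) \<partial>lborel) < \<infinity>" for h :: "real^'m::_ \<Rightarrow> real" and T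
  proof -
    have nn: "indicator T y * h y \<ge> 0" for y using that(2) by (auto simp: indicator_def)
    have "integrable lborel (\<lambda>y. indicator T y * h y)"
      by (rule integrableI_nonneg) (use m(1) lt nn in auto)
    then show ?thesis
      by (simp add: set_integrable_def integrable_completion m(1))
  qed
  have posD: "0 \<le> ?D x" if "x \<in> S" for x using pos that by simp
  show ?thesis
  proof (cases "f absolutely_integrable_on (\<phi> ` S)")
    case True
    then have "?D absolutely_integrable_on S" "integral S ?D = integral (\<phi> ` S) f"
      using iff by auto
    then show ?thesis using fin[OF _ posD] fin[OF True pos] by simp
  next
    case False
    then have "\<not> ?D absolutely_integrable_on S" using iff by auto
    then have "\<not> (\<integral>\<^sup>+x. ennreal (indicator S x * ?D x) \<partial>lborel) < \<infinity>"
      using conv[OF mg posD] by blast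
    moreover have "\<not> (\<integral>\<^sup>+y. ennreal (indicator (\<phi> ` S) y * f y) \<partial>lborel) < \<infinity>"
      using conv[OF mf pos] False by blast
    ultimately show ?thesis by (simp only: not_less infinity_ennreal_def top.extremum_unique)
  qed
qed

lemma nn_integral_change_of_variables:
  fixes \<phi> :: "real^'n::finite \<Rightarrow> real^'n" and f :: "real^'n \<Rightarrow> real"
  assumes S: "S \<in> sets borel"
    and der: "\<And>x. x \<in> S \<Longrightarrow> (\<phi> has_derivative \<phi>' x) (at x)" and inj: "inj_on \<phi> S"
    and pos: "\<And>y. y \<in> \<phi> ` S \<Longrightarrow> 0 \<le> f y"
    and mf: "(\<lambda>y. indicator (\<phi> ` S) y * f y) \<in> borel_measurable borel"
    and mg: "(\<lambda>x. indicator S x * (\<bar>det (matrix (\<phi>' x))\<bar> * f (\<phi> x))) \<in> borel_measurable borel"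
  shows "(\<integral>\<^sup>+y. ennreal (indicator (\<phi> ` S) y * f y) \<partial>lborel) =
    (\<integral>\<^sup>+x. ennreal (indicator S x * (\<bar>det (matrix (\<phi>' x))\<bar> * f (\<phi> x))) \<partial>lborel)"
proof -
  obtain e :: "'n ordered_index \<Rightarrow> 'n" where e: "bij e" using ex_bij_ordered_index by blast
  let ?s = "inv e"
  have s: "bij ?s" and inv_s: "inv ?s = e"
    using e by (auto simp: bij_imp_bij_inv inv_inv_eq)
  define R :: "real^'n ordered_index \<Rightarrow> real^'n" where "R = reindex_vec ?s"
  define Q :: "real^'n \<Rightarrow> real^'n ordered_index" where "Q = reindex_vec e"
  have RQ [simp]: "R (Q x) = x" "Q (R y) = y" for x y
    using reindex_vec_inv[OF s] by (simp_all add: R_def Q_def inv_s)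
  have mR [measurable]: "R \<in> borel_measurable borel" and mQ: "Q \<in> borel_measurable borel"
    by (simp_all add: R_def Q_def)
  have blR: "bounded_linear R" and blQ: "bounded_linear Q"
    by (simp_all add: R_def Q_def bounded_linear_reindex_vec)
  let ?S = "R -` S" and ?\<phi> = "\<lambda>x. Q (\<phi> (R x))" and ?d = "\<lambda>x v. Q (\<phi>' (R x) (R v))"
  have im: "indicator (?\<phi> ` ?S) y = (indicator (\<phi> ` S) (R y) :: real)" for y
  proof -
    have "y \<in> ?\<phi> ` ?S \<longleftrightarrow> R y \<in> \<phi> ` S"
    proof
      assume "R y \<in> \<phi> ` S"
      then obtain x where "x \<in> S" "R y = \<phi> x" by auto
      then have "Q x \<in> ?S" "y = ?\<phi> (Q x)" using RQ(2)[of y] by auto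
      then show "y \<in> ?\<phi> ` ?S" by blast
    qed auto
    then show ?thesis by (simp add: indicator_def)
  qed
  have detd: "det (matrix (?d x)) = det (matrix (\<phi>' (R x)))" for x
  proof -
    have Rax: "R (axis j 1) = axis (e j) 1" for j
      using e by (auto simp: R_def reindex_vec_def vec_eq_iff axis_def
          bij_is_inj bij_is_surj surj_f_inv_f)
    have "matrix (?d x) = (\<chi> i j. matrix (\<phi>' (R x)) $ e i $ e j)"
      by (simp add: matrix_def Rax Q_def vec_eq_iff) (simp add: reindex_vec_def)
    then show ?thesis using det_reindex[OF e] by simp
  qed
  have "(\<integral>\<^sup>+y. ennreal (indicator (\<phi> ` S) y * f y) \<partial>lborel) =
      (\<integral>\<^sup>+y. ennreal (indicator (\<phi> ` S) (R y) * f (R y)) \<partial>lborel)"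
    unfolding R_def by (rule nn_integral_reindex_vec[OF s]) (use mf in auto)
  also have "\<dots> = (\<integral>\<^sup>+y. ennreal (indicator (?\<phi> ` ?S) y * f (R y)) \<partial>lborel)"
    by (simp only: im)
  also have "\<dots> = (\<integral>\<^sup>+x. ennreal (indicator ?S x * (\<bar>det (matrix (?d x))\<bar> * f (R (?\<phi> x)))) \<partial>lborel)"
  proof (rule nn_integral_change_of_variables_wellorder)
    show "?S \<in> sets borel" using measurable_sets[OF mR S] by simp
    show "(?\<phi> has_derivative ?d x) (at x)" if "x \<in> ?S" for x
    proof -
      have "(R has_derivative R) (at x)" using blR by (rule bounded_linear_imp_has_derivative)
      from has_derivative_compose[OF this der[of "R x"]] that
      have "((\<lambda>x. \<phi> (R x)) has_derivative (\<lambda>v. \<phi>' (R x) (R v))) (at x)" by simp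
      then show ?thesis by (rule bounded_linear.has_derivative[OF blQ])
    qed
    show "inj_on ?\<phi> ?S"
    proof (rule inj_onI)
      fix x y assume "x \<in> ?S" "y \<in> ?S" "?\<phi> x = ?\<phi> y"
      then have "\<phi> (R x) = \<phi> (R y)" using RQ(1) by metis
      then have "R x = R y" using \<open>x \<in> ?S\<close> \<open>y \<in> ?S\<close> inj by (auto dest: inj_onD)
      then show "x = y" using RQ(2) by metis
    qed
    show "0 \<le> f (R y)" if "y \<in> ?\<phi> ` ?S" for y using that pos by auto
    show "(\<lambda>y. indicator (?\<phi> ` ?S) y * f (R y)) \<in> borel_measurable borel"
      unfolding im using measurable_compose[OF mR mf] by simp
    show "(\<lambda>x. indicator ?S x * (\<bar>det (matrix (?d x))\<bar> * f (R (?\<phi> x)))) \<in> borel_measurable borel"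
      using measurable_compose[OF mR mg] by (simp add: detd indicator_def)
  qed
  also have "\<dots> = (\<integral>\<^sup>+x. ennreal (indicator S (R x) * (\<bar>det (matrix (\<phi>' (R x)))\<bar> * f (\<phi> (R x)))) \<partial>lborel)"
    by (simp add: detd indicator_def)
  also have "\<dots> = (\<integral>\<^sup>+x. ennreal (indicator S x * (\<bar>det (matrix (\<phi>' x))\<bar> * f (\<phi> x))) \<partial>lborel)"
    unfolding R_def by (rule nn_integral_reindex_vec[OF s, symmetric]) (use mg in auto)
  finally show ?thesis .
qed

section \<open>Positive definite matrices\<close>

definition pos_def :: "real^'n::finite^'n \<Rightarrow> bool" where
  "pos_def A \<longleftrightarrow> transpose A = A \<and> (\<forall>v. v \<noteq> 0 \<longrightarrow> v \<bullet> (A *v v) > 0)"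

lemma sym_matrix_inner:
  fixes A :: "real^'n::finite^'n"
  assumes "transpose A = A"
  shows "u \<bullet> (A *v v) = (A *v u) \<bullet> v"
  using assms dot_lmul_matrix[of u A v] by (metis transpose_matrix_vector)

text \<open>
  Gram--Schmidt, one vector at a time: fewer than \<open>n\<close> vectors \<open>A v\<close> do not span, so some nonzero vector is
  Euclidean-orthogonal to all of them, that is, orthogonal to the vectors \<open>v\<close> for the form \<open>A\<close>.
\<close>

lemma pos_def_orthonormal_set:
  fixes A :: "real^'n::finite^'n"
  assumes A: "pos_def A"
  shows "m \<le> CARD('n) \<Longrightarrow> \<exists>B. finite B \<and> card B = m \<and>
    (\<forall>u\<in>B. \<forall>v\<in>B. u \<bullet> (A *v v) = (if u = v then 1 else 0))"
proof (induction m)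
  case 0
  then show ?case by (intro exI[of _ "{}"]) simp
next
  case (Suc m)
  then obtain B where B: "finite B" "card B = m"
    "\<And>u v. u \<in> B \<Longrightarrow> v \<in> B \<Longrightarrow> u \<bullet> (A *v v) = (if u = v then 1 else 0)" by auto
  have "dim ((*v) A ` B) \<le> card ((*v) A ` B)"
    using B(1) by (intro dim_le_card') auto
  also have "\<dots> < DIM(real^'n)" using Suc.prems B card_image_le[of B "(*v) A"] by simp
  finally obtain x where x: "x \<noteq> 0" "\<And>y. y \<in> span ((*v) A ` B) \<Longrightarrow> orthogonal x y"
    using orthogonal_to_subspace_exists by blast
  define c where "c = sqrt (x \<bullet> (A *v x))"
  have pos: "x \<bullet> (A *v x) > 0" using A x(1) by (simp add: pos_def_def)
  then have c: "c > 0" "c * c = x \<bullet> (A *v x)" by (auto simp: c_def)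
  let ?x = "x /\<^sub>R c"
  have 1: "?x \<bullet> (A *v ?x) = 1"
    using c(1) by (simp add: matrix_vector_mult_scaleR field_simps flip: c(2))
  have 2: "?x \<bullet> (A *v v) = 0" if "v \<in> B" for v
    using x(2)[of "A *v v"] that by (simp add: orthogonal_def span_base)
  have 3: "v \<bullet> (A *v ?x) = 0" if "v \<in> B" for v
    using 2[OF that] sym_matrix_inner[of A v ?x] A by (simp add: pos_def_def inner_commute)
  have "?x \<notin> B" using 2 B(3) 1 by force
  then show ?case
    by (intro exI[of _ "insert ?x B"]) (use B 1 2 3 in auto)
qed

lemma pos_def_orthonormal_frame:
  fixes A :: "real^'n::finite^'n"
  assumes A: "pos_def A"
  obtains E :: "real^'n^'n" where "transpose E ** A ** E = mat 1"
proof -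
  obtain B where B: "finite B" "card B = CARD('n)"
    "\<And>u v. u \<in> B \<Longrightarrow> v \<in> B \<Longrightarrow> u \<bullet> (A *v v) = (if u = v then 1 else 0)"
    using pos_def_orthonormal_set[OF A, of "CARD('n)"] by auto
  obtain b :: "'n \<Rightarrow> real^'n" where b: "bij_betw b UNIV B"
    using B finite_same_card_bij[of "UNIV :: 'n set" B] by auto
  let ?E = "\<chi> i j. b j $ i"
  have "(transpose ?E ** A ** ?E) $ j $ k = b j \<bullet> (A *v b k)" for j k
    by (simp add: matrix_matrix_mult_def transpose_def inner_vec_def matrix_vector_mult_def
        sum_distrib_left sum_distrib_right mult.assoc) (rule sum.swap)
  also have "\<dots> j k = (if j = k then 1 else 0)" for j k
    using B(3)[of "b j" "b k"] b by (auto simp: bij_betw_def dest: injD)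
  finally have "transpose ?E ** A ** ?E = mat 1"
    by (simp add: vec_eq_iff mat_def)
  then show ?thesis using that by blast
qed

lemma pos_def_det_pos:
  fixes A :: "real^'n::finite^'n"
  assumes "pos_def A"
  shows "det A > 0"
proof -
  obtain E :: "real^'n^'n" where "transpose E ** A ** E = mat 1"
    using pos_def_orthonormal_frame[OF assms] .
  then have "det E * det A * det E = 1" by (metis det_I det_mul det_transpose)
  then have "det A * (det E)\<^sup>2 = 1" by (simp add: power2_eq_square algebra_simps)
  then show ?thesis
    by (metis zero_less_mult_pos2 zero_less_one zero_le_power2 less_eq_real_def mult_zero_right zero_neq_one)
qed

lemma matrix_inv_mult:
  fixes A :: "real^'n::finite^'n"
  assumes "det A \<noteq> 0"
  shows "A ** matrix_inv A = mat 1" "matrix_inv A ** A = mat 1"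
proof -
  have "\<exists>B. A ** B = mat 1 \<and> B ** A = mat 1"
    using assms by (simp add: invertible_det_nz[symmetric] invertible_def)
  then have "A ** matrix_inv A = mat 1 \<and> matrix_inv A ** A = mat 1"
    unfolding matrix_inv_def by (rule someI_ex)
  then show "A ** matrix_inv A = mat 1" "matrix_inv A ** A = mat 1" by auto
qed

lemma matrix_inv_unique:
  fixes A :: "real^'n::finite^'n"
  assumes "A ** B = mat 1"
  shows "matrix_inv A = B"
proof -
  have "det A \<noteq> 0" using assms by (metis det_I det_mul mult_zero_left zero_neq_one)
  then show ?thesis
    using assms matrix_inv_mult(2)[of A] by (metis matrix_mul_assoc matrix_mul_lid matrix_mul_rid)
qed

lemma transpose_matrix_inv:
  fixes A :: "real^'n::finite^'n"
  assumes "transpose A = A" "det A \<noteq> 0"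
  shows "transpose (matrix_inv A) = matrix_inv A"
proof -
  have "transpose (matrix_inv A ** A) = mat 1" using matrix_inv_mult(2)[OF assms(2)] by (simp add: transpose_mat)
  then have "A ** transpose (matrix_inv A) = mat 1" using assms(1) by (simp add: matrix_transpose_mul)
  then show ?thesis using matrix_inv_unique by metis
qed

text \<open>
  Cramer's rule. It expresses the entries of the inverse as quotients of polynomials in the entries of
  \<open>A\<close>, which is how smoothness passes to the inverse metric.
\<close>

lemma matrix_inv_cofactor:
  fixes A :: "real^'n::finite^'n"
  assumes "det A \<noteq> 0"
  shows "matrix_inv A $ k $ l = det (\<chi> i j. if j = k then axis l 1 $ i else A $ i $ j) / det A"
proof -
  have "A *v (matrix_inv A *v axis l 1) = axis l 1"
    by (simp add: matrix_vector_mul_assoc matrix_inv_mult[OF assms])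
  then have "(matrix_inv A *v axis l 1) $ k = det (\<chi> i j. if j = k then axis l 1 $ i else A $ i $ j) / det A"
    unfolding cramer[OF assms] by (metis (lifting) vec_lambda_beta)
  moreover have "(matrix_inv A *v axis l 1) $ k = matrix_inv A $ k $ l"
    by (simp add: matrix_vector_mul_component inner_axis)
  ultimately show ?thesis by simp
qed

text \<open>
  For a metric \<open>A\<close> and a symmetric form \<open>S\<close> this is the squared norm of \<open>S\<close>. In an orthonormal frame
  \<open>E\<close> the inverse metric is \<open>E E\<^sup>T\<close>, so the trace is the sum of the squares of the entries of
  \<open>E\<^sup>T S E\<close>.
\<close>

lemma trace_inv_sym_square:
  fixes A S :: "real^'n::finite^'n"
  assumes A: "pos_def A" and S: "transpose S = S"
  shows "0 \<le> trace (matrix_inv A ** S ** (matrix_inv A ** S))"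
    and "trace (matrix_inv A ** S ** (matrix_inv A ** S)) = 0 \<Longrightarrow> S = 0"
proof -
  obtain E :: "real^'n^'n" where E: "transpose E ** A ** E = mat 1"
    using pos_def_orthonormal_frame[OF A] .
  have AE: "A ** E ** transpose E = mat 1"
    using E matrix_left_right_inverse[of "transpose E" "A ** E"] by (simp add: matrix_mul_assoc)
  then have inv: "matrix_inv A = E ** transpose E"
    by (intro matrix_inv_unique) (simp add: matrix_mul_assoc)
  have AE': "E ** transpose E ** A = mat 1"
    using AE matrix_left_right_inverse[of A "E ** transpose E"] by (simp add: matrix_mul_assoc)
  let ?T = "transpose E ** S ** E"
  have sym: "transpose ?T = ?T" using S by (simp add: matrix_transpose_mul matrix_mul_assoc)
  have "trace (matrix_inv A ** S ** (matrix_inv A ** S)) = trace (E ** (transpose E ** S ** E ** transpose E ** S))"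
    by (simp add: inv matrix_mul_assoc)
  also have "\<dots> = trace (?T ** ?T)"
    by (subst trace_mul_sym) (simp add: matrix_mul_assoc)
  also have "\<dots> = trace (transpose ?T ** ?T)" by (simp only: sym)
  also have "\<dots> = (\<Sum>i\<in>UNIV. \<Sum>j\<in>UNIV. (?T $ j $ i)\<^sup>2)"
    by (simp add: trace_def matrix_matrix_mult_def transpose_def power2_eq_square)
  finally have eq: "trace (matrix_inv A ** S ** (matrix_inv A ** S)) = (\<Sum>i\<in>UNIV. \<Sum>j\<in>UNIV. (?T $ j $ i)\<^sup>2)" .
  show "0 \<le> trace (matrix_inv A ** S ** (matrix_inv A ** S))"
    unfolding eq by (intro sum_nonneg) auto
  assume "trace (matrix_inv A ** S ** (matrix_inv A ** S)) = 0"
  then have "(\<Sum>i\<in>UNIV. \<Sum>j\<in>UNIV. (?T $ j $ i)\<^sup>2) = 0" by (simp only: eq)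
  then have "?T $ j $ i = 0" for i j
    by (subst (asm) sum_nonneg_eq_0_iff) (auto simp: sum_nonneg sum_nonneg_eq_0_iff)
  then have "?T = 0" by (simp add: vec_eq_iff)
  then have "A ** E ** ?T ** (transpose E ** A) = 0" by (simp add: matrix_matrix_mult_def vec_eq_iff)
  moreover have "A ** E ** ?T ** (transpose E ** A) = A ** E ** transpose E ** S ** (E ** transpose E ** A)"
    by (simp add: matrix_mul_assoc)
  ultimately show "S = 0" by (simp add: AE AE')
qed

lemma trace_similar:
  fixes J B C :: "real^'n::finite^'n"
  assumes "B ** J = J ** C" "det J \<noteq> 0"
  shows "trace B = trace C"
proof -
  have "B = J ** C ** matrix_inv J"
    using arg_cong[OF assms(1), of "\<lambda>m. m ** matrix_inv J"] matrix_inv_mult[OF assms(2)]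
    by (simp add: matrix_mul_assoc[symmetric])
  then have "trace B = trace (matrix_inv J ** (J ** C))" by (simp only: trace_mul_sym[of "J ** C"])
  then show ?thesis by (simp add: matrix_mul_assoc matrix_inv_mult[OF assms(2)])
qed

section \<open>Derivatives of determinants and inverse matrices\<close>

lemma Ck_on_det:
  fixes F :: "'m::finite \<Rightarrow> 'm \<Rightarrow> real^'n::finite \<Rightarrow> real"
  assumes "open S" "\<And>i j. Ck_on k S (F i j)"
  shows "Ck_on k S (\<lambda>x. det (\<chi> i j. F i j x))"
  unfolding det_def by (intro Ck_on_sum Ck_on_mult Ck_on_prod) (simp_all add: assms)

lemma Ck_on_matrix_inv:
  fixes F :: "real^'n::finite \<Rightarrow> real^'m::finite^'m"
  assumes S: "open S" and F: "\<And>i j. Ck_on k S (\<lambda>x. F x $ i $ j)" and inv: "\<And>x. x \<in> S \<Longrightarrow> det (F x) \<noteq> 0"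
  shows "Ck_on k S (\<lambda>x. matrix_inv (F x) $ a $ b)"
proof (rule Ck_on_cong[OF S])
  have "Ck_on k S (\<lambda>x. det (\<chi> i j. F x $ i $ j))" by (intro Ck_on_det S F)
  then have det: "Ck_on k S (\<lambda>x. det (F x))" by simp
  have "Ck_on k S (\<lambda>x. if j = a then axis b 1 $ i else F x $ i $ j)" for i j
    using F by (cases "j = a") auto
  then show "Ck_on k S (\<lambda>x. det (\<chi> i j. if j = a then axis b 1 $ i else F x $ i $ j) / det (F x))"
    by (intro Ck_on_divide S det inv Ck_on_det) auto
  show "det (\<chi> i j. if j = a then axis b 1 $ i else F x $ i $ j) / det (F x) = matrix_inv (F x) $ a $ b"
    if "x \<in> S" for x
    using matrix_inv_cofactor[OF inv[OF that]] by simp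
qed

lemma partial_deriv_sum:
  fixes f :: "'i \<Rightarrow> real^'n::finite \<Rightarrow> real"
  assumes "\<And>i. i \<in> I \<Longrightarrow> f i differentiable (at x)"
  shows "partial_deriv k (\<lambda>x. \<Sum>i\<in>I. f i x) x = (\<Sum>i\<in>I. partial_deriv k (f i) x)"
proof -
  have "((\<lambda>x. \<Sum>i\<in>I. f i x) has_derivative (\<lambda>v. \<Sum>i\<in>I. frechet_derivative (f i) (at x) v)) (at x)"
    by (intro has_derivative_sum) (use assms frechet_derivative_works in blast)
  from partial_deriv_eq[OF this] show ?thesis by (simp add: partial_deriv_def)
qed

text \<open>
  Jacobi's formula. The derivative of \<open>det F\<close> is the sum over \<open>i\<close> of the determinants of \<open>F\<close> with its \<open>i\<close>-th row
  differentiated. With \<open>C = F' F\<^sup>-\<^sup>1\<close> the differentiated row is the combination of the rows of \<open>F\<close> with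
  coefficients \<open>C\<^sub>i\<^sub>j\<close>, and only the coefficient \<open>C\<^sub>i\<^sub>i\<close> survives in the determinant.
\<close>

lemma partial_deriv_det:
  fixes F :: "real^'n::finite \<Rightarrow> real^'m::finite^'m"
  assumes F: "\<And>i j. (\<lambda>x. F x $ i $ j) differentiable (at x)" and inv: "det (F x) \<noteq> 0"
  shows "(\<lambda>x. det (F x)) differentiable (at x)"
    and "partial_deriv k (\<lambda>x. det (F x)) x =
      det (F x) * (\<Sum>i\<in>UNIV. \<Sum>j\<in>UNIV. matrix_inv (F x) $ j $ i * partial_deriv k (\<lambda>x. F x $ i $ j) x)"
proof -
  let ?P = "{p. p permutes (UNIV :: 'm set)}"
  let ?d = "\<lambda>i j. frechet_derivative (\<lambda>x. F x $ i $ j) (at x)"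
  have *: "((\<lambda>x. det (F x)) has_derivative (\<lambda>v. \<Sum>p\<in>?P. of_int (sign p) *
      (\<Sum>i\<in>UNIV. ?d i (p i) v * (\<Prod>j\<in>UNIV - {i}. F x $ j $ p j)))) (at x)"
    unfolding det_def
    by (intro has_derivative_sum has_derivative_mult_right has_derivative_prod)
      (use F frechet_derivative_works in blast)
  then show "(\<lambda>x. det (F x)) differentiable (at x)" by (auto simp: differentiable_def)
  define B where "B = (\<chi> i j. partial_deriv k (\<lambda>x. F x $ i $ j) x)"
  define C where "C = B ** matrix_inv (F x)"
  have CF: "C ** F x = B"
    by (simp add: C_def matrix_mul_assoc[symmetric] matrix_inv_mult[OF inv])
  have "partial_deriv k (\<lambda>x. det (F x)) x = (\<Sum>p\<in>?P. of_int (sign p) *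
      (\<Sum>i\<in>UNIV. B $ i $ p i * (\<Prod>j\<in>UNIV - {i}. F x $ j $ p j)))"
    using partial_deriv_eq[OF *] by (simp add: B_def partial_deriv_def)
  also have "\<dots> = (\<Sum>i\<in>UNIV. \<Sum>p\<in>?P. of_int (sign p) * (B $ i $ p i * (\<Prod>j\<in>UNIV - {i}. F x $ j $ p j)))"
    by (simp only: sum_distrib_left) (rule sum.swap)
  also have "\<dots> = (\<Sum>i\<in>UNIV. det (\<chi> j. if j = i then row i B else row j (F x)))"
  proof (rule sum.cong)
    fix i
    have "(\<Prod>j\<in>UNIV. (\<chi> j. if j = i then row i B else row j (F x)) $ j $ p j) =
        B $ i $ p i * (\<Prod>j\<in>UNIV - {i}. F x $ j $ p j)" for p
      by (subst prod.remove[of UNIV i]) (auto simp: row_def intro!: prod.cong)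
    then show "(\<Sum>p\<in>?P. of_int (sign p) * (B $ i $ p i * (\<Prod>j\<in>UNIV - {i}. F x $ j $ p j))) =
        det (\<chi> j. if j = i then row i B else row j (F x))"
      unfolding det_def by simp
  qed simp
  also have "\<dots> = (\<Sum>i\<in>UNIV. C $ i $ i * det (F x))"
  proof (rule sum.cong)
    fix i
    have "row i B = (\<Sum>j\<in>UNIV. C $ i $ j *s row j (F x))"
      by (simp add: CF[symmetric] vec_eq_iff row_def matrix_matrix_mult_def)
    then show "det (\<chi> j. if j = i then row i B else row j (F x)) = C $ i $ i * det (F x)"
      using cramer_lemma_transpose[of i "C $ i" "F x"] by (simp only:)
  qed simp
  finally show "partial_deriv k (\<lambda>x. det (F x)) x =
      det (F x) * (\<Sum>i\<in>UNIV. \<Sum>j\<in>UNIV. matrix_inv (F x) $ j $ i * partial_deriv k (\<lambda>x. F x $ i $ j) x)"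
    by (simp add: C_def B_def matrix_matrix_mult_def sum_distrib_left mult.commute)
qed

text \<open>
  Differentiate \<open>F\<^sup>-\<^sup>1 F = 1\<close>.
\<close>

lemma partial_deriv_matrix_inv:
  fixes F :: "real^'n::finite \<Rightarrow> real^'m::finite^'m"
  assumes S: "open S" "x \<in> S" and F: "\<And>i j. Ck_on 1 S (\<lambda>x. F x $ i $ j)"
    and inv: "\<And>x. x \<in> S \<Longrightarrow> det (F x) \<noteq> 0"
  shows "partial_deriv k (\<lambda>x. matrix_inv (F x) $ a $ b) x =
    - (\<Sum>i\<in>UNIV. \<Sum>j\<in>UNIV. matrix_inv (F x) $ a $ i * partial_deriv k (\<lambda>x. F x $ i $ j) x * matrix_inv (F x) $ j $ b)"
proof -
  let ?H = "\<lambda>x. matrix_inv (F x)"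
  have dF: "(\<lambda>x. F x $ i $ j) differentiable (at x)" for i j using F[of i j] S(2) by simp
  have dH: "(\<lambda>x. ?H x $ i $ j) differentiable (at x)" for i j
    using Ck_on_matrix_inv[OF S(1) F inv, of i j] S(2) by simp
  define dHm where "dHm = (\<chi> i j. partial_deriv k (\<lambda>x. ?H x $ i $ j) x)"
  define dFm where "dFm = (\<chi> i j. partial_deriv k (\<lambda>x. F x $ i $ j) x)"
  have "?H x ** dFm + dHm ** F x = 0"
  proof -
    have "(?H x ** dFm + dHm ** F x) $ i $ j = 0" for i j
    proof -
      have "(?H x ** dFm + dHm ** F x) $ i $ j = partial_deriv k (\<lambda>x. \<Sum>l\<in>UNIV. ?H x $ i $ l * F x $ l $ j) x"
        by (subst partial_deriv_sum)
          (auto simp: partial_deriv_mult dF dH matrix_matrix_mult_def dHm_def dFm_def sum.distrib intro: differentiable_mult)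
      also have "\<dots> = partial_deriv k (\<lambda>x. (mat 1 :: real^'m^'m) $ i $ j) x"
      proof (rule partial_deriv_cong[OF S])
        fix y assume "y \<in> S"
        from matrix_inv_mult(2)[OF inv[OF this]]
        show "(\<Sum>l\<in>UNIV. ?H y $ i $ l * F y $ l $ j) = (mat 1 :: real^'m^'m) $ i $ j"
          by (simp add: matrix_matrix_mult_def vec_eq_iff)
      qed
      also have "\<dots> = 0" by (simp add: partial_deriv_def)
      finally show ?thesis .
    qed
    then show ?thesis by (simp add: vec_eq_iff)
  qed
  then have "dHm ** F x = - (?H x ** dFm)" by (simp add: eq_neg_iff_add_eq_0 add.commute)
  then have "dHm ** (F x ** ?H x) = - (?H x ** dFm) ** ?H x" by (simp add: matrix_mul_assoc)
  then have "dHm = - (?H x ** dFm) ** ?H x" by (simp add: matrix_inv_mult[OF inv[OF S(2)]])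
  then have "dHm $ a $ b = (- (?H x ** dFm) ** ?H x) $ a $ b" by simp
  also have "\<dots> = - (\<Sum>j\<in>UNIV. \<Sum>i\<in>UNIV. ?H x $ a $ i * dFm $ i $ j * ?H x $ j $ b)"
    by (simp add: matrix_matrix_mult_def sum_distrib_right sum_negf)
  also have "(\<Sum>j\<in>UNIV. \<Sum>i\<in>UNIV. ?H x $ a $ i * dFm $ i $ j * ?H x $ j $ b) =
      (\<Sum>i\<in>UNIV. \<Sum>j\<in>UNIV. ?H x $ a $ i * dFm $ i $ j * ?H x $ j $ b)"
    by (rule sum.swap)
  finally show ?thesis by (simp add: dHm_def dFm_def)
qed

section \<open>Charts and transition maps\<close>

definition chart_Ck :: "nat \<Rightarrow> ('a, 'n::finite) chart \<Rightarrow> ('a \<Rightarrow> real) \<Rightarrow> bool" where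
  "chart_Ck k c f \<longleftrightarrow> Ck_on k (coord c ` chart_dom c) (\<lambda>x. f (chart_inv c x))"

lemma chart_smooth_imp_Ck: "chart_smooth c f \<Longrightarrow> chart_Ck k c f"
  by (simp add: chart_smooth_def smooth_on_def chart_Ck_def)

text \<open>
  The transformation law alone, separated from smoothness: the field to which the divergence theorem is
  applied only has to be \<open>C\<^sup>1\<close>.
\<close>

definition transforms_as_vector :: "('a, 'n::finite) chart set \<Rightarrow> ('a, 'n) vfield \<Rightarrow> bool" where
  "transforms_as_vector A Y \<longleftrightarrow> (\<forall>c\<in>A. \<forall>d\<in>A. \<forall>p \<in> chart_dom c \<inter> chart_dom d. \<forall>k.
        Y d p $ k = (\<Sum>i\<in>UNIV. jac c d p k i * Y c p $ i))"

definition Jac :: "('a, 'n::finite) chart \<Rightarrow> ('a, 'n) chart \<Rightarrow> 'a \<Rightarrow> real^'n^'n" where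
  "Jac c d p = (\<chi> k i. jac c d p k i)"

locale manifold_atlas =
  fixes M :: "'a topology" and A :: "('a, 'n::finite) chart set"
  assumes closed_manifold: "closed_manifold M A"
begin

lemma atlas: "smooth_atlas M A" and compact_M: "compact_space M" and Hausdorff_M: "Hausdorff_space M"
  using closed_manifold by (auto simp: closed_manifold_def)

lemma topspace_M: "topspace M = (\<Union>c\<in>A. chart_dom c)"
  using atlas by (simp add: smooth_atlas_def)

lemma chart_at: "p \<in> topspace M \<Longrightarrow> chart_at A p \<in> A \<and> p \<in> chart_dom (chart_at A p)"
  unfolding chart_at_def topspace_M by (rule someI_ex) auto

context
  fixes c assumes c: "c \<in> A"
begin

lemma is_chart: "is_chart M c"
  using atlas c by (simp add: smooth_atlas_def)

lemma openin_dom: "openin M (chart_dom c)"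
  using is_chart by (simp add: is_chart_def)

lemma dom_subset: "chart_dom c \<subseteq> topspace M"
  using openin_dom openin_subset by blast

lemma open_img: "open (coord c ` chart_dom c)"
  using is_chart by (simp add: is_chart_def)

lemma homeo_coord: "homeomorphic_map (subtopology M (chart_dom c)) (top_of_set (coord c ` chart_dom c)) (coord c)"
  using is_chart by (simp add: is_chart_def)

lemma inj_coord: "inj_on (coord c) (chart_dom c)"
  using homeomorphic_imp_injective_map[OF homeo_coord] dom_subset by (simp add: Int_absorb1)

lemma chart_inv_coord: "p \<in> chart_dom c \<Longrightarrow> chart_inv c (coord c p) = p"
  by (simp add: chart_inv_def inj_coord)

lemma coord_chart_inv: "x \<in> coord c ` chart_dom c \<Longrightarrow> coord c (chart_inv c x) = x"
  by (simp add: chart_inv_def f_inv_into_f)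

lemma chart_inv_in: "x \<in> coord c ` chart_dom c \<Longrightarrow> chart_inv c x \<in> chart_dom c"
  by (simp add: chart_inv_def inv_into_into)

lemma open_coord_image:
  assumes "openin M U"
  shows "open (coord c ` (U \<inter> chart_dom c))"
proof -
  have "openin (subtopology M (chart_dom c)) (U \<inter> chart_dom c)"
    using assms by (auto simp: openin_subtopology)
  then have "openin (top_of_set (coord c ` chart_dom c)) (coord c ` (U \<inter> chart_dom c))"
    using homeomorphic_imp_open_map[OF homeo_coord] by (simp add: open_map_def)
  then show ?thesis using open_img openin_open_trans by blast
qed

lemma openin_coord_vimage:
  assumes "open V"
  shows "openin M {p \<in> chart_dom c. coord c p \<in> V}"
proof -
  have "openin (subtopology M (chart_dom c)) {p \<in> topspace (subtopology M (chart_dom c)). coord c p \<in> V \<inter> coord c ` chart_dom c}"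
    using homeomorphic_imp_continuous_map[OF homeo_coord] assms
    by (intro openin_continuous_map_preimage) (auto simp: openin_open intro!: exI[of _ V])
  moreover have "{p \<in> topspace (subtopology M (chart_dom c)). coord c p \<in> V \<inter> coord c ` chart_dom c} =
      {p \<in> chart_dom c. coord c p \<in> V}" using dom_subset by auto
  ultimately show ?thesis by (simp add: openin_open_subtopology[OF openin_dom])
qed

lemma continuous_map_chart_inv: "continuous_map (top_of_set (coord c ` chart_dom c)) M (chart_inv c)"
proof -
  have "{x \<in> coord c ` chart_dom c. chart_inv c x \<in> U} = coord c ` (U \<inter> chart_dom c)" for U
    by (auto simp: chart_inv_coord)
  then show ?thesis
    using dom_subset chart_inv_in open_coord_image
    unfolding continuous_map_def by (simp add: openin_open_eq[OF open_img] Pi_def) blast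
qed

lemma compactin_chart_inv_image:
  assumes "compact K" "K \<subseteq> coord c ` chart_dom c"
  shows "compactin M (chart_inv c ` K)"
  by (rule image_compactin[OF _ continuous_map_chart_inv])
    (use assms in \<open>simp add: compactin_subtopology\<close>)

lemma chart_Ck_imp_differentiable:
  assumes "chart_Ck (Suc k) c f" "p \<in> chart_dom c"
  shows "(\<lambda>x. f (chart_inv c x)) differentiable (at (coord c p))"
  using assms by (simp add: chart_Ck_def)

lemma continuous_chart_deriv:
  assumes "chart_Ck 1 c f"
  shows "chart_Ck 0 c (chart_deriv c i f)"
proof -
  have "Ck_on 0 (coord c ` chart_dom c) (partial_deriv i (\<lambda>x. f (chart_inv c x)))"
    using assms by (simp add: chart_Ck_def)
  then show ?thesis unfolding chart_Ck_def
    by (rule Ck_on_cong[OF open_img, rotated]) (simp add: chart_deriv_def coord_chart_inv)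
qed

lemma chart_Ck_cong:
  assumes "\<And>p. p \<in> chart_dom c \<Longrightarrow> f p = h p" "chart_Ck k c f"
  shows "chart_Ck k c h"
  using Ck_on_cong[OF open_img _ assms(2)[unfolded chart_Ck_def]] assms(1) chart_inv_in
  by (simp add: chart_Ck_def)

lemma chart_deriv_cong:
  assumes "openin M U" "p \<in> U" "p \<in> chart_dom c" "\<And>q. q \<in> U \<Longrightarrow> q \<in> chart_dom c \<Longrightarrow> f q = h q"
  shows "chart_deriv c i f p = chart_deriv c i h p"
  unfolding chart_deriv_def
proof (rule partial_deriv_cong[OF open_coord_image[OF assms(1)]])
  show "coord c p \<in> coord c ` (U \<inter> chart_dom c)" using assms by auto
  show "f (chart_inv c y) = h (chart_inv c y)" if "y \<in> coord c ` (U \<inter> chart_dom c)" for y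
    using that assms(4) by (auto simp: chart_inv_coord)
qed

lemma chart_deriv_coord:
  assumes "p \<in> chart_dom c"
  shows "chart_deriv c i (\<lambda>p'. coord c p' $ k) p = (if i = k then 1 else 0)"
proof -
  have "chart_deriv c i (\<lambda>p'. coord c p' $ k) p = partial_deriv i (\<lambda>x. x $ k) (coord c p)"
    unfolding chart_deriv_def
    by (rule partial_deriv_cong[OF open_img]) (use assms coord_chart_inv in auto)
  also have "\<dots> = axis i 1 $ k"
    by (rule partial_deriv_eq) (rule bounded_linear_imp_has_derivative[OF bounded_linear_vec_nth])
  finally show ?thesis by (simp add: axis_def)
qed

end

context
  fixes c d assumes c: "c \<in> A" and d: "d \<in> A"
begin

lemma open_overlap: "open (coord c ` (chart_dom c \<inter> chart_dom d))"
  using open_coord_image[OF c openin_dom[OF d]] by (simp add: Int_commute)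

lemma transition_Ck:
  "Ck_on k (coord c ` (chart_dom c \<inter> chart_dom d)) (\<lambda>x. coord d (chart_inv c x) $ i)"
  using atlas c d by (auto simp: smooth_atlas_def smooth_on_def)

lemma transition_has_derivative:
  assumes p: "p \<in> chart_dom c" "p \<in> chart_dom d"
  shows "((\<lambda>x. coord d (chart_inv c x)) has_derivative (\<lambda>v. Jac c d p *v v)) (at (coord c p))"
proof -
  have "(\<lambda>x. coord d (chart_inv c x) $ k) differentiable (at (coord c p))" for k
    using transition_Ck[of 1 k] p by simp
  from has_derivative_partial_deriv[OF this]
  have "((\<lambda>x. coord d (chart_inv c x) $ k) has_derivative (\<lambda>v. (Jac c d p *v v) $ k)) (at (coord c p))" for k
    by (simp add: matrix_vector_mult_def Jac_def jac_def chart_deriv_def mult.commute)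
  then show ?thesis
    by (subst has_derivative_componentwise_within) (auto simp: Basis_vec_def inner_axis)
qed

lemma chart_deriv_change:
  assumes p: "p \<in> chart_dom c" "p \<in> chart_dom d"
    and f: "(\<lambda>x. f (chart_inv d x)) differentiable (at (coord d p))"
  shows "chart_deriv c i f p = (\<Sum>k\<in>UNIV. jac c d p k i * chart_deriv d k f p)"
proof -
  have D: "((\<lambda>x. f (chart_inv d x)) has_derivative (\<lambda>v. \<Sum>k\<in>UNIV. v $ k * chart_deriv d k f p))
      (at (coord d (chart_inv c (coord c p))))"
    using has_derivative_partial_deriv[OF f] p c by (simp add: chart_deriv_def chart_inv_coord)
  have "((\<lambda>x. f (chart_inv d (coord d (chart_inv c x)))) has_derivative
      (\<lambda>v. \<Sum>k\<in>UNIV. (Jac c d p *v v) $ k * chart_deriv d k f p)) (at (coord c p))"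
    using has_derivative_compose[OF transition_has_derivative[OF p] D] .
  then have "((\<lambda>x. f (chart_inv c x)) has_derivative
      (\<lambda>v. \<Sum>k\<in>UNIV. (Jac c d p *v v) $ k * chart_deriv d k f p)) (at (coord c p))"
    by (rule has_derivative_transform_within_open[OF _ open_overlap])
      (use p in \<open>auto simp: chart_inv_coord[OF c] chart_inv_coord[OF d]\<close>)
  from partial_deriv_eq[OF this] show ?thesis
    by (simp add: chart_deriv_def Jac_def matrix_vector_mul_component inner_axis)
qed

text \<open>
  The chain rule, applied to the coordinate functions of \<open>c\<close> themselves.
\<close>

lemma Jac_mult:
  assumes p: "p \<in> chart_dom c" "p \<in> chart_dom d"
  shows "Jac d c p ** Jac c d p = mat 1"
proof -
  have "(Jac d c p ** Jac c d p) $ k $ i = (if i = k then 1 else 0)" for k i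
  proof -
    have "Ck_on 1 (coord d ` (chart_dom d \<inter> chart_dom c)) (\<lambda>x. coord c (chart_inv d x) $ k)"
      using atlas c d unfolding smooth_atlas_def smooth_on_def by blast
    then have "(\<lambda>x. coord c (chart_inv d x) $ k) differentiable (at (coord d p))" using p by simp
    from chart_deriv_change[OF p this, of i]
    show ?thesis using chart_deriv_coord[OF c p(1), of i k]
      by (simp add: Jac_def jac_def matrix_matrix_mult_def mult.commute)
  qed
  then show ?thesis by (auto simp: vec_eq_iff mat_def)
qed

end

lemma transforms_as_vectorD:
  assumes "transforms_as_vector A Y" "c \<in> A" "d \<in> A" "p \<in> chart_dom c" "p \<in> chart_dom d"
  shows "Y d p = Jac c d p *v Y c p"
  using assms by (simp add: transforms_as_vector_def vec_eq_iff Jac_def matrix_vector_mult_def)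

text \<open>
  The Jacobian with which the components of \<open>Y\<close> change cancels the one that the chain rule produces for the
  derivatives of \<open>f\<close>.
\<close>

lemma lie_fun_eq:
  assumes Y: "transforms_as_vector A Y" and f: "\<And>c. c \<in> A \<Longrightarrow> chart_Ck 1 c f"
    and c: "c \<in> A" and p: "p \<in> chart_dom c"
  shows "lie_fun A Y f p = (\<Sum>k\<in>UNIV. Y c p $ k * chart_deriv c k f p)"
proof -
  let ?d = "chart_at A p"
  have d: "?d \<in> A" "p \<in> chart_dom ?d" using chart_at p dom_subset[OF c] by auto
  have df: "(\<lambda>x. f (chart_inv ?d x)) differentiable (at (coord ?d p))"
    using chart_Ck_imp_differentiable[OF d(1) _ d(2), of 0 f] f[OF d(1)] by simp
  have "(\<Sum>k\<in>UNIV. Y c p $ k * chart_deriv c k f p) =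
      (\<Sum>k\<in>UNIV. \<Sum>l\<in>UNIV. jac c ?d p l k * Y c p $ k * chart_deriv ?d l f p)"
    by (simp add: chart_deriv_change[OF c d(1) p d(2) df] sum_distrib_left algebra_simps)
  also have "\<dots> = (\<Sum>l\<in>UNIV. \<Sum>k\<in>UNIV. jac c ?d p l k * Y c p $ k * chart_deriv ?d l f p)"
    by (rule sum.swap)
  also have "\<dots> = (\<Sum>l\<in>UNIV. Y ?d p $ l * chart_deriv ?d l f p)"
  proof -
    have "Y ?d p $ l = (\<Sum>k\<in>UNIV. jac c ?d p l k * Y c p $ k)" for l
      using Y c d p by (simp add: transforms_as_vector_def)
    then show ?thesis by (simp add: sum_distrib_right)
  qed
  finally show ?thesis by (simp add: lie_fun_def Let_def)
qed

lemma tensor_fieldD: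
  assumes "tensor_field A q" "c \<in> A" "d \<in> A" "p \<in> chart_dom c" "p \<in> chart_dom d"
  shows "q c p = transpose (Jac c d p) ** q d p ** Jac c d p"
proof -
  have "q c p $ i $ j = (transpose (Jac c d p) ** q d p ** Jac c d p) $ i $ j" for i j
  proof -
    have "q c p $ i $ j = (\<Sum>k\<in>UNIV. \<Sum>l\<in>UNIV. jac c d p k i * jac c d p l j * q d p $ k $ l)"
      using assms unfolding tensor_field_def by blast
    also have "\<dots> = (\<Sum>l\<in>UNIV. \<Sum>k\<in>UNIV. jac c d p k i * jac c d p l j * q d p $ k $ l)"
      by (rule sum.swap)
    also have "\<dots> = (transpose (Jac c d p) ** q d p ** Jac c d p) $ i $ j"
      by (simp add: matrix_matrix_mult_def transpose_def Jac_def sum_distrib_right sum_distrib_left mult_ac)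
    finally show ?thesis .
  qed
  then show ?thesis by (simp add: vec_eq_iff)
qed

end

section \<open>Riemannian metrics\<close>

locale riemannian_atlas = manifold_atlas M A
  for M :: "'a topology" and A :: "('a, 'n::finite) chart set" +
  fixes g :: "('a, 'n) tensor2"
  assumes metric: "riemannian_metric A g"
begin

abbreviation vol_dens :: "('a, 'n) chart \<Rightarrow> 'a \<Rightarrow> real" where
  "vol_dens c p \<equiv> sqrt (det (g c p))"

abbreviation raise :: "('a, 'n) tensor2 \<Rightarrow> ('a, 'n) chart \<Rightarrow> 'a \<Rightarrow> real^'n^'n" where
  "raise q c p \<equiv> matrix_inv (g c p) ** q c p"

lemma g_tensor: "tensor_field A g"
  using metric by (auto simp: riemannian_metric_def symmetric_tensor_field_def)

lemma g_Ck: "c \<in> A \<Longrightarrow> chart_Ck k c (\<lambda>p. g c p $ i $ j)"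
  using g_tensor by (auto simp: tensor_field_def intro: chart_smooth_imp_Ck)

lemma pos_def_g: "c \<in> A \<Longrightarrow> p \<in> chart_dom c \<Longrightarrow> pos_def (g c p)"
  using metric by (auto simp: riemannian_metric_def symmetric_tensor_field_def pos_def_def)

lemma det_g_pos: "c \<in> A \<Longrightarrow> p \<in> chart_dom c \<Longrightarrow> det (g c p) > 0"
  using pos_def_g pos_def_det_pos by blast

lemma det_g_nz: "c \<in> A \<Longrightarrow> p \<in> chart_dom c \<Longrightarrow> det (g c p) \<noteq> 0"
  by (rule less_imp_neq[OF det_g_pos, symmetric])

lemma ginv_sym: "c \<in> A \<Longrightarrow> p \<in> chart_dom c \<Longrightarrow> matrix_inv (g c p) $ i $ j = matrix_inv (g c p) $ j $ i"
  using transpose_matrix_inv[of "g c p"] pos_def_g[of c p] det_g_nz[of c p]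
  by (simp add: pos_def_def vec_eq_iff transpose_def)

lemma ginv_Ck:
  assumes c: "c \<in> A"
  shows "chart_Ck k c (\<lambda>p. matrix_inv (g c p) $ i $ j)"
  unfolding chart_Ck_def
  by (rule Ck_on_matrix_inv[OF open_img[OF c]])
    (use g_Ck[OF c] det_g_nz[OF c] chart_inv_in[OF c] in \<open>auto simp: chart_Ck_def\<close>)

lemma vol_dens_Ck:
  assumes c: "c \<in> A"
  shows "chart_Ck 1 c (vol_dens c)"
  unfolding chart_Ck_def
proof (rule C1_on_compose[where f = "\<lambda>x. det (g c (chart_inv c x))" and d = "\<lambda>t. inverse (sqrt t) / 2",
      OF open_img[OF c]])
  have "Ck_on 1 (coord c ` chart_dom c) (\<lambda>x. det (\<chi> i j. g c (chart_inv c x) $ i $ j))"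
    by (intro Ck_on_det open_img c) (use g_Ck[OF c, of 1] in \<open>simp add: chart_Ck_def\<close>)
  then show "Ck_on 1 (coord c ` chart_dom c) (\<lambda>x. det (g c (chart_inv c x)))" by simp
  show "(sqrt has_real_derivative inverse (sqrt (det (g c (chart_inv c x)))) / 2) (at (det (g c (chart_inv c x))))"
    if "x \<in> coord c ` chart_dom c" for x
    using DERIV_real_sqrt[OF det_g_pos[OF c chart_inv_in[OF c that]]] .
  show "continuous_on ((\<lambda>x. det (g c (chart_inv c x))) ` coord c ` chart_dom c) (\<lambda>t. inverse (sqrt t) / 2)"
  proof (intro continuous_intros ballI)
    fix t assume "t \<in> (\<lambda>x. det (g c (chart_inv c x))) ` coord c ` chart_dom c"
    then obtain x where "x \<in> coord c ` chart_dom c" "t = det (g c (chart_inv c x))" by blast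
    then show "sqrt t \<noteq> 0" using det_g_nz[OF c chart_inv_in[OF c]] by simp
  qed simp
qed

lemma vol_dens_pos: "c \<in> A \<Longrightarrow> p \<in> chart_dom c \<Longrightarrow> vol_dens c p > 0"
  using det_g_pos by simp

lemma vol_dens_change:
  assumes "c \<in> A" "d \<in> A" "p \<in> chart_dom c" "p \<in> chart_dom d"
  shows "vol_dens c p = \<bar>det (Jac c d p)\<bar> * vol_dens d p"
proof -
  have "det (g c p) = (det (Jac c d p))\<^sup>2 * det (g d p)"
    by (simp add: tensor_fieldD[OF g_tensor assms] det_mul det_transpose power2_eq_square)
  then show ?thesis by (simp add: real_sqrt_mult)
qed

text \<open>
  Raising an index turns a bilinear form into an endomorphism, and endomorphisms change by conjugation
  with the Jacobian. Hence traces of powers of \<open>raise q\<close> are scalars on \<open>M\<close>.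
\<close>

lemma raise_change:
  assumes q: "tensor_field A q" and cd: "c \<in> A" "d \<in> A" "p \<in> chart_dom c" "p \<in> chart_dom d"
  shows "raise q d p ** Jac c d p = Jac c d p ** raise q c p"
proof -
  let ?J = "Jac c d p" and ?K = "Jac d c p"
  have KJ: "?K ** ?J = mat 1" and JK: "?J ** ?K = mat 1"
    using Jac_mult[of c d p] Jac_mult[of d c p] cd by auto
  have gc: "g c p = transpose ?J ** g d p ** ?J" and qc: "q c p = transpose ?J ** q d p ** ?J"
    using tensor_fieldD[OF g_tensor] tensor_fieldD[OF q] cd by blast+
  have "g c p ** (?K ** raise q d p ** ?J) = transpose ?J ** g d p ** (?J ** ?K) ** matrix_inv (g d p) ** q d p ** ?J"
    by (simp add: gc matrix_mul_assoc)
  also have "\<dots> = transpose ?J ** (g d p ** matrix_inv (g d p)) ** q d p ** ?J"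
    by (simp add: JK matrix_mul_assoc)
  also have "\<dots> = q c p" using cd by (simp add: matrix_inv_mult det_g_nz qc)
  finally have "matrix_inv (g c p) ** (g c p ** (?K ** raise q d p ** ?J)) = raise q c p" by simp
  then have "?K ** raise q d p ** ?J = raise q c p"
    using cd by (simp add: matrix_mul_assoc matrix_inv_mult det_g_nz)
  then have "?J ** (?K ** raise q d p ** ?J) = ?J ** raise q c p" by simp
  then show ?thesis using JK by (simp add: matrix_mul_assoc)
qed

lemma trace_raise_change:
  assumes q: "tensor_field A q" and cd: "c \<in> A" "d \<in> A" "p \<in> chart_dom c" "p \<in> chart_dom d"
  shows "trace (raise q d p) = trace (raise q c p)"
    and "trace (raise q d p ** raise q d p) = trace (raise q c p ** raise q c p)"
proof -
  have "det (Jac c d p) \<noteq> 0"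
    using Jac_mult[OF cd] by (metis det_I det_mul mult_zero_right zero_neq_one)
  moreover note raise_change[OF q cd]
  moreover have "raise q d p ** raise q d p ** Jac c d p = Jac c d p ** (raise q c p ** raise q c p)"
    using raise_change[OF q cd] by (metis matrix_mul_assoc)
  ultimately show "trace (raise q d p) = trace (raise q c p)"
    "trace (raise q d p ** raise q d p) = trace (raise q c p ** raise q c p)"
    using trace_similar by blast+
qed

lemma tr_eq:
  assumes q: "symmetric_tensor_field A q" and c: "c \<in> A" "p \<in> chart_dom c"
  shows "tr A g q p = trace (raise q c p)"
proof -
  let ?d = "chart_at A p"
  have d: "?d \<in> A" "p \<in> chart_dom ?d" using chart_at c dom_subset by blast+
  have sym: "q ?d p $ i $ j = q ?d p $ j $ i" for i j
    using q d by (simp add: symmetric_tensor_field_def vec_eq_iff transpose_def)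
  have "tr A g q p = (\<Sum>i\<in>UNIV. \<Sum>j\<in>UNIV. ginv g ?d p i j * q ?d p $ j $ i)"
    unfolding tr_def Let_def by (intro sum.cong refl) (simp only: sym[symmetric])
  then have "tr A g q p = trace (raise q ?d p)"
    by (simp add: trace_def matrix_matrix_mult_def)
  then show ?thesis
    using trace_raise_change(1)[of q c ?d p] q c d by (simp add: symmetric_tensor_field_def)
qed

lemma g_sym: "c \<in> A \<Longrightarrow> p \<in> chart_dom c \<Longrightarrow> g c p $ i $ j = g c p $ j $ i"
  using pos_def_g[of c p] by (simp add: pos_def_def vec_eq_iff transpose_def)

lemma chart_deriv_ginv:
  assumes c: "c \<in> A" "p \<in> chart_dom c"
  shows "chart_deriv c k (\<lambda>p. matrix_inv (g c p) $ a $ b) p =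
    - (\<Sum>i\<in>UNIV. \<Sum>j\<in>UNIV. matrix_inv (g c p) $ a $ i * chart_deriv c k (\<lambda>p. g c p $ i $ j) p * matrix_inv (g c p) $ j $ b)"
proof -
  have "coord c p \<in> coord c ` chart_dom c" using c by simp
  from partial_deriv_matrix_inv[OF open_img[OF c(1)] this, of "\<lambda>x. g c (chart_inv c x)"]
  show ?thesis
    using g_Ck[OF c(1), of 1] det_g_nz[OF c(1) chart_inv_in[OF c(1)]] chart_inv_coord[OF c]
    unfolding chart_deriv_def chart_Ck_def by simp
qed

lemma chart_deriv_vol_dens:
  assumes c: "c \<in> A" "p \<in> chart_dom c"
  shows "chart_deriv c k (vol_dens c) p = vol_dens c p * ((1/2) *
    (\<Sum>i\<in>UNIV. \<Sum>j\<in>UNIV. matrix_inv (g c p) $ i $ j * chart_deriv c k (\<lambda>p. g c p $ i $ j) p))"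
proof -
  let ?F = "\<lambda>x. g c (chart_inv c x)" and ?x = "coord c p"
  have x: "chart_inv c ?x = p" by (rule chart_inv_coord[OF c])
  have F: "(\<lambda>x. ?F x $ i $ j) differentiable (at ?x)" for i j
    using chart_Ck_imp_differentiable[OF c(1) _ c(2), of 0 "\<lambda>p. g c p $ i $ j"] g_Ck[OF c(1)] by simp
  have nz: "det (?F ?x) \<noteq> 0" using det_g_nz[OF c] x by simp
  have pos: "det (g c p) > 0" by (rule det_g_pos[OF c])
  have "chart_deriv c k (vol_dens c) p =
      inverse (sqrt (det (?F ?x))) / 2 * partial_deriv k (\<lambda>x. det (?F x)) ?x"
    unfolding chart_deriv_def
    by (rule partial_deriv_compose(2)[OF partial_deriv_det(1)[OF F nz] DERIV_real_sqrt])
      (use pos x in simp)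
  also have "partial_deriv k (\<lambda>x. det (?F x)) ?x = det (g c p) *
      (\<Sum>i\<in>UNIV. \<Sum>j\<in>UNIV. matrix_inv (g c p) $ j $ i * chart_deriv c k (\<lambda>p. g c p $ i $ j) p)"
    unfolding partial_deriv_det(2)[OF F nz] chart_deriv_def x ..
  also have "inverse (sqrt (det (?F ?x))) / 2 * (det (g c p) * s) = vol_dens c p * ((1/2) * s)" for s
    using pos by (simp add: x field_simps)
  finally show ?thesis using ginv_sym[OF c] by simp
qed

end

section \<open>The Riemannian volume measure\<close>

context manifold_atlas
begin

definition borel_M :: "'a measure" where
  "borel_M = sigma (topspace M) {U. openin M U}"

lemma opens_Pow: "{U. openin M U} \<subseteq> Pow (topspace M)"
  using openin_subset by auto

lemma space_borel_M [simp]: "space borel_M = topspace M"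
  by (simp add: borel_M_def space_measure_of[OF opens_Pow])

lemma sets_borel_M: "sets borel_M = sigma_sets (topspace M) {U. openin M U}"
  by (simp add: borel_M_def sets_measure_of[OF opens_Pow])

lemma openin_borel_M: "openin M U \<Longrightarrow> U \<in> sets borel_M"
  by (simp add: sets_borel_M sigma_sets.Basic)

lemma dom_borel_M: "c \<in> A \<Longrightarrow> chart_dom c \<in> sets borel_M"
  using openin_borel_M openin_dom by blast

lemma measurable_chart_inv:
  assumes c: "c \<in> A"
  shows "chart_inv c \<in> restrict_space borel (coord c ` chart_dom c) \<rightarrow>\<^sub>M borel_M"
proof -
  let ?S = "coord c ` chart_dom c"
  have S: "?S \<in> sets borel" using open_img[OF c] by simp
  show ?thesis unfolding borel_M_def
  proof (rule measurable_measure_of[OF opens_Pow])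
    show "chart_inv c \<in> space (restrict_space borel ?S) \<rightarrow> topspace M"
      using chart_inv_in[OF c] dom_subset[OF c] by (auto simp: space_restrict_space)
    fix U assume U: "U \<in> {U. openin M U}"
    have "chart_inv c -` U \<inter> ?S = coord c ` (U \<inter> chart_dom c)"
      by (auto simp: chart_inv_coord[OF c])
    moreover have "open (coord c ` (U \<inter> chart_dom c))" using U by (simp add: open_coord_image[OF c])
    ultimately show "chart_inv c -` U \<inter> space (restrict_space borel ?S) \<in> sets (restrict_space borel ?S)"
      using S by (auto simp: space_restrict_space sets_restrict_space_iff)
  qed
qed

text \<open>
  Continuity in every chart is continuity on \<open>M\<close>, because the chart domains form an open cover.
\<close>

lemma chart_continuous_openin:
  assumes f: "\<And>c. c \<in> A \<Longrightarrow> chart_Ck 0 c f" and U: "open U"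
  shows "openin M {p \<in> topspace M. f p \<in> U}"
proof -
  have "openin M {p \<in> chart_dom c. f p \<in> U}" if c: "c \<in> A" for c
  proof -
    have "continuous_on (coord c ` chart_dom c) (\<lambda>x. f (chart_inv c x))"
      using f[OF c] by (simp add: chart_Ck_def)
    then have "open ((\<lambda>x. f (chart_inv c x)) -` U \<inter> coord c ` chart_dom c)"
      using continuous_on_open_vimage[OF open_img[OF c]] U by blast
    from openin_coord_vimage[OF c this] show ?thesis
      by (rule back_subst[of "openin M"]) (auto simp: chart_inv_coord[OF c] dest: inj_onD[OF inj_coord[OF c]])
  qed
  then have "openin M (\<Union>c\<in>A. {p \<in> chart_dom c. f p \<in> U})" by blast
  moreover have "(\<Union>c\<in>A. {p \<in> chart_dom c. f p \<in> U}) = {p \<in> topspace M. f p \<in> U}"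
    by (auto simp: topspace_M)
  ultimately show ?thesis by simp
qed

lemma chart_continuous_measurable:
  assumes "\<And>c. c \<in> A \<Longrightarrow> chart_Ck 0 c f"
  shows "f \<in> borel_measurable borel_M"
proof (rule borel_measurableI)
  fix U :: "real set" assume "open U"
  from openin_borel_M[OF chart_continuous_openin[OF assms this]]
  show "f -` U \<inter> space borel_M \<in> sets borel_M"
    by (simp add: vimage_def Int_def conj_commute)
qed

lemma finite_chart_cover:
  obtains I where "finite I" "I \<subseteq> A" "topspace M = (\<Union>c\<in>I. chart_dom c)"
proof -
  have "\<exists>F. finite F \<and> F \<subseteq> chart_dom ` A \<and> topspace M \<subseteq> \<Union>F"
    using compact_M openin_dom topspace_M unfolding compact_space_alt by auto
  then obtain F where F: "finite F" "F \<subseteq> chart_dom ` A" "topspace M \<subseteq> \<Union>F" by blast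
  then obtain I where I: "finite I" "I \<subseteq> A" "F = chart_dom ` I" using finite_subset_image by metis
  then have "topspace M = (\<Union>c\<in>I. chart_dom c)" using F(3) topspace_M by auto
  then show ?thesis using that I by blast
qed

end

context riemannian_atlas
begin

text \<open>
  The part of the Riemannian volume that lies in one chart, as a measure on all of \<open>M\<close>.
\<close>

definition chart_measure :: "('a, 'n) chart \<Rightarrow> 'a measure" where
  "chart_measure c = distr (density (restrict_space lborel (coord c ` chart_dom c))
     (\<lambda>x. ennreal (vol_dens c (chart_inv c x)))) borel_M (chart_inv c)"

lemma space_chart_measure [simp]: "space (chart_measure c) = topspace M"
  and sets_chart_measure [simp, measurable_cong]: "sets (chart_measure c) = sets borel_M"
  by (simp_all add: chart_measure_def)

context
  fixes c assumes c: "c \<in> A"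
begin

lemma measurable_vol_dens_chart:
  "(\<lambda>x. vol_dens c (chart_inv c x)) \<in> borel_measurable (restrict_space borel (coord c ` chart_dom c))"
  using Ck_on_continuous[OF vol_dens_Ck[OF c, unfolded chart_Ck_def]]
  by (rule borel_measurable_continuous_on_restrict)

lemma measurable_chart_inv_lborel:
  "chart_inv c \<in> restrict_space lborel (coord c ` chart_dom c) \<rightarrow>\<^sub>M borel_M"
  using measurable_chart_inv[OF c] by (simp cong: measurable_cong_sets add: sets_restrict_space)

lemma measurable_vol_dens_lborel:
  "(\<lambda>x. vol_dens c (chart_inv c x)) \<in> borel_measurable (restrict_space lborel (coord c ` chart_dom c))"
  using measurable_vol_dens_chart by (simp cong: measurable_cong_sets add: sets_restrict_space)

lemma img_lborel: "coord c ` chart_dom c \<inter> space lborel \<in> sets lborel"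
  using open_img[OF c] by simp

lemma nn_integral_chart_measure:
  assumes f: "f \<in> borel_measurable borel_M"
  shows "(\<integral>\<^sup>+p. f p \<partial>chart_measure c) = (\<integral>\<^sup>+x\<in>coord c ` chart_dom c.
      (ennreal (vol_dens c (chart_inv c x)) * f (chart_inv c x)) \<partial>lborel)"
proof -
  have m: "(\<lambda>x. f (chart_inv c x)) \<in> borel_measurable (restrict_space lborel (coord c ` chart_dom c))"
    by (rule measurable_compose[OF measurable_chart_inv_lborel f])
  show ?thesis unfolding chart_measure_def
    by (subst nn_integral_distr)
      (use measurable_chart_inv_lborel f measurable_vol_dens_lborel m img_lborel in
        \<open>simp_all add: nn_integral_density nn_integral_restrict_space\<close>)
qed

lemma integral_chart_measure:
  fixes f :: "'a \<Rightarrow> real"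
  assumes f: "f \<in> borel_measurable borel_M"
  shows "integrable (chart_measure c) f \<longleftrightarrow> integrable lborel
      (\<lambda>x. indicator (coord c ` chart_dom c) x *\<^sub>R (vol_dens c (chart_inv c x) * f (chart_inv c x)))"
    and "(LINT p|chart_measure c. f p) = (LINT x|lborel.
      indicator (coord c ` chart_dom c) x *\<^sub>R (vol_dens c (chart_inv c x) * f (chart_inv c x)))"
proof -
  let ?S = "coord c ` chart_dom c"
  have m: "(\<lambda>x. f (chart_inv c x)) \<in> borel_measurable (restrict_space lborel ?S)"
    by (rule measurable_compose[OF measurable_chart_inv_lborel f])
  have pos: "AE x in restrict_space lborel ?S. 0 \<le> vol_dens c (chart_inv c x)"
    using vol_dens_pos[OF c chart_inv_in[OF c]] by (auto simp: space_restrict_space intro!: AE_I2 less_imp_le)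
  show "integrable (chart_measure c) f \<longleftrightarrow> integrable lborel
      (\<lambda>x. indicator ?S x *\<^sub>R (vol_dens c (chart_inv c x) * f (chart_inv c x)))"
    unfolding chart_measure_def
    by (subst integrable_distr_eq)
      (use measurable_chart_inv_lborel f measurable_vol_dens_lborel m pos img_lborel in
        \<open>simp_all add: integrable_density integrable_restrict_space\<close>)
  show "(LINT p|chart_measure c. f p) = (LINT x|lborel.
      indicator ?S x *\<^sub>R (vol_dens c (chart_inv c x) * f (chart_inv c x)))"
    unfolding chart_measure_def
    by (subst integral_distr)
      (use measurable_chart_inv_lborel f measurable_vol_dens_lborel m pos img_lborel in
        \<open>simp_all add: integral_density integral_restrict_space\<close>)
qed

lemma emeasure_chart_measure:
  assumes E: "E \<in> sets borel_M"
  shows "emeasure (chart_measure c) E =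
    (\<integral>\<^sup>+x\<in>coord c ` (E \<inter> chart_dom c). ennreal (vol_dens c (chart_inv c x)) \<partial>lborel)"
proof -
  have "emeasure (chart_measure c) E = (\<integral>\<^sup>+p. indicator E p \<partial>chart_measure c)"
    using E by (simp add: nn_integral_indicator)
  also have "\<dots> = (\<integral>\<^sup>+x\<in>coord c ` chart_dom c.
      (ennreal (vol_dens c (chart_inv c x)) * indicator E (chart_inv c x)) \<partial>lborel)"
    using E by (subst nn_integral_chart_measure) auto
  also have "\<dots> = (\<integral>\<^sup>+x\<in>coord c ` (E \<inter> chart_dom c). ennreal (vol_dens c (chart_inv c x)) \<partial>lborel)"
    by (intro nn_integral_cong) (auto simp: indicator_def chart_inv_coord[OF c])
  finally show ?thesis .
qed

lemma coord_image_borel: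
  assumes E: "E \<in> sets borel_M"
  shows "coord c ` (E \<inter> chart_dom c) \<in> sets borel"
proof -
  have "chart_inv c -` E \<inter> coord c ` chart_dom c \<in> sets (restrict_space borel (coord c ` chart_dom c))"
    using measurable_sets[OF measurable_chart_inv[OF c] E] by (simp add: space_restrict_space)
  moreover have "chart_inv c -` E \<inter> coord c ` chart_dom c = coord c ` (E \<inter> chart_dom c)"
    by (auto simp: chart_inv_coord[OF c])
  ultimately show ?thesis using open_img[OF c] by (simp add: sets_restrict_space_iff)
qed

lemma measurable_vol_dens_image:
  assumes E: "E \<in> sets borel_M"
  shows "(\<lambda>x. indicator (coord c ` (E \<inter> chart_dom c)) x * vol_dens c (chart_inv c x)) \<in> borel_measurable borel"
proof -
  let ?S = "coord c ` (E \<inter> chart_dom c)"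
  have "(\<lambda>x. indicator ?S x *\<^sub>R vol_dens c (chart_inv c x)) \<in> borel_measurable borel"
    by (rule borel_measurable_continuous_on_indicator[OF coord_image_borel[OF E]])
      (rule continuous_on_subset[OF Ck_on_continuous[OF vol_dens_Ck[OF c, unfolded chart_Ck_def]]], auto)
  then show ?thesis by simp
qed

end

text \<open>
  Change of variables along the transition map: the density changes by exactly the factor
  \<open>\<bar>det J\<bar>\<close>, since the Gram matrices satisfy \<open>det g\<^sub>c = (det J)\<^sup>2 det g\<^sub>d\<close>.
\<close>

lemma chart_measure_overlap:
  assumes c: "c \<in> A" and d: "d \<in> A" and E: "E \<in> sets borel_M" "E \<subseteq> chart_dom c" "E \<subseteq> chart_dom d"
  shows "emeasure (chart_measure c) E = emeasure (chart_measure d) E"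
proof -
  let ?\<phi> = "\<lambda>x. coord d (chart_inv c x)" and ?S = "coord c ` E"
  let ?f = "\<lambda>y. vol_dens d (chart_inv d y)"
  have Ec: "E \<inter> chart_dom c = E" and Ed: "E \<inter> chart_dom d = E" using E by auto
  have im: "?\<phi> ` ?S = coord d ` E"
    using E by (force simp: image_iff chart_inv_coord[OF c])
  have dens: "vol_dens c (chart_inv c x) =
      \<bar>det (matrix (\<lambda>v. Jac c d (chart_inv c x) *v v))\<bar> * ?f (?\<phi> x)" if "x \<in> ?S" for x
  proof -
    obtain p where p: "p \<in> E" "x = coord c p" using \<open>x \<in> ?S\<close> by auto
    have pc: "p \<in> chart_dom c" "p \<in> chart_dom d" using p E by auto
    show ?thesis
      using vol_dens_change[OF c d pc] by (simp add: p(2) chart_inv_coord[OF c pc(1)] chart_inv_coord[OF d pc(2)])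
  qed
  have "emeasure (chart_measure d) E = (\<integral>\<^sup>+y. ennreal (indicator (?\<phi> ` ?S) y * ?f y) \<partial>lborel)"
    unfolding emeasure_chart_measure[OF d E(1)] Ed im
    by (intro nn_integral_cong) (auto simp: indicator_def)
  also have "\<dots> = (\<integral>\<^sup>+x. ennreal (indicator ?S x *
      (\<bar>det (matrix (\<lambda>v. Jac c d (chart_inv c x) *v v))\<bar> * ?f (?\<phi> x))) \<partial>lborel)"
  proof (rule nn_integral_change_of_variables)
    show "?S \<in> sets borel" using coord_image_borel[OF c E(1)] by (simp add: Ec)
    show "(?\<phi> has_derivative (\<lambda>v. Jac c d (chart_inv c x) *v v)) (at x)" if "x \<in> ?S" for x
    proof -
      obtain p where p: "p \<in> E" "x = coord c p" using \<open>x \<in> ?S\<close> by auto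
      then have "p \<in> chart_dom c" "p \<in> chart_dom d" using E by auto
      from transition_has_derivative[OF c d this] chart_inv_coord[OF c this(1)] p(2)
      show ?thesis by simp
    qed
    show "inj_on ?\<phi> ?S"
    proof (rule inj_onI)
      fix x y assume xy: "x \<in> ?S" "y \<in> ?S" "?\<phi> x = ?\<phi> y"
      then obtain p q where pq: "p \<in> E" "q \<in> E" "x = coord c p" "y = coord c q" by auto
      then have "p \<in> chart_dom c" "q \<in> chart_dom c" "p \<in> chart_dom d" "q \<in> chart_dom d" using E by auto
      then have "coord d p = coord d q" using xy(3) by (simp add: pq chart_inv_coord[OF c])
      then have "p = q"
        using inj_onD[OF inj_coord[OF d]] \<open>p \<in> chart_dom d\<close> \<open>q \<in> chart_dom d\<close> by blast
      then show "x = y" by (simp add: pq)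
    qed
    show "0 \<le> ?f y" if "y \<in> ?\<phi> ` ?S" for y
    proof -
      from that obtain p where "p \<in> E" "y = coord d p" unfolding im by blast
      then show ?thesis using vol_dens_pos[OF d, of p] E by (auto simp: chart_inv_coord[OF d])
    qed
    show "(\<lambda>y. indicator (?\<phi> ` ?S) y * ?f y) \<in> borel_measurable borel"
      using measurable_vol_dens_image[OF d E(1)] by (simp add: im Ed)
    have "(\<lambda>x. indicator ?S x * (\<bar>det (matrix (\<lambda>v. Jac c d (chart_inv c x) *v v))\<bar> * ?f (?\<phi> x))) =
        (\<lambda>x. indicator ?S x * vol_dens c (chart_inv c x))"
      using dens by (auto simp: indicator_def)
    then show "(\<lambda>x. indicator ?S x * (\<bar>det (matrix (\<lambda>v. Jac c d (chart_inv c x) *v v))\<bar> * ?f (?\<phi> x)))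
        \<in> borel_measurable borel"
      using measurable_vol_dens_image[OF c E(1)] by (simp add: Ec)
  qed
  also have "\<dots> = emeasure (chart_measure c) E"
    unfolding emeasure_chart_measure[OF c E(1)] Ec
    by (intro nn_integral_cong) (auto simp: indicator_def dens)
  finally show ?thesis by simp
qed

lemma riemannian_volume_iff:
  "is_riemannian_volume M A g \<mu> \<longleftrightarrow> sets \<mu> = sets borel_M \<and>
     (\<forall>c\<in>A. \<forall>E\<in>sets borel_M. E \<subseteq> chart_dom c \<longrightarrow> emeasure \<mu> E = emeasure (chart_measure c) E)"
proof -
  have "space \<mu> = topspace M" if "sets \<mu> = sets borel_M"
    using sets_eq_imp_space_eq[OF that] by simp
  then show ?thesis
    unfolding is_riemannian_volume_def sets_borel_M[symmetric]
    by (auto simp: emeasure_chart_measure Int_absorb2)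
qed

lemma density_riemannian_volume:
  assumes \<mu>: "is_riemannian_volume M A g \<mu>" and c: "c \<in> A"
  shows "density \<mu> (indicator (chart_dom c)) = chart_measure c"
proof (rule measure_eqI)
  have sets: "sets \<mu> = sets borel_M" using \<mu> riemannian_volume_iff by blast
  then show "sets (density \<mu> (indicator (chart_dom c))) = sets (chart_measure c)" by simp
  fix E assume "E \<in> sets (density \<mu> (indicator (chart_dom c)))"
  then have E: "E \<in> sets borel_M" by (simp add: sets)
  then have Ec: "E \<inter> chart_dom c \<in> sets borel_M" using dom_borel_M[OF c] by blast
  have "E \<in> sets \<mu>" "chart_dom c \<in> sets \<mu>" using E dom_borel_M[OF c] by (simp_all add: sets)
  then have "emeasure (density \<mu> (indicator (chart_dom c))) E =
      (\<integral>\<^sup>+p. indicator (chart_dom c) p * indicator E p \<partial>\<mu>)"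
    by (intro emeasure_density) auto
  also have "\<dots> = (\<integral>\<^sup>+p. indicator (E \<inter> chart_dom c) p \<partial>\<mu>)"
    by (rule nn_integral_cong) (auto simp: indicator_def)
  also have "\<dots> = emeasure \<mu> (E \<inter> chart_dom c)" using Ec by (simp add: sets)
  also have "\<dots> = emeasure (chart_measure c) (E \<inter> chart_dom c)"
    using \<mu> c Ec riemannian_volume_iff by blast
  also have "\<dots> = emeasure (chart_measure c) E"
    using Ec E by (simp add: emeasure_chart_measure[OF c])
  finally show "emeasure (density \<mu> (indicator (chart_dom c))) E = emeasure (chart_measure c) E" .
qed

text \<open>
  The weight \<open>w p\<close> is the reciprocal of the number of charts of the cover that contain \<open>p\<close>. It splits a measure
  on \<open>M\<close> into pieces that live in single charts; measurability is all that these
  pieces need to have.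
\<close>

lemma chart_weights:
  assumes I: "finite I" "I \<subseteq> A" "topspace M = (\<Union>c\<in>I. chart_dom c)"
  defines "w \<equiv> \<lambda>p. ennreal (inverse (\<Sum>c\<in>I. indicator (chart_dom c) p))"
  shows "w \<in> borel_measurable borel_M"
    and "p \<in> topspace M \<Longrightarrow> (\<Sum>c\<in>I. indicator (chart_dom c) p * w p) = 1"
proof -
  have "chart_dom c \<in> sets borel_M" if "c \<in> I" for c using that I dom_borel_M by blast
  then show "w \<in> borel_measurable borel_M" unfolding w_def by measurable
  assume p: "p \<in> topspace M"
  let ?s = "\<Sum>c\<in>I. indicator (chart_dom c) p :: real"
  obtain c where c: "c \<in> I" "p \<in> chart_dom c" using p I by auto
  have "indicator (chart_dom c) p \<le> ?s" using c I(1) by (intro member_le_sum) auto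
  then have s: "?s > 0" using c by simp
  have "(\<Sum>c\<in>I. indicator (chart_dom c) p * w p) = ennreal ?s * w p"
    by (simp add: sum_distrib_right[symmetric] sum_ennreal[symmetric] ennreal_indicator del: sum_indicator_eq_card)
  also have "\<dots> = ennreal (?s * inverse ?s)"
    unfolding w_def using s by (simp only: ennreal_mult less_imp_le inverse_nonnegative_iff_nonnegative)
  finally show "(\<Sum>c\<in>I. indicator (chart_dom c) p * w p) = 1" using s by simp
qed

text \<open>
  Splitting with the weights expresses a Riemannian volume through the chart measures alone.
\<close>

lemma riemannian_volume_unique:
  assumes \<mu>: "is_riemannian_volume M A g \<mu>" and \<nu>: "is_riemannian_volume M A g \<nu>"
  shows "\<mu> = \<nu>"
proof -
  obtain I where I: "finite I" "I \<subseteq> A" "topspace M = (\<Union>c\<in>I. chart_dom c)"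
    using finite_chart_cover .
  define w where "w = (\<lambda>p. ennreal (inverse (\<Sum>c\<in>I. indicator (chart_dom c) p)))"
  have w: "w \<in> borel_measurable borel_M"
    "\<And>p. p \<in> topspace M \<Longrightarrow> (\<Sum>c\<in>I. indicator (chart_dom c) p * w p) = 1"
    unfolding w_def by (rule chart_weights[OF I], assumption?)+
  have "emeasure \<rho> E = (\<Sum>c\<in>I. \<integral>\<^sup>+p. (indicator E p * w p) \<partial>chart_measure c)"
    if \<rho>: "is_riemannian_volume M A g \<rho>" and E: "E \<in> sets borel_M" for \<rho> E
  proof -
    have sets_\<rho> [measurable_cong]: "sets \<rho> = sets borel_M" using \<rho> riemannian_volume_iff by blast
    from sets_eq_imp_space_eq[OF sets_\<rho>] have sp: "space \<rho> = topspace M" by simp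
    have [measurable]: "w \<in> borel_measurable \<rho>" "E \<in> sets \<rho>" using w(1) E by simp_all
    have [measurable]: "chart_dom c \<in> sets \<rho>" if "c \<in> I" for c
      using dom_borel_M[of c] that I(2) by auto
    have "emeasure \<rho> E = (\<integral>\<^sup>+p. indicator E p \<partial>\<rho>)" by simp
    also have "\<dots> = (\<integral>\<^sup>+p. (\<Sum>c\<in>I. indicator (chart_dom c) p * (indicator E p * w p)) \<partial>\<rho>)"
    proof (rule nn_integral_cong)
      fix p assume "p \<in> space \<rho>"
      then have "(\<Sum>c\<in>I. indicator (chart_dom c) p * w p) = 1" using w(2) sp by simp
      moreover have "(\<Sum>c\<in>I. indicator (chart_dom c) p * (indicator E p * w p)) =
          indicator E p * (\<Sum>c\<in>I. indicator (chart_dom c) p * w p)"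
        by (simp add: sum_distrib_left mult_ac)
      ultimately show "indicator E p = (\<Sum>c\<in>I. indicator (chart_dom c) p * (indicator E p * w p))" by simp
    qed
    also have "\<dots> = (\<Sum>c\<in>I. \<integral>\<^sup>+p. (indicator (chart_dom c) p * (indicator E p * w p)) \<partial>\<rho>)"
      by (rule nn_integral_sum) measurable
    also have "\<dots> = (\<Sum>c\<in>I. \<integral>\<^sup>+p. (indicator E p * w p) \<partial>chart_measure c)"
    proof (rule sum.cong)
      fix c assume "c \<in> I"
      then have c: "c \<in> A" using I by auto
      have "chart_dom c \<in> sets \<rho>" using dom_borel_M[OF c] sets_\<rho> by simp
      then show "(\<integral>\<^sup>+p. (indicator (chart_dom c) p * (indicator E p * w p)) \<partial>\<rho>) =
          (\<integral>\<^sup>+p. (indicator E p * w p) \<partial>chart_measure c)"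
        unfolding density_riemannian_volume[OF \<rho> c, symmetric]
        by (subst nn_integral_density) auto
    qed simp
    finally show ?thesis .
  qed
  note * = this
  have "sets \<mu> = sets borel_M" "sets \<nu> = sets borel_M" using \<mu> \<nu> riemannian_volume_iff by auto
  then show ?thesis using *[OF \<mu>] *[OF \<nu>] by (intro measure_eqI) auto
qed

text \<open>
  The sum of the weighted chart measures. For a set inside a chart \<open>d\<close> all summands can be
  computed in \<open>d\<close>, where the weights add up to \<open>1\<close>.
\<close>

lemma riemannian_volume_exists: "\<exists>\<mu>. is_riemannian_volume M A g \<mu>"
proof -
  obtain I where I: "finite I" "I \<subseteq> A" "topspace M = (\<Union>c\<in>I. chart_dom c)"
    using finite_chart_cover .
  define w where "w = (\<lambda>p. ennreal (inverse (\<Sum>c\<in>I. indicator (chart_dom c) p)))"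
  have w: "w \<in> borel_measurable borel_M"
    "\<And>p. p \<in> topspace M \<Longrightarrow> (\<Sum>c\<in>I. indicator (chart_dom c) p * w p) = 1"
    unfolding w_def by (rule chart_weights[OF I], assumption?)+
  define \<nu> where "\<nu> c = density (chart_measure c) w" for c
  have sets_\<nu> [simp]: "sets (\<nu> c) = sets borel_M" for c by (simp add: \<nu>_def)
  define \<mu> where "\<mu> = measure_of (topspace M) {U. openin M U} (\<lambda>E. \<Sum>c\<in>I. emeasure (\<nu> c) E)"
  have sets_\<mu>: "sets \<mu> = sets borel_M"
    by (simp add: \<mu>_def sets_measure_of[OF opens_Pow] sets_borel_M)
  have em: "emeasure \<mu> E = (\<Sum>c\<in>I. emeasure (\<nu> c) E)" if "E \<in> sets borel_M" for E
  proof (rule emeasure_measure_of[OF \<mu>_def opens_Pow])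
    show "positive (sets \<mu>) (\<lambda>E. \<Sum>c\<in>I. emeasure (\<nu> c) E)" by (simp add: positive_def)
    show "countably_additive (sets \<mu>) (\<lambda>E. \<Sum>c\<in>I. emeasure (\<nu> c) E)"
    proof (rule countably_additiveI)
      fix F :: "nat \<Rightarrow> 'a set" assume F: "range F \<subseteq> sets \<mu>" "disjoint_family F"
      have "(\<Sum>i. \<Sum>c\<in>I. emeasure (\<nu> c) (F i)) = (\<Sum>c\<in>I. \<Sum>i. emeasure (\<nu> c) (F i))"
        by (rule suminf_sum) (rule summableI)
      also have "\<dots> = (\<Sum>c\<in>I. emeasure (\<nu> c) (\<Union>i. F i))"
        by (intro sum.cong refl suminf_emeasure) (use F sets_\<mu> in auto)
      finally show "(\<Sum>i. \<Sum>c\<in>I. emeasure (\<nu> c) (F i)) = (\<Sum>c\<in>I. emeasure (\<nu> c) (\<Union>i. F i))" .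
    qed
  qed (use that sets_\<mu> in simp)
  have "emeasure \<mu> E = emeasure (chart_measure d) E"
    if d: "d \<in> A" and E: "E \<in> sets borel_M" "E \<subseteq> chart_dom d" for d E
  proof -
    have [measurable]: "w \<in> borel_measurable borel_M" "E \<in> sets borel_M" by fact+
    have [measurable]: "chart_dom c \<in> sets borel_M" if "c \<in> I" for c
      using that I(2) by (intro dom_borel_M) blast
    have ov: "emeasure (\<nu> c) E = (\<integral>\<^sup>+p. indicator (chart_dom c) p * (w p * indicator E p) \<partial>chart_measure d)"
      if cI: "c \<in> I" for c
    proof -
      have c: "c \<in> A" using cI I by auto
      have [measurable]: "chart_dom c \<in> sets borel_M" "chart_dom d \<in> sets borel_M" using dom_borel_M c d by auto
      let ?D = "chart_dom c \<inter> chart_dom d"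
      \<comment> \<open>on the overlap of two charts, the two chart measures agree\<close>
      have D: "density (chart_measure c) (indicator ?D) = density (chart_measure d) (indicator ?D)"
      proof (rule measure_eqI)
        fix F assume "F \<in> sets (density (chart_measure c) (indicator ?D))"
        then have F [measurable]: "F \<in> sets borel_M" by simp
        have "emeasure (density (chart_measure e) (indicator ?D)) F = emeasure (chart_measure e) (?D \<inter> F)" for e
          by (subst emeasure_density) (auto simp: indicator_inter_arith[symmetric])
        then show "emeasure (density (chart_measure c) (indicator ?D)) F =
            emeasure (density (chart_measure d) (indicator ?D)) F"
          using chart_measure_overlap[OF c d, of "?D \<inter> F"] by auto
      qed simp
      have int: "(\<integral>\<^sup>+p. indicator ?D p * (w p * indicator E p) \<partial>chart_measure e) =
        (\<integral>\<^sup>+p. (w p * indicator E p) \<partial>density (chart_measure e) (indicator ?D))" for e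
        by (subst nn_integral_density) auto
      have "emeasure (\<nu> c) E = (\<integral>\<^sup>+p. w p * indicator E p \<partial>chart_measure c)"
        unfolding \<nu>_def by (subst emeasure_density) auto
      also have "\<dots> = (\<integral>\<^sup>+p. indicator ?D p * (w p * indicator E p) \<partial>chart_measure c)"
      proof -
        have "(\<integral>\<^sup>+p. f p \<partial>chart_measure c) = (\<integral>\<^sup>+p. indicator (chart_dom c) p * f p \<partial>chart_measure c)"
          if [measurable]: "f \<in> borel_measurable borel_M" for f
          by (subst (1 2) nn_integral_chart_measure[OF c])
            (auto intro!: nn_integral_cong simp: indicator_def chart_inv_coord[OF c])
        from this[of "\<lambda>p. w p * indicator E p"]
        show "(\<integral>\<^sup>+p. w p * indicator E p \<partial>chart_measure c) =
            (\<integral>\<^sup>+p. indicator ?D p * (w p * indicator E p) \<partial>chart_measure c)"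
          using E(2) by (auto simp: indicator_def intro!: nn_integral_cong)
      qed
      also have "\<dots> = (\<integral>\<^sup>+p. indicator ?D p * (w p * indicator E p) \<partial>chart_measure d)"
        by (simp only: int D)
      also have "\<dots> = (\<integral>\<^sup>+p. indicator (chart_dom c) p * (w p * indicator E p) \<partial>chart_measure d)"
        by (intro nn_integral_cong) (use E(2) in \<open>auto simp: indicator_def\<close>)
      finally show ?thesis .
    qed
    have "emeasure \<mu> E = (\<Sum>c\<in>I. \<integral>\<^sup>+p. indicator (chart_dom c) p * (w p * indicator E p) \<partial>chart_measure d)"
      using ov by (simp add: em[OF E(1)])
    also have "\<dots> = (\<integral>\<^sup>+p. (\<Sum>c\<in>I. indicator (chart_dom c) p * (w p * indicator E p)) \<partial>chart_measure d)"
      by (rule nn_integral_sum[symmetric]) measurable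
    also have "\<dots> = (\<integral>\<^sup>+p. indicator E p \<partial>chart_measure d)"
    proof (rule nn_integral_cong)
      fix p assume "p \<in> space (chart_measure d)"
      then have "(\<Sum>c\<in>I. indicator (chart_dom c) p * w p) = 1" using w(2) by simp
      moreover have "(\<Sum>c\<in>I. indicator (chart_dom c) p * (w p * indicator E p)) =
          (\<Sum>c\<in>I. indicator (chart_dom c) p * w p) * indicator E p"
        by (simp add: sum_distrib_right sum_distrib_left mult_ac)
      ultimately show "(\<Sum>c\<in>I. indicator (chart_dom c) p * (w p * indicator E p)) = indicator E p" by simp
    qed
    also have "\<dots> = emeasure (chart_measure d) E" by simp
    finally show ?thesis .
  qed
  then have "is_riemannian_volume M A g \<mu>" unfolding riemannian_volume_iff using sets_\<mu> by blast
  then show ?thesis by blast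
qed

lemma dvol_is_riemannian_volume: "is_riemannian_volume M A g (dvol M A g)"
  unfolding dvol_def
  using riemannian_volume_exists riemannian_volume_unique by (blast intro: theI')

end

section \<open>Partitions of unity and the divergence theorem\<close>

lemma Ck_on_extend_by_zero:
  fixes f :: "real^'n::finite \<Rightarrow> real"
  assumes S: "open S" and K: "compact K" "K \<subseteq> S" and f: "Ck_on k S f"
    and zero: "\<And>x. x \<in> S \<Longrightarrow> x \<notin> K \<Longrightarrow> f x = 0"
  shows "Ck_on k UNIV (\<lambda>x. indicator S x *\<^sub>R f x)"
proof (rule Ck_on_local)
  fix x :: "real^'n"
  show "\<exists>U. open U \<and> x \<in> U \<and> Ck_on k U (\<lambda>x. indicator S x *\<^sub>R f x)"
  proof (cases "x \<in> S")
    case True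
    have "Ck_on k S (\<lambda>x. indicator S x *\<^sub>R f x)"
      by (rule Ck_on_cong[OF S _ f]) simp
    then show ?thesis using True S by blast
  next
    case False
    have "open (- K)" using compact_imp_closed[OF K(1)] by auto
    moreover have "Ck_on k (- K) (\<lambda>x. indicator S x *\<^sub>R f x)"
      by (rule Ck_on_cong[OF \<open>open (- K)\<close> _ Ck_on_const[of k "- K" 0]]) (use zero in \<open>auto simp: indicator_def\<close>)
    ultimately show ?thesis using False K by blast
  qed
qed

text \<open>
  The profile \<open>(max 0 t)\<^sup>2\<close> is \<open>C\<^sup>1\<close> but not \<open>C\<^sup>2\<close>; one derivative suffices for a
  partition of unity that is used to integrate a divergence.
\<close>

lemma DERIV_square_positive_part:
  "((\<lambda>t::real. (max 0 t)\<^sup>2) has_real_derivative 2 * max 0 t) (at t)"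
proof -
  consider "t > 0" | "t < 0" | "t = 0" by linarith
  then show ?thesis
  proof cases
    case 1
    have "((\<lambda>t. t\<^sup>2) has_real_derivative 2 * max 0 t) (at t)"
      using 1 by (auto intro!: derivative_eq_intros)
    then show ?thesis
      by (rule DERIV_cong_ev[THEN iffD1, rotated 3])
        (use 1 eventually_nhds_in_open[of "{0<..}" t] in \<open>auto elim!: eventually_mono\<close>)
  next
    case 2
    have "((\<lambda>t. 0) has_real_derivative 2 * max 0 t) (at t)"
      using 2 by (auto intro!: derivative_eq_intros)
    then show ?thesis
      by (rule DERIV_cong_ev[THEN iffD1, rotated 3])
        (use 2 eventually_nhds_in_open[of "{..<0}" t] in \<open>auto elim!: eventually_mono\<close>)
  next
    case 3
    have "((\<lambda>h::real. (max 0 h)\<^sup>2 / h) \<longlongrightarrow> 0) (at 0)"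
    proof (rule Lim_null_comparison)
      show "\<forall>\<^sub>F h in at 0. norm ((max 0 h)\<^sup>2 / h) \<le> \<bar>h\<bar>"
        by (rule always_eventually) (auto simp: max_def power2_eq_square)
      show "((\<lambda>h::real. \<bar>h\<bar>) \<longlongrightarrow> 0) (at 0)"
        by (auto intro!: tendsto_eq_intros)
    qed
    then show ?thesis using 3 by (simp add: DERIV_def)
  qed
qed

context manifold_atlas
begin

lemma chart_Ck_mult:
  "c \<in> A \<Longrightarrow> chart_Ck k c f \<Longrightarrow> chart_Ck k c h \<Longrightarrow> chart_Ck k c (\<lambda>p. f p * h p)"
  unfolding chart_Ck_def by (rule Ck_on_mult[OF open_img])

lemma chart_Ck_add:
  "c \<in> A \<Longrightarrow> chart_Ck k c f \<Longrightarrow> chart_Ck k c h \<Longrightarrow> chart_Ck k c (\<lambda>p. f p + h p)"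
  unfolding chart_Ck_def by (rule Ck_on_add[OF open_img])

lemma chart_Ck_sum:
  "c \<in> A \<Longrightarrow> (\<And>i. i \<in> I \<Longrightarrow> chart_Ck k c (f i)) \<Longrightarrow> chart_Ck k c (\<lambda>p. \<Sum>i\<in>I. f i p)"
  unfolding chart_Ck_def by (rule Ck_on_sum[OF open_img])

lemma chart_Ck_const: "chart_Ck k c (\<lambda>p. a)"
  by (simp add: chart_Ck_def)

lemma chart_Ck_divide:
  assumes "c \<in> A" "chart_Ck k c f" "chart_Ck k c h" "\<And>p. p \<in> chart_dom c \<Longrightarrow> h p \<noteq> 0"
  shows "chart_Ck k c (\<lambda>p. f p / h p)"
  using assms chart_inv_in unfolding chart_Ck_def by (intro Ck_on_divide open_img) auto

lemma chart_C1_imp_C0: "c \<in> A \<Longrightarrow> chart_Ck 1 c f \<Longrightarrow> chart_Ck 0 c f"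
  unfolding chart_Ck_def by (rule Ck_on_pred) simp

lemma chart_deriv_add:
  assumes "c \<in> A" "p \<in> chart_dom c" "chart_Ck 1 c f1" "chart_Ck 1 c f2"
  shows "chart_deriv c i (\<lambda>p. f1 p + f2 p) p = chart_deriv c i f1 p + chart_deriv c i f2 p"
proof -
  have "(\<lambda>x. f1 (chart_inv c x)) differentiable (at (coord c p))"
    "(\<lambda>x. f2 (chart_inv c x)) differentiable (at (coord c p))"
    using assms(2-4) by (simp_all add: chart_Ck_def)
  from partial_deriv_add[OF this] show ?thesis by (simp add: chart_deriv_def)
qed

lemma chart_deriv_mult:
  assumes "c \<in> A" "p \<in> chart_dom c" "chart_Ck 1 c f" "chart_Ck 1 c h"
  shows "chart_deriv c i (\<lambda>p. f p * h p) p = f p * chart_deriv c i h p + chart_deriv c i f p * h p"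
proof -
  have "(\<lambda>x. f (chart_inv c x)) differentiable (at (coord c p))"
    "(\<lambda>x. h (chart_inv c x)) differentiable (at (coord c p))"
    using assms(2-4) by (simp_all add: chart_Ck_def)
  from partial_deriv_mult[OF this] show ?thesis
    by (simp add: chart_deriv_def chart_inv_coord[OF assms(1,2)])
qed

lemma chart_deriv_sum:
  assumes "c \<in> A" "p \<in> chart_dom c" "\<And>j. j \<in> J \<Longrightarrow> chart_Ck 1 c (f j)"
  shows "chart_deriv c i (\<lambda>p. \<Sum>j\<in>J. f j p) p = (\<Sum>j\<in>J. chart_deriv c i (f j) p)"
proof -
  have "(\<lambda>x. f j (chart_inv c x)) differentiable (at (coord c p))" if "j \<in> J" for j
    using assms(2) assms(3)[OF that] by (simp add: chart_Ck_def)
  from partial_deriv_sum[OF this] show ?thesis by (simp add: chart_deriv_def)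
qed

lemma chart_deriv_const: "chart_deriv c i (\<lambda>p. a) p = 0"
  by (simp add: chart_deriv_def partial_deriv_def)

lemma chart_compact_closed:
  assumes c: "c \<in> A" and K: "compact K" "K \<subseteq> coord c ` chart_dom c"
  shows "openin M (topspace M - chart_inv c ` K)"
  using compactin_imp_closedin[OF Hausdorff_M compactin_chart_inv_image[OF c K]]
  by (simp add: closedin_def)

text \<open>
  In a chart around \<open>p\<close> the bump is \<open>(max 0 (r\<^sup>2 - |x - a|\<^sup>2))\<^sup>2\<close>, extended by zero. The extension is \<open>C\<^sup>1\<close> in all
  other charts because the support is compact, hence closed in the Hausdorff space \<open>M\<close>: each point has
  a neighbourhood that lies in the first chart or one on which the bump vanishes.
\<close>

lemma bump_function:
  assumes p: "p \<in> topspace M"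
  shows "\<exists>b c K. c \<in> A \<and> compact K \<and> K \<subseteq> coord c ` chart_dom c \<and> (\<forall>d\<in>A. chart_Ck 1 d b) \<and>
    (\<forall>q. 0 \<le> b q) \<and> b p > 0 \<and> (\<forall>q. q \<notin> chart_inv c ` K \<longrightarrow> b q = (0::real))"
proof -
  obtain c where c: "c \<in> A" "p \<in> chart_dom c" using p topspace_M by auto
  define a where "a = coord c p"
  have "a \<in> coord c ` chart_dom c" using c by (simp add: a_def)
  then obtain r where r: "r > 0" "cball a r \<subseteq> coord c ` chart_dom c"
    using open_img[OF c(1)] open_contains_cball by blast
  define s where "s q = r\<^sup>2 - (\<Sum>i\<in>UNIV. (coord c q $ i - a $ i) * (coord c q $ i - a $ i))" for q
  define b where "b q = (if q \<in> chart_dom c then (max 0 (s q))\<^sup>2 else 0)" for q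
  have s_norm: "s q = r\<^sup>2 - (dist a (coord c q))\<^sup>2" for q
    by (simp only: s_def dist_commute[of a] dist_norm power2_norm_eq_inner inner_vec_def)
      (auto intro!: sum.cong simp: algebra_simps)
  have supp: "b q = 0" if "q \<notin> chart_inv c ` cball a r" for q
  proof (cases "q \<in> chart_dom c")
    case True
    then have "coord c q \<notin> cball a r"
      using that chart_inv_coord[OF c(1) True] by (metis imageI)
    then have "r\<^sup>2 < (dist a (coord c q))\<^sup>2" using r(1) by (auto intro: power_strict_mono)
    then show ?thesis by (simp add: b_def s_norm)
  qed (simp add: b_def)
  have "chart_Ck 1 d b" if d: "d \<in> A" for d
    unfolding chart_Ck_def
  proof (rule Ck_on_local)
    fix x assume x: "x \<in> coord d ` chart_dom d"
    let ?q = "chart_inv d x"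
    have q: "?q \<in> chart_dom d" "coord d ?q = x"
      using chart_inv_in[OF d x] coord_chart_inv[OF d x] by auto
    show "\<exists>U. open U \<and> x \<in> U \<and> Ck_on 1 U (\<lambda>x. b (chart_inv d x))"
    proof (cases "?q \<in> chart_dom c")
      case True
      let ?U = "coord d ` (chart_dom d \<inter> chart_dom c)"
      have U: "open ?U" by (rule open_overlap[OF d c(1)])
      have "Ck_on 1 ?U (\<lambda>x. s (chart_inv d x))"
        unfolding s_def
        by (intro Ck_on_diff Ck_on_sum Ck_on_mult U Ck_on_const transition_Ck[OF d c(1)])
      then have "Ck_on 1 ?U (\<lambda>x. (max 0 (s (chart_inv d x)))\<^sup>2)"
        by (rule C1_on_compose[where \<psi> = "\<lambda>t. (max 0 t)\<^sup>2" and d = "\<lambda>t. 2 * max 0 t", OF U])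
          (auto intro!: DERIV_square_positive_part continuous_intros)
      then have "Ck_on 1 ?U (\<lambda>x. b (chart_inv d x))"
        by (rule Ck_on_cong[OF U, rotated]) (auto simp: b_def chart_inv_coord[OF d])
      moreover have "x \<in> ?U" using q True by (metis IntI imageI)
      ultimately show ?thesis using U by blast
    next
      case False
      let ?N = "topspace M - chart_inv c ` cball a r"
      let ?U = "coord d ` (?N \<inter> chart_dom d)"
      have N: "openin M ?N" by (rule chart_compact_closed[OF c(1)]) (use r in auto)
      then have U: "open ?U" by (rule open_coord_image[OF d])
      have "?q \<notin> chart_inv c ` cball a r"
      proof
        assume "?q \<in> chart_inv c ` cball a r"
        then obtain y where y: "?q = chart_inv c y" "y \<in> cball a r" by (rule imageE)
        from chart_inv_in[OF c(1) subsetD[OF r(2) y(2)]] show False using False y(1) by simp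
      qed
      then have "x \<in> ?U" using q dom_subset[OF d] by (metis DiffI IntI imageI subsetD)
      moreover have "Ck_on 1 ?U (\<lambda>x. b (chart_inv d x))"
        by (rule Ck_on_cong[OF U _ Ck_on_const[of 1 ?U 0]]) (auto simp: supp chart_inv_coord[OF d])
      ultimately show ?thesis using U by blast
    qed
  qed
  moreover have "b p > 0" using c(2) r(1) by (simp add: b_def s_norm a_def)
  moreover have "0 \<le> b q" for q by (simp add: b_def)
  ultimately show ?thesis
    by (intro exI[of _ b] exI[of _ c] exI[of _ "cball a r"]) (use c r supp in auto)
qed

lemma partition_of_unity:
  obtains P :: "'a set" and ch :: "'a \<Rightarrow> ('a, 'n) chart"
    and K :: "'a \<Rightarrow> (real^'n) set" and \<rho> :: "'a \<Rightarrow> 'a \<Rightarrow> real" where "finite P"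
    and "\<And>p. p \<in> P \<Longrightarrow> ch p \<in> A \<and> compact (K p) \<and> K p \<subseteq> coord (ch p) ` chart_dom (ch p)"
    and "\<And>p d. p \<in> P \<Longrightarrow> d \<in> A \<Longrightarrow> chart_Ck 1 d (\<rho> p)"
    and "\<And>p q. p \<in> P \<Longrightarrow> q \<notin> chart_inv (ch p) ` K p \<Longrightarrow> \<rho> p q = 0"
    and "\<And>q. q \<in> topspace M \<Longrightarrow> (\<Sum>p\<in>P. \<rho> p q) = 1"
proof -
  obtain b :: "'a \<Rightarrow> 'a \<Rightarrow> real" and ch K where b: "\<And>p. p \<in> topspace M \<Longrightarrow> ch p \<in> A \<and> compact (K p) \<and>
      K p \<subseteq> coord (ch p) ` chart_dom (ch p) \<and> (\<forall>d\<in>A. chart_Ck 1 d (b p)) \<and>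
      (\<forall>q. 0 \<le> b p q) \<and> b p p > 0 \<and> (\<forall>q. q \<notin> chart_inv (ch p) ` K p \<longrightarrow> b p q = 0)"
    using bump_function by metis
  define U where "U p = {q \<in> topspace M. b p q \<in> {0<..}}" for p
  have "openin M (U p)" if "p \<in> topspace M" for p
    unfolding U_def by (rule chart_continuous_openin) (use b[OF that] chart_C1_imp_C0 in auto)
  moreover have "topspace M \<subseteq> (\<Union>p\<in>topspace M. U p)" using b by (auto simp: U_def)
  ultimately have "\<exists>F. finite F \<and> F \<subseteq> U ` topspace M \<and> topspace M \<subseteq> \<Union>F"
    using compact_M unfolding compact_space_alt by auto
  then obtain P where P: "finite P" "P \<subseteq> topspace M" "topspace M \<subseteq> (\<Union>p\<in>P. U p)"
    using finite_subset_image by metis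
  define s where "s q = (\<Sum>p\<in>P. b p q)" for q
  have s: "s q > 0" if "q \<in> topspace M" for q
  proof -
    from that obtain p where p: "p \<in> P" "b p q > 0" using P(3) unfolding U_def by blast
    then have "b p q \<le> s q" unfolding s_def by (intro member_le_sum) (use P b in auto)
    then show ?thesis using p by simp
  qed
  define \<rho> where "\<rho> p q = b p q / s q" for p q
  show ?thesis
  proof (rule that[of P ch K \<rho>])
    show "chart_Ck 1 d (\<rho> p)" if "p \<in> P" "d \<in> A" for p d
      unfolding \<rho>_def s_def
    proof (rule chart_Ck_divide[OF that(2)])
      show "chart_Ck 1 d (\<lambda>q. \<Sum>p\<in>P. b p q)"
        by (rule chart_Ck_sum[OF that(2)]) (use b P that in blast)
      show "(\<Sum>p\<in>P. b p q) \<noteq> 0" if "q \<in> chart_dom d" for q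
        using s[of q] dom_subset[OF \<open>d \<in> A\<close>] that by (auto simp: s_def)
    qed (use b P that in blast)
    show "(\<Sum>p\<in>P. \<rho> p q) = 1" if "q \<in> topspace M" for q
      using s[OF that] by (simp add: \<rho>_def sum_divide_distrib[symmetric] s_def)
    show "\<rho> p q = 0" if "p \<in> P" "q \<notin> chart_inv (ch p) ` K p" for p q
      using b P(2) that by (auto simp: \<rho>_def)
    show "ch p \<in> A \<and> compact (K p) \<and> K p \<subseteq> coord (ch p) ` chart_dom (ch p)" if "p \<in> P" for p
      using b P(2) that by blast
  qed (rule P(1))
qed

end

context riemannian_atlas
begin

lemma sets_dvol: "sets (dvol M A g) = sets borel_M"
  using dvol_is_riemannian_volume riemannian_volume_iff by blast

lemma space_dvol: "space (dvol M A g) = topspace M"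
  using sets_eq_imp_space_eq[OF sets_dvol] by simp

lemma integral_dvol_chart:
  fixes f :: "'a \<Rightarrow> real"
  assumes c: "c \<in> A" and f: "f \<in> borel_measurable borel_M"
    and zero: "\<And>p. p \<in> topspace M \<Longrightarrow> p \<notin> chart_dom c \<Longrightarrow> f p = 0"
  shows "integrable (dvol M A g) f \<longleftrightarrow> integrable lborel
      (\<lambda>x. indicator (coord c ` chart_dom c) x *\<^sub>R (vol_dens c (chart_inv c x) * f (chart_inv c x)))"
    and "(LINT p|dvol M A g. f p) = (LINT x|lborel.
      indicator (coord c ` chart_dom c) x *\<^sub>R (vol_dens c (chart_inv c x) * f (chart_inv c x)))"
proof -
  let ?\<mu> = "dvol M A g" and ?i = "indicator (chart_dom c) :: 'a \<Rightarrow> real"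
  have fm: "f \<in> borel_measurable ?\<mu>" using f measurable_cong_sets[OF sets_dvol refl] by blast
  have D: "chart_dom c \<in> sets ?\<mu>" using dom_borel_M[OF c] sets_dvol by simp
  have dens: "density ?\<mu> (\<lambda>p. ennreal (?i p)) = chart_measure c"
    using density_riemannian_volume[OF dvol_is_riemannian_volume c] by (simp add: ennreal_indicator)
  have eq: "?i p *\<^sub>R f p = f p" if "p \<in> space ?\<mu>" for p
    using zero that by (auto simp: indicator_def space_dvol)
  have "integrable ?\<mu> f \<longleftrightarrow> integrable ?\<mu> (\<lambda>p. ?i p *\<^sub>R f p)"
    by (rule Bochner_Integration.integrable_cong) (use eq in auto)
  also have "\<dots> \<longleftrightarrow> integrable (chart_measure c) f"
    unfolding dens[symmetric] by (subst integrable_density) (use fm D in auto)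
  finally show "integrable ?\<mu> f \<longleftrightarrow> integrable lborel
      (\<lambda>x. indicator (coord c ` chart_dom c) x *\<^sub>R (vol_dens c (chart_inv c x) * f (chart_inv c x)))"
    using integral_chart_measure(1)[OF c f] by simp
  have "(LINT p|?\<mu>. f p) = (LINT p|?\<mu>. ?i p *\<^sub>R f p)"
    by (rule Bochner_Integration.integral_cong) (use eq in auto)
  also have "\<dots> = (LINT p|chart_measure c. f p)"
    unfolding dens[symmetric] by (subst integral_density) (use fm D in auto)
  finally show "(LINT p|?\<mu>. f p) = (LINT x|lborel.
      indicator (coord c ` chart_dom c) x *\<^sub>R (vol_dens c (chart_inv c x) * f (chart_inv c x)))"
    using integral_chart_measure(2)[OF c f] by simp
qed

lemma integrable_dvol_chart_support:
  assumes c: "c \<in> A" and K: "compact K" "K \<subseteq> coord c ` chart_dom c"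
    and f: "\<And>d. d \<in> A \<Longrightarrow> chart_Ck 0 d f"
    and zero: "\<And>p. p \<notin> chart_inv c ` K \<Longrightarrow> f p = 0"
  shows "integrable (dvol M A g) f"
proof -
  let ?S = "coord c ` chart_dom c"
  have out: "f (chart_inv c x) = 0" if "x \<in> ?S" "x \<notin> K" for x
  proof (rule zero, rule notI)
    assume "chart_inv c x \<in> chart_inv c ` K"
    then obtain y where "y \<in> K" "chart_inv c x = chart_inv c y" by auto
    then show False using that K(2) coord_chart_inv[OF c] by (metis subsetD)
  qed
  have "f p = 0" if "p \<notin> chart_dom c" for p
    by (rule zero) (use that K chart_inv_in[OF c] in blast)
  moreover have "integrable lborel (\<lambda>x. indicator ?S x *\<^sub>R (vol_dens c (chart_inv c x) * f (chart_inv c x)))"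
  proof (rule integrable_continuous_compact_support[OF _ K(1)])
    have "Ck_on 0 ?S (\<lambda>x. vol_dens c (chart_inv c x) * f (chart_inv c x))"
      using chart_Ck_mult[OF c chart_C1_imp_C0[OF c vol_dens_Ck[OF c]] f[OF c]]
      by (simp add: chart_Ck_def)
    from Ck_on_extend_by_zero[OF open_img[OF c] K this]
    show "continuous_on UNIV (\<lambda>x. indicator ?S x *\<^sub>R (vol_dens c (chart_inv c x) * f (chart_inv c x)))"
      using out by simp
    show "indicator ?S x *\<^sub>R (vol_dens c (chart_inv c x) * f (chart_inv c x)) = 0" if "x \<notin> K" for x
      using out[of x] that by (simp add: indicator_def)
  qed
  ultimately show ?thesis
    using integral_dvol_chart(1)[OF c chart_continuous_measurable[OF f]] by blast
qed

lemma integrable_dvol_continuous: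
  assumes f: "\<And>d. d \<in> A \<Longrightarrow> chart_Ck 0 d f"
  shows "integrable (dvol M A g) f"
proof -
  obtain P :: "'a set" and ch :: "'a \<Rightarrow> ('a, 'n) chart"
    and K :: "'a \<Rightarrow> (real^'n) set" and \<rho> :: "'a \<Rightarrow> 'a \<Rightarrow> real" where P: "finite P"
    "\<And>p. p \<in> P \<Longrightarrow> ch p \<in> A \<and> compact (K p) \<and> K p \<subseteq> coord (ch p) ` chart_dom (ch p)"
    "\<And>p d. p \<in> P \<Longrightarrow> d \<in> A \<Longrightarrow> chart_Ck 1 d (\<rho> p)"
    "\<And>p q. p \<in> P \<Longrightarrow> q \<notin> chart_inv (ch p) ` K p \<Longrightarrow> \<rho> p q = 0"
    "\<And>q. q \<in> topspace M \<Longrightarrow> (\<Sum>p\<in>P. \<rho> p q) = 1"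
    by (rule partition_of_unity, rule that)
  have "integrable (dvol M A g) (\<lambda>q. \<rho> p q * f q)" if p: "p \<in> P" for p
  proof (rule integrable_dvol_chart_support[of "ch p" "K p"])
    show "chart_Ck 0 d (\<lambda>q. \<rho> p q * f q)" if d: "d \<in> A" for d
      by (intro chart_Ck_mult d f chart_C1_imp_C0 P(3) p)
  qed (use p P(2,4) in auto)
  then have "integrable (dvol M A g) (\<lambda>q. \<Sum>p\<in>P. \<rho> p q * f q)" by simp
  moreover have "(\<Sum>p\<in>P. \<rho> p q * f q) = f q" if "q \<in> space (dvol M A g)" for q
    using P(5) that by (simp add: sum_distrib_right[symmetric] space_dvol)
  ultimately show ?thesis by (simp cong: Bochner_Integration.integrable_cong)
qed

lemma lie_fun_continuous:
  assumes Y: "transforms_as_vector A Y" "\<And>c k. c \<in> A \<Longrightarrow> chart_Ck 1 c (\<lambda>p. Y c p $ k)"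
    and f: "\<And>c. c \<in> A \<Longrightarrow> chart_Ck 1 c f" and c: "c \<in> A"
  shows "chart_Ck 0 c (lie_fun A Y f)"
proof (rule chart_Ck_cong[OF c])
  show "chart_Ck 0 c (\<lambda>p. \<Sum>k\<in>UNIV. Y c p $ k * chart_deriv c k f p)"
    by (intro chart_Ck_sum[OF c] chart_Ck_mult[OF c] continuous_chart_deriv[OF c] f[OF c])
      (rule chart_C1_imp_C0[OF c Y(2)[OF c]])
qed (use lie_fun_eq[OF Y(1) f c] in auto)

text \<open>
  A point with \<open>f p > 0\<close> would have a neighbourhood of measure zero, whose image in a chart is open, nonempty
  and, as the density is positive, of Lebesgue measure zero.
\<close>

lemma continuous_nonneg_integral_zero:
  assumes f: "\<And>c. c \<in> A \<Longrightarrow> chart_Ck 0 c f" and nonneg: "\<And>p. p \<in> topspace M \<Longrightarrow> 0 \<le> f p"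
    and zero: "(LINT p|dvol M A g. f p) = 0" and p: "p \<in> topspace M"
  shows "f p = (0::real)"
proof (rule ccontr)
  let ?\<mu> = "dvol M A g"
  assume "f p \<noteq> 0"
  then have fp: "f p > 0" using nonneg[OF p] by simp
  obtain c where c: "c \<in> A" "p \<in> chart_dom c" using p topspace_M by auto
  have "AE x in ?\<mu>. 0 \<le> f x" using nonneg by (intro AE_I2) (simp add: space_dvol)
  then have "AE x in ?\<mu>. f x = 0"
    using integral_nonneg_eq_0_iff_AE[OF integrable_dvol_continuous[OF f]] zero by blast
  then have AE: "AE x in chart_measure c. f x = 0"
    unfolding density_riemannian_volume[OF dvol_is_riemannian_volume c(1), symmetric]
    by (subst AE_density) (use dom_borel_M[OF c(1)] sets_dvol in auto)
  let ?U = "{p \<in> topspace M. f p \<in> {0<..}}"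
  have U: "openin M ?U" by (rule chart_continuous_openin[OF f]) auto
  then have Ub: "?U \<in> sets borel_M" by (rule openin_borel_M)
  have "AE x in chart_measure c. f x \<notin> {0<..}" using AE by eventually_elim simp
  from emeasure_eq_0_AE[OF this] have "emeasure (chart_measure c) ?U = 0" by simp
  then have "(\<integral>\<^sup>+x\<in>coord c ` (?U \<inter> chart_dom c). ennreal (vol_dens c (chart_inv c x)) \<partial>lborel) = 0"
    by (simp only: emeasure_chart_measure[OF c(1) Ub])
  then have "(\<integral>\<^sup>+x. ennreal (indicator (coord c ` (?U \<inter> chart_dom c)) x * vol_dens c (chart_inv c x)) \<partial>lborel) = 0"
    by (rule trans[rotated]) (intro nn_integral_cong, auto simp: indicator_def)
  then have "AE x in lborel. ennreal (indicator (coord c ` (?U \<inter> chart_dom c)) x * vol_dens c (chart_inv c x)) = 0"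
    by (subst (asm) nn_integral_0_iff_AE) (use measurable_vol_dens_image[OF c(1) Ub] in auto)
  then have AEn: "AE x in lborel. x \<notin> coord c ` (?U \<inter> chart_dom c)"
  proof (rule eventually_mono, intro notI)
    fix x assume 0: "ennreal (indicator (coord c ` (?U \<inter> chart_dom c)) x * vol_dens c (chart_inv c x)) = 0"
      and x: "x \<in> coord c ` (?U \<inter> chart_dom c)"
    then have "x \<in> coord c ` chart_dom c" by auto
    from vol_dens_pos[OF c(1) chart_inv_in[OF c(1) this]] show False using 0 x by (simp add: ennreal_eq_0_iff)
  qed
  have open_cU: "open (coord c ` (?U \<inter> chart_dom c))" by (rule open_coord_image[OF c(1) U])
  from emeasure_eq_0_AE[OF AEn] have "emeasure lborel (coord c ` (?U \<inter> chart_dom c)) = 0" by simp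
  then have "negligible (coord c ` (?U \<inter> chart_dom c))"
    using open_cU by (auto simp: negligible_iff_null_sets null_sets_def)
  moreover have "coord c p \<in> coord c ` (?U \<inter> chart_dom c)" using c p fp by auto
  ultimately show False using open_not_negligible[OF open_cU] by auto
qed

text \<open>
  The hypothesis on \<open>D\<close> is the coordinate formula \<open>D = (1/\<surd>det g) \<partial>\<^sub>k (\<surd>det g Y\<^sup>k)\<close> for the divergence of \<open>Y\<close>.
  For each function \<open>\<rho>\<close> of a partition of unity, \<open>h = \<rho> D + Y(\<rho>)\<close> is the divergence of \<open>\<rho> Y\<close>. In the chart that
  contains the support of \<open>\<rho>\<close>, the function \<open>\<surd>det g h\<close> is a sum of partial derivatives of compactly supported
  functions, so \<open>h\<close> has integral zero. Summed over the partition of unity, the functions \<open>h\<close>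
  give \<open>D + Y(1) = D\<close>.
\<close>

theorem divergence_theorem:
  assumes Y: "transforms_as_vector A Y" "\<And>c k. c \<in> A \<Longrightarrow> chart_Ck 1 c (\<lambda>p. Y c p $ k)"
    and D: "\<And>c p. c \<in> A \<Longrightarrow> p \<in> chart_dom c \<Longrightarrow>
      vol_dens c p * D p = (\<Sum>k\<in>UNIV. chart_deriv c k (\<lambda>p'. vol_dens c p' * Y c p' $ k) p)"
  shows "(LINT p|dvol M A g. D p) = 0"
proof -
  let ?\<mu> = "dvol M A g"
  have VY: "chart_Ck 1 c (\<lambda>p. vol_dens c p * Y c p $ k)" if "c \<in> A" for c k
    using that by (intro chart_Ck_mult vol_dens_Ck Y(2))
  have contD: "chart_Ck 0 c D" if c: "c \<in> A" for c
  proof (rule chart_Ck_cong[OF c])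
    show "chart_Ck 0 c (\<lambda>p. (\<Sum>k\<in>UNIV. chart_deriv c k (\<lambda>p'. vol_dens c p' * Y c p' $ k) p) / vol_dens c p)"
      by (intro chart_Ck_divide chart_Ck_sum continuous_chart_deriv VY c)
        (use vol_dens_pos[OF c] chart_C1_imp_C0[OF c vol_dens_Ck[OF c]] in \<open>auto simp: less_imp_neq[symmetric]\<close>)
    show "(\<Sum>k\<in>UNIV. chart_deriv c k (\<lambda>p'. vol_dens c p' * Y c p' $ k) p) / vol_dens c p = D p"
      if "p \<in> chart_dom c" for p
      using D[OF c that, symmetric] vol_dens_pos[OF c that] by simp
  qed
  obtain P :: "'a set" and ch :: "'a \<Rightarrow> ('a, 'n) chart"
    and K :: "'a \<Rightarrow> (real^'n) set" and \<rho> :: "'a \<Rightarrow> 'a \<Rightarrow> real" where P: "finite P"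
    "\<And>p. p \<in> P \<Longrightarrow> ch p \<in> A \<and> compact (K p) \<and> K p \<subseteq> coord (ch p) ` chart_dom (ch p)"
    "\<And>p d. p \<in> P \<Longrightarrow> d \<in> A \<Longrightarrow> chart_Ck 1 d (\<rho> p)"
    "\<And>p q. p \<in> P \<Longrightarrow> q \<notin> chart_inv (ch p) ` K p \<Longrightarrow> \<rho> p q = 0"
    "\<And>q. q \<in> topspace M \<Longrightarrow> (\<Sum>p\<in>P. \<rho> p q) = 1"
    by (rule partition_of_unity, rule that)
  define h where "h p q = \<rho> p q * D q + lie_fun A Y (\<rho> p) q" for p q
  have hC: "chart_Ck 0 d (h p)" if "p \<in> P" "d \<in> A" for p d
    unfolding h_def
    by (intro chart_Ck_add chart_Ck_mult that contD lie_fun_continuous[OF Y] P(3))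
      (rule chart_C1_imp_C0[OF that(2) P(3)[OF that]])
  have int_h: "integrable ?\<mu> (h p)" if "p \<in> P" for p
    by (rule integrable_dvol_continuous) (rule hC[OF that])
  have zero_h: "(LINT q|?\<mu>. h p q) = 0" if p: "p \<in> P" for p
  proof -
    let ?c = "ch p"
    let ?S = "coord ?c ` chart_dom ?c"
    have c: "?c \<in> A" and K: "compact (K p)" "K p \<subseteq> ?S" using P(2)[OF p] by auto
    have \<rho>0: "\<rho> p q = 0" if "q \<notin> chart_inv ?c ` K p" for q using P(4) p that by blast
    have \<rho>1: "chart_Ck 1 d (\<rho> p)" if "d \<in> A" for d using P(3) p that by blast
    have out: "\<rho> p (chart_inv ?c x) = 0" if "x \<in> ?S" "x \<notin> K p" for x
    proof (rule \<rho>0, rule notI)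
      assume "chart_inv ?c x \<in> chart_inv ?c ` K p"
      then obtain y where "y \<in> K p" "chart_inv ?c x = chart_inv ?c y" by auto
      then show False using that K(2) coord_chart_inv[OF c] by (metis subsetD)
    qed
    \<comment> \<open>the derivatives of \<open>\<rho> p\<close> vanish too, because \<open>\<rho> p\<close> is zero on the open complement of its support\<close>
    have h0: "h p q = 0" if q: "q \<in> topspace M" "q \<notin> chart_dom ?c" for q
    proof -
      let ?d = "chart_at A q"
      have d: "?d \<in> A" "q \<in> chart_dom ?d" using chart_at[OF q(1)] by auto
      have "q \<notin> chart_inv ?c ` K p" using q K chart_inv_in[OF c] by blast
      moreover from this have "chart_deriv ?d k (\<rho> p) q = chart_deriv ?d k (\<lambda>q. 0) q" for k
        by (intro chart_deriv_cong[OF d(1) chart_compact_closed[OF c K] _ d(2)]) (use q \<rho>0 in auto)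
      ultimately show ?thesis by (simp add: h_def lie_fun_def \<rho>0 chart_deriv_const)
    qed
    define u where "u k x = indicator ?S x *\<^sub>R (\<rho> p (chart_inv ?c x) *
        (vol_dens ?c (chart_inv ?c x) * Y ?c (chart_inv ?c x) $ k))" for k x
    have uC: "Ck_on 1 UNIV (u k)" for k
      unfolding u_def
    proof (rule Ck_on_extend_by_zero[OF open_img[OF c] K])
      show "Ck_on 1 ?S (\<lambda>x. \<rho> p (chart_inv ?c x) *
          (vol_dens ?c (chart_inv ?c x) * Y ?c (chart_inv ?c x) $ k))"
        using chart_Ck_mult[OF c \<rho>1[OF c] VY[OF c, of k]] unfolding chart_Ck_def .
    qed (simp add: out)
    have u0: "u k x = 0" if "x \<notin> K p" for k x
      using out[of x] that by (auto simp: u_def indicator_def)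
    have du: "indicator ?S x *\<^sub>R (vol_dens ?c (chart_inv ?c x) * h p (chart_inv ?c x)) =
        (\<Sum>k\<in>UNIV. partial_deriv k (u k) x)" for x
    proof (cases "x \<in> ?S")
      case True
      let ?q = "chart_inv ?c x"
      have q: "?q \<in> chart_dom ?c" "coord ?c ?q = x" using chart_inv_in[OF c True] coord_chart_inv[OF c True] by auto
      have "partial_deriv k (u k) x = chart_deriv ?c k (\<lambda>q. \<rho> p q * (vol_dens ?c q * Y ?c q $ k)) ?q" for k
        unfolding chart_deriv_def q(2)
        by (rule partial_deriv_cong[OF open_img[OF c] True]) (simp add: u_def)
      also have "\<dots> k = \<rho> p ?q * chart_deriv ?c k (\<lambda>q. vol_dens ?c q * Y ?c q $ k) ?q +
          chart_deriv ?c k (\<rho> p) ?q * (vol_dens ?c ?q * Y ?c ?q $ k)" for k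
        by (rule chart_deriv_mult[OF c q(1) \<rho>1[OF c] VY[OF c]])
      finally have "(\<Sum>k\<in>UNIV. partial_deriv k (u k) x) =
          \<rho> p ?q * (\<Sum>k\<in>UNIV. chart_deriv ?c k (\<lambda>q. vol_dens ?c q * Y ?c q $ k) ?q) +
          (\<Sum>k\<in>UNIV. chart_deriv ?c k (\<rho> p) ?q * (vol_dens ?c ?q * Y ?c ?q $ k))"
        by (simp only: sum.distrib sum_distrib_left)
      also have "(\<Sum>k\<in>UNIV. chart_deriv ?c k (\<lambda>q. vol_dens ?c q * Y ?c q $ k) ?q) = vol_dens ?c ?q * D ?q"
        by (rule D[OF c q(1), symmetric])
      also have "(\<Sum>k\<in>UNIV. chart_deriv ?c k (\<rho> p) ?q * (vol_dens ?c ?q * Y ?c ?q $ k)) =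
          vol_dens ?c ?q * lie_fun A Y (\<rho> p) ?q"
        by (simp only: lie_fun_eq[OF Y(1) \<rho>1 c q(1)] sum_distrib_left mult_ac)
      finally have "(\<Sum>k\<in>UNIV. partial_deriv k (u k) x) =
          \<rho> p ?q * (vol_dens ?c ?q * D ?q) + vol_dens ?c ?q * lie_fun A Y (\<rho> p) ?q" .
      then show ?thesis using True by (simp add: h_def algebra_simps)
    next
      case False
      then have "partial_deriv k (u k) x = 0" for k
        by (intro partial_deriv_zero_outside[of "K p"]) (use u0 K compact_imp_closed in auto)
      then show ?thesis using False by simp
    qed
    have "(LINT q|?\<mu>. h p q) = (LINT x|lborel. (\<Sum>k\<in>UNIV. partial_deriv k (u k) x))"
      using integral_dvol_chart(2)[OF c chart_continuous_measurable[OF hC[OF p]] h0] du by simp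
    also have "\<dots> = (\<Sum>k\<in>UNIV. LINT x|lborel. partial_deriv k (u k) x)"
      by (rule Bochner_Integration.integral_sum) (rule integral_partial_deriv_compact_support(1)[OF uC K(1) u0])
    also have "\<dots> = 0"
      using integral_partial_deriv_compact_support(2)[OF uC K(1) u0] by simp
    finally show ?thesis .
  qed
  have "(\<Sum>p\<in>P. h p q) = D q" if q: "q \<in> space ?\<mu>" for q
  proof -
    obtain d where d: "d \<in> A" "q \<in> chart_dom d" using q by (auto simp: space_dvol topspace_M)
    have "(\<Sum>p\<in>P. lie_fun A Y (\<rho> p) q) = (\<Sum>p\<in>P. \<Sum>k\<in>UNIV. Y d q $ k * chart_deriv d k (\<rho> p) q)"
      using lie_fun_eq[OF Y(1) P(3) d] by simp
    also have "\<dots> = (\<Sum>k\<in>UNIV. Y d q $ k * (\<Sum>p\<in>P. chart_deriv d k (\<rho> p) q))"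
      unfolding sum_distrib_left by (rule sum.swap)
    also have "\<dots> = (\<Sum>k\<in>UNIV. Y d q $ k * chart_deriv d k (\<lambda>q. \<Sum>p\<in>P. \<rho> p q) q)"
      by (simp only: chart_deriv_sum[of d q P \<rho>, OF d P(3)[OF _ d(1)]])
    also have "\<dots> = (\<Sum>k\<in>UNIV. Y d q $ k * chart_deriv d k (\<lambda>q. 1) q)"
    proof -
      have "chart_deriv d k (\<lambda>q. \<Sum>p\<in>P. \<rho> p q) q = chart_deriv d k (\<lambda>q. 1) q" for k
        by (rule chart_deriv_cong[OF d(1) openin_dom[OF d(1)] d(2) d(2)])
          (use P(5) dom_subset[OF d(1)] in blast)
      then show ?thesis by simp
    qed
    also have "\<dots> = 0" by (simp add: chart_deriv_const)
    finally have "(\<Sum>p\<in>P. lie_fun A Y (\<rho> p) q) = 0" .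
    then show ?thesis using P(5)[of q] q
      by (simp add: h_def sum.distrib sum_distrib_right[symmetric] space_dvol)
  qed
  then have "(LINT q|?\<mu>. D q) = (LINT q|?\<mu>. (\<Sum>p\<in>P. h p q))"
    by (intro Bochner_Integration.integral_cong) auto
  also have "\<dots> = (\<Sum>p\<in>P. LINT q|?\<mu>. h p q)"
    by (rule Bochner_Integration.integral_sum) (rule int_h)
  finally show ?thesis using zero_h by simp
qed

end

section \<open>The divergence identity\<close>

lemma sum_rotate3:
  "(\<Sum>i\<in>I. \<Sum>j\<in>J. \<Sum>k\<in>K. f i j k) = (\<Sum>k\<in>K. \<Sum>i\<in>I. \<Sum>j\<in>J. f i j k)"
proof -
  have "(\<Sum>i\<in>I. \<Sum>j\<in>J. \<Sum>k\<in>K. f i j k) = (\<Sum>i\<in>I. \<Sum>k\<in>K. \<Sum>j\<in>J. f i j k)"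
    by (intro sum.cong refl sum.swap)
  then show ?thesis by (simp only: sum.swap[of _ K I])
qed

text \<open>
  The values at one point, in one chart, of everything that enters \<open>div Y\<close>: the inverse metric \<open>h\<close>, the metric
  \<open>G\<close>, the tensor \<open>Q\<close>, their first derivatives \<open>dG k i j = \<partial>\<^sub>k g\<^sub>i\<^sub>j\<close> and \<open>dQ\<close>, the vector \<open>X\<close> with
  \<open>dX k i = \<partial>\<^sub>k X\<^sup>i\<close>, the differential \<open>dt\<close> of the trace \<open>\<tau>\<close>, and \<open>P = q\<^sup>k\<^sub>i\<close>. The assumptions \<open>lie\<close> and \<open>div\<close> are the
  soliton equation and the condition \<open>div q = (1/2) \<nabla>\<tau>\<close>. What follows is finite sums over real numbers.
\<close>

locale index_calculus =
  fixes h G Q :: "'n::finite \<Rightarrow> 'n \<Rightarrow> real" and dG dQ :: "'n \<Rightarrow> 'n \<Rightarrow> 'n \<Rightarrow> real"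
    and X :: "'n \<Rightarrow> real" and dX :: "'n \<Rightarrow> 'n \<Rightarrow> real" and dt :: "'n \<Rightarrow> real" and \<phi> :: real
    and \<Gamma> :: "'n \<Rightarrow> 'n \<Rightarrow> 'n \<Rightarrow> real" and P :: "'n \<Rightarrow> 'n \<Rightarrow> real"
  assumes h_sym: "h i j = h j i" and G_sym: "G i j = G j i" and Q_sym: "Q i j = Q j i"
    and dG_sym: "dG k i j = dG k j i"
    and hG: "(\<Sum>j\<in>UNIV. h i j * G j k) = (if i = k then 1 else 0)"
    and lie: "(\<Sum>k\<in>UNIV. X k * dG k i j + G k j * dX i k + G i k * dX j k) = Q i j + 2 * \<phi> * G i j"
    and \<Gamma>: "\<Gamma> k i j = (1/2) * (\<Sum>l\<in>UNIV. h k l * (dG i j l + dG j i l - dG l i j))"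
    and div: "(\<Sum>i\<in>UNIV. \<Sum>k\<in>UNIV. h i k * (dQ k i j - (\<Sum>l\<in>UNIV. \<Gamma> l k i * Q l j)
        - (\<Sum>l\<in>UNIV. \<Gamma> l k j * Q i l))) = (1/2) * dt j"
    and P: "P k i = (\<Sum>j\<in>UNIV. h k j * Q j i)"
begin

text \<open>
  \<open>m\<close> and \<open>w\<close> are the two contractions of \<open>\<partial>g\<close> with the inverse metric, \<open>m\<^sub>k = g\<^sup>i\<^sup>j \<partial>\<^sub>k g\<^sub>i\<^sub>j\<close> (twice the logarithmic
  derivative of the volume density) and \<open>w\<^sub>b = g\<^sup>k\<^sup>a \<partial>\<^sub>k g\<^sub>a\<^sub>b\<close>; \<open>R = q\<^sup>i\<^sup>j\<close> is \<open>q\<close> with both indices raised.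
\<close>

definition m :: "'n \<Rightarrow> real" where "m k = (\<Sum>i\<in>UNIV. \<Sum>j\<in>UNIV. h i j * dG k i j)"
definition w :: "'n \<Rightarrow> real" where "w b = (\<Sum>k\<in>UNIV. \<Sum>a\<in>UNIV. h k a * dG k a b)"
definition R :: "'n \<Rightarrow> 'n \<Rightarrow> real" where "R i j = (\<Sum>b\<in>UNIV. P i b * h b j)"

lemma R_sym: "R i j = R j i"
proof -
  have "R i j = (\<Sum>b\<in>UNIV. \<Sum>a\<in>UNIV. h i a * Q a b * h b j)"
    by (simp add: R_def P sum_distrib_right)
  also have "\<dots> = (\<Sum>a\<in>UNIV. \<Sum>b\<in>UNIV. h i a * Q a b * h b j)" by (rule sum.swap)
  also have "\<dots> = (\<Sum>a\<in>UNIV. \<Sum>b\<in>UNIV. h j b * Q b a * h a i)"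
  proof -
    have "h i a * Q a b * h b j = h j b * Q b a * h a i" for a b
      using h_sym[of i a] Q_sym[of a b] h_sym[of b j] by simp
    then show ?thesis by (simp only:)
  qed
  also have "\<dots> = R j i" by (simp add: R_def P sum_distrib_right)
  finally show ?thesis .
qed

text \<open>
  The soliton equation contracted with a symmetric tensor \<open>S\<^sup>i\<^sup>j\<close>: the two terms with derivatives of \<open>X\<close>
  coincide. It is used for \<open>S = g\<^sup>-\<^sup>1\<close>, where it gives the divergence of \<open>X\<close>, and for \<open>S = q\<^sup>i\<^sup>j\<close>.
\<close>

lemma lie_contract:
  assumes S: "\<And>i j. S i j = S j i"
  shows "(\<Sum>i\<in>UNIV. \<Sum>j\<in>UNIV. S i j * (Q i j + 2 * \<phi> * G i j)) =
    (\<Sum>k\<in>UNIV. X k * (\<Sum>i\<in>UNIV. \<Sum>j\<in>UNIV. S i j * dG k i j))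
    + 2 * (\<Sum>i\<in>UNIV. \<Sum>k\<in>UNIV. (\<Sum>j\<in>UNIV. S i j * G j k) * dX i k)"
proof -
  let ?B = "\<Sum>i\<in>UNIV. \<Sum>k\<in>UNIV. (\<Sum>j\<in>UNIV. S i j * G j k) * dX i k"
  have "(\<Sum>i\<in>UNIV. \<Sum>j\<in>UNIV. S i j * (Q i j + 2 * \<phi> * G i j)) =
      (\<Sum>i\<in>UNIV. \<Sum>j\<in>UNIV. \<Sum>k\<in>UNIV. X k * (S i j * dG k i j)) +
      (\<Sum>i\<in>UNIV. \<Sum>j\<in>UNIV. \<Sum>k\<in>UNIV. S i j * G k j * dX i k) +
      (\<Sum>i\<in>UNIV. \<Sum>j\<in>UNIV. \<Sum>k\<in>UNIV. S i j * G i k * dX j k)"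
    unfolding lie[symmetric] by (simp add: sum.distrib sum_distrib_left algebra_simps)
  also have "(\<Sum>i\<in>UNIV. \<Sum>j\<in>UNIV. \<Sum>k\<in>UNIV. X k * (S i j * dG k i j)) =
      (\<Sum>k\<in>UNIV. X k * (\<Sum>i\<in>UNIV. \<Sum>j\<in>UNIV. S i j * dG k i j))"
    by (subst sum_rotate3) (simp add: sum_distrib_left)
  also have "(\<Sum>i\<in>UNIV. \<Sum>j\<in>UNIV. \<Sum>k\<in>UNIV. S i j * G k j * dX i k) = ?B"
  proof (rule sum.cong)
    fix i
    have "(\<Sum>j\<in>UNIV. \<Sum>k\<in>UNIV. S i j * G k j * dX i k) = (\<Sum>k\<in>UNIV. \<Sum>j\<in>UNIV. S i j * G k j * dX i k)"
      by (rule sum.swap)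
    then show "(\<Sum>j\<in>UNIV. \<Sum>k\<in>UNIV. S i j * G k j * dX i k) =
        (\<Sum>k\<in>UNIV. (\<Sum>j\<in>UNIV. S i j * G j k) * dX i k)"
      by (simp add: sum_distrib_right G_sym)
  qed simp
  also have "(\<Sum>i\<in>UNIV. \<Sum>j\<in>UNIV. \<Sum>k\<in>UNIV. S i j * G i k * dX j k) = ?B"
  proof -
    have "(\<Sum>i\<in>UNIV. \<Sum>j\<in>UNIV. \<Sum>k\<in>UNIV. S i j * G i k * dX j k) =
        (\<Sum>j\<in>UNIV. \<Sum>k\<in>UNIV. \<Sum>i\<in>UNIV. S i j * G i k * dX j k)"
      by (subst sum_rotate3[symmetric]) simp
    then show ?thesis by (simp add: sum_distrib_right S)
  qed
  finally show ?thesis by simp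
qed

lemma contract_rhs:
  "(\<Sum>i\<in>UNIV. \<Sum>j\<in>UNIV. S i j * (Q i j + 2 * \<phi> * G i j)) =
    (\<Sum>i\<in>UNIV. \<Sum>j\<in>UNIV. S i j * Q j i) + 2 * \<phi> * (\<Sum>i\<in>UNIV. \<Sum>j\<in>UNIV. S i j * G j i)"
proof -
  have "S i j * (Q i j + 2 * \<phi> * G i j) = S i j * Q j i + 2 * \<phi> * (S i j * G j i)" for i j
    using Q_sym[of i j] G_sym[of i j] by (simp add: algebra_simps)
  then show ?thesis by (simp only: sum.distrib sum_distrib_left)
qed

text \<open>
  The left-hand side is \<open>div X\<close>, since \<open>m/2\<close> is the logarithmic derivative of the volume density.
\<close>

lemma divergence_X:
  "(\<Sum>k\<in>UNIV. dX k k) + (1/2) * (\<Sum>k\<in>UNIV. m k * X k) =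
    (1/2) * (\<Sum>i\<in>UNIV. P i i) + real CARD('n) * \<phi>"
proof -
  have 1: "(\<Sum>i\<in>UNIV. \<Sum>j\<in>UNIV. h i j * (Q i j + 2 * \<phi> * G i j)) =
      (\<Sum>i\<in>UNIV. P i i) + 2 * \<phi> * real CARD('n)"
    unfolding contract_rhs P[symmetric] hG by simp
  have 2: "(\<Sum>i\<in>UNIV. \<Sum>k\<in>UNIV. (\<Sum>j\<in>UNIV. h i j * G j k) * dX i k) = (\<Sum>k\<in>UNIV. dX k k)"
    by (simp add: hG if_distrib[of "\<lambda>x. x * _"] cong: if_cong)
  have 3: "(\<Sum>k\<in>UNIV. X k * (\<Sum>i\<in>UNIV. \<Sum>j\<in>UNIV. h i j * dG k i j)) = (\<Sum>k\<in>UNIV. m k * X k)"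
    by (simp add: m_def mult.commute)
  show ?thesis using lie_contract[of h, OF h_sym] unfolding 1 2 3 by (simp add: field_simps)
qed

lemma contracted_christoffel:
  "(\<Sum>i\<in>UNIV. \<Sum>k\<in>UNIV. h i k * \<Gamma> l k i) = (\<Sum>b\<in>UNIV. h l b * (w b - (1/2) * m b))"
proof -
  have a: "(\<Sum>i\<in>UNIV. \<Sum>k\<in>UNIV. h i k * dG k i b) = w b" for b
    unfolding w_def by (subst sum.swap) (simp add: h_sym)
  have b: "(\<Sum>i\<in>UNIV. \<Sum>k\<in>UNIV. h i k * dG i k b) = w b" for b
    by (simp add: w_def)
  have c: "(\<Sum>i\<in>UNIV. \<Sum>k\<in>UNIV. h i k * dG b k i) = m b" for b
    unfolding m_def by (simp add: dG_sym)
  have "(\<Sum>i\<in>UNIV. \<Sum>k\<in>UNIV. h i k * \<Gamma> l k i) =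
      (\<Sum>i\<in>UNIV. \<Sum>k\<in>UNIV. \<Sum>b\<in>UNIV. (1/2) * h l b * (h i k * dG k i b + h i k * dG i k b - h i k * dG b k i))"
    unfolding \<Gamma> by (simp add: sum_distrib_left algebra_simps)
  also have "\<dots> = (\<Sum>b\<in>UNIV. \<Sum>i\<in>UNIV. \<Sum>k\<in>UNIV.
      (1/2) * h l b * (h i k * dG k i b + h i k * dG i k b - h i k * dG b k i))"
    by (rule sum_rotate3)
  also have "\<dots> = (\<Sum>b\<in>UNIV. (1/2) * h l b * (w b + w b - m b))"
    unfolding sum_distrib_left[symmetric] sum.distrib sum_subtractf a b c ..
  finally show ?thesis by (simp add: algebra_simps)
qed

text \<open>
  In the second Christoffel term, \<open>q\<^sup>k\<^sup>b\<close> is contracted with \<open>\<partial>\<^sub>k g\<^sub>j\<^sub>b + \<partial>\<^sub>j g\<^sub>k\<^sub>b - \<partial>\<^sub>b g\<^sub>k\<^sub>j\<close>; the first and the third summand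
  form an expression antisymmetric in \<open>k\<close> and \<open>b\<close> and drop out.
\<close>

lemma div_expanded:
  "(\<Sum>i\<in>UNIV. \<Sum>k\<in>UNIV. h i k * dQ k i j) - (\<Sum>b\<in>UNIV. (w b - (1/2) * m b) * P b j)
    - (1/2) * (\<Sum>k\<in>UNIV. \<Sum>b\<in>UNIV. R k b * dG j k b) = (1/2) * dt j"
proof -
  have A: "(\<Sum>i\<in>UNIV. \<Sum>k\<in>UNIV. h i k * (\<Sum>l\<in>UNIV. \<Gamma> l k i * Q l j)) =
      (\<Sum>b\<in>UNIV. (w b - (1/2) * m b) * P b j)"
  proof -
    have "(\<Sum>i\<in>UNIV. \<Sum>k\<in>UNIV. h i k * (\<Sum>l\<in>UNIV. \<Gamma> l k i * Q l j)) =
        (\<Sum>i\<in>UNIV. \<Sum>k\<in>UNIV. \<Sum>l\<in>UNIV. h i k * \<Gamma> l k i * Q l j)"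
      by (simp add: sum_distrib_left mult.assoc)
    also have "\<dots> = (\<Sum>l\<in>UNIV. \<Sum>i\<in>UNIV. \<Sum>k\<in>UNIV. h i k * \<Gamma> l k i * Q l j)"
      by (rule sum_rotate3)
    also have "\<dots> = (\<Sum>l\<in>UNIV. \<Sum>b\<in>UNIV. (w b - (1/2) * m b) * (h b l * Q l j))"
      unfolding sum_distrib_right[symmetric] contracted_christoffel
      by (simp add: sum_distrib_right sum_distrib_left h_sym mult_ac)
    also have "\<dots> = (\<Sum>b\<in>UNIV. \<Sum>l\<in>UNIV. (w b - (1/2) * m b) * (h b l * Q l j))"
      by (rule sum.swap)
    finally show ?thesis by (simp add: P sum_distrib_left)
  qed
  have B: "(\<Sum>i\<in>UNIV. \<Sum>k\<in>UNIV. h i k * (\<Sum>l\<in>UNIV. \<Gamma> l k j * Q i l)) =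
      (1/2) * (\<Sum>k\<in>UNIV. \<Sum>b\<in>UNIV. R k b * dG j k b)"
  proof -
    let ?t = "\<lambda>k b. dG k j b + dG j k b - dG b k j"
    have "(\<Sum>i\<in>UNIV. \<Sum>k\<in>UNIV. h i k * (\<Sum>l\<in>UNIV. \<Gamma> l k j * Q i l)) =
        (\<Sum>k\<in>UNIV. \<Sum>i\<in>UNIV. \<Sum>l\<in>UNIV. h k i * Q i l * \<Gamma> l k j)"
      by (subst sum.swap) (simp add: sum_distrib_left h_sym mult_ac)
    also have "\<dots> = (\<Sum>k\<in>UNIV. \<Sum>l\<in>UNIV. \<Sum>i\<in>UNIV. h k i * Q i l * \<Gamma> l k j)"
      by (intro sum.cong refl sum.swap)
    also have "\<dots> = (\<Sum>k\<in>UNIV. \<Sum>l\<in>UNIV. P k l * \<Gamma> l k j)"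
      by (simp only: P sum_distrib_right)
    also have "\<dots> = (\<Sum>k\<in>UNIV. \<Sum>l\<in>UNIV. \<Sum>b\<in>UNIV. (1/2) * (P k l * h l b * ?t k b))"
      unfolding \<Gamma> by (simp add: sum_distrib_left algebra_simps)
    also have "\<dots> = (\<Sum>k\<in>UNIV. \<Sum>b\<in>UNIV. \<Sum>l\<in>UNIV. (1/2) * (P k l * h l b * ?t k b))"
      by (intro sum.cong refl sum.swap)
    also have "\<dots> = (1/2) * (\<Sum>k\<in>UNIV. \<Sum>b\<in>UNIV. R k b * ?t k b)"
      by (simp only: R_def sum_distrib_left sum_distrib_right)
    also have "(\<Sum>k\<in>UNIV. \<Sum>b\<in>UNIV. R k b * ?t k b) = (\<Sum>k\<in>UNIV. \<Sum>b\<in>UNIV. R k b * dG k j b) +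
        (\<Sum>k\<in>UNIV. \<Sum>b\<in>UNIV. R k b * dG j k b) - (\<Sum>k\<in>UNIV. \<Sum>b\<in>UNIV. R k b * dG b k j)"
      by (simp add: sum.distrib sum_subtractf algebra_simps)
    also have "(\<Sum>k\<in>UNIV. \<Sum>b\<in>UNIV. R k b * dG b k j) = (\<Sum>k\<in>UNIV. \<Sum>b\<in>UNIV. R k b * dG k j b)"
    proof -
      have "R b k * dG k b j = R k b * dG k j b" for b k
        using R_sym[of b k] dG_sym[of k b j] by simp
      then show ?thesis by (subst sum.swap) (simp only:)
    qed
    finally show ?thesis by simp
  qed
  have "(\<Sum>i\<in>UNIV. \<Sum>k\<in>UNIV. h i k * (dQ k i j - (\<Sum>l\<in>UNIV. \<Gamma> l k i * Q l j) - (\<Sum>l\<in>UNIV. \<Gamma> l k j * Q i l))) =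
      (\<Sum>i\<in>UNIV. \<Sum>k\<in>UNIV. h i k * dQ k i j) -
      (\<Sum>i\<in>UNIV. \<Sum>k\<in>UNIV. h i k * (\<Sum>l\<in>UNIV. \<Gamma> l k i * Q l j)) -
      (\<Sum>i\<in>UNIV. \<Sum>k\<in>UNIV. h i k * (\<Sum>l\<in>UNIV. \<Gamma> l k j * Q i l))"
    by (simp only: right_diff_distrib sum_subtractf)
  then show ?thesis unfolding A B using div[of j] by simp
qed

lemma lie_contract_R:
  "(\<Sum>k\<in>UNIV. X k * (\<Sum>i\<in>UNIV. \<Sum>j\<in>UNIV. R i j * dG k i j)) + 2 * (\<Sum>i\<in>UNIV. \<Sum>k\<in>UNIV. P i k * dX i k) =
    (\<Sum>i\<in>UNIV. \<Sum>k\<in>UNIV. P i k * P k i) + 2 * \<phi> * (\<Sum>i\<in>UNIV. P i i)"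
proof -
  have RG: "(\<Sum>j\<in>UNIV. R i j * G j k) = P i k" for i k
  proof -
    have "(\<Sum>j\<in>UNIV. R i j * G j k) = (\<Sum>j\<in>UNIV. \<Sum>b\<in>UNIV. P i b * (h b j * G j k))"
      by (simp add: R_def sum_distrib_right mult.assoc)
    also have "\<dots> = (\<Sum>b\<in>UNIV. P i b * (\<Sum>j\<in>UNIV. h b j * G j k))"
      by (subst sum.swap) (simp add: sum_distrib_left)
    finally show ?thesis by (simp add: hG if_distrib cong: if_cong)
  qed
  have RQ: "(\<Sum>j\<in>UNIV. R i j * Q j k) = (\<Sum>b\<in>UNIV. P i b * P b k)" for i k
  proof -
    have "(\<Sum>j\<in>UNIV. R i j * Q j k) = (\<Sum>j\<in>UNIV. \<Sum>b\<in>UNIV. P i b * (h b j * Q j k))"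
      by (simp add: R_def sum_distrib_right mult.assoc)
    also have "\<dots> = (\<Sum>b\<in>UNIV. P i b * (\<Sum>j\<in>UNIV. h b j * Q j k))"
      by (subst sum.swap) (simp add: sum_distrib_left)
    finally show ?thesis by (simp add: P)
  qed
  have "(\<Sum>i\<in>UNIV. \<Sum>j\<in>UNIV. R i j * (Q i j + 2 * \<phi> * G i j)) =
      (\<Sum>i\<in>UNIV. \<Sum>k\<in>UNIV. P i k * P k i) + 2 * \<phi> * (\<Sum>i\<in>UNIV. P i i)"
    unfolding contract_rhs RQ RG ..
  then show ?thesis using lie_contract[of R, OF R_sym] unfolding RG by simp
qed

text \<open>
  The left-hand side is \<open>div V\<close> for \<open>V\<^sup>k = q\<^sup>k\<^sub>i X\<^sup>i\<close>, with the derivative of the inverse metric expanded. The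
  first Christoffel term of \<open>div q\<close> absorbs the derivatives of the inverse metric and of the density, which
  leaves \<open>(div q)(X) + q\<^sup>i\<^sup>j (\<nabla>X)\<^sub>i\<^sub>j\<close>; the hypotheses then replace \<open>div q\<close>, and the
  symmetric part of \<open>\<nabla>X\<close> by \<open>q/2 + \<phi> g\<close>.
\<close>

lemma divergence_PX:
  "(\<Sum>k\<in>UNIV. \<Sum>i\<in>UNIV. (\<Sum>j\<in>UNIV. - (\<Sum>a\<in>UNIV. \<Sum>b\<in>UNIV. h k a * dG k a b * h b j) * Q j i + h k j * dQ k j i) * X i
      + P k i * dX k i) + (1/2) * (\<Sum>k\<in>UNIV. m k * (\<Sum>i\<in>UNIV. P k i * X i)) =
    (1/2) * (\<Sum>k\<in>UNIV. X k * dt k) + (1/2) * (\<Sum>i\<in>UNIV. \<Sum>k\<in>UNIV. P i k * P k i) + \<phi> * (\<Sum>i\<in>UNIV. P i i)"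
proof -
  have inner: "(\<Sum>j\<in>UNIV. (\<Sum>a\<in>UNIV. \<Sum>b\<in>UNIV. h k a * dG k a b * h b j) * Q j i) =
      (\<Sum>a\<in>UNIV. \<Sum>b\<in>UNIV. h k a * dG k a b * P b i)" for k i
  proof -
    have "(\<Sum>j\<in>UNIV. (\<Sum>a\<in>UNIV. \<Sum>b\<in>UNIV. h k a * dG k a b * h b j) * Q j i) =
        (\<Sum>j\<in>UNIV. \<Sum>a\<in>UNIV. \<Sum>b\<in>UNIV. h k a * dG k a b * (h b j * Q j i))"
      by (simp add: sum_distrib_right mult.assoc)
    also have "\<dots> = (\<Sum>a\<in>UNIV. \<Sum>b\<in>UNIV. \<Sum>j\<in>UNIV. h k a * dG k a b * (h b j * Q j i))"
      by (rule sum_rotate3[symmetric])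
    finally show ?thesis by (simp add: P sum_distrib_left)
  qed
  have W: "(\<Sum>k\<in>UNIV. \<Sum>a\<in>UNIV. \<Sum>b\<in>UNIV. h k a * dG k a b * P b i) = (\<Sum>b\<in>UNIV. w b * P b i)" for i
    by (subst sum_rotate3) (simp add: w_def sum_distrib_right)
  have H: "(\<Sum>k\<in>UNIV. \<Sum>j\<in>UNIV. h k j * dQ k j i) = (\<Sum>j\<in>UNIV. \<Sum>k\<in>UNIV. h j k * dQ k j i)" for i
    by (subst sum.swap) (simp add: h_sym)
  have "(\<Sum>k\<in>UNIV. \<Sum>i\<in>UNIV. (\<Sum>j\<in>UNIV. - (\<Sum>a\<in>UNIV. \<Sum>b\<in>UNIV. h k a * dG k a b * h b j) * Q j i + h k j * dQ k j i) * X i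
      + P k i * dX k i) =
    (\<Sum>k\<in>UNIV. \<Sum>i\<in>UNIV. ((\<Sum>j\<in>UNIV. h k j * dQ k j i) - (\<Sum>a\<in>UNIV. \<Sum>b\<in>UNIV. h k a * dG k a b * P b i)) * X i)
      + (\<Sum>k\<in>UNIV. \<Sum>i\<in>UNIV. P k i * dX k i)"
    by (simp only: inner[symmetric] sum.distrib mult_minus_left sum_negf) simp
  also have "(\<Sum>k\<in>UNIV. \<Sum>i\<in>UNIV. ((\<Sum>j\<in>UNIV. h k j * dQ k j i) - (\<Sum>a\<in>UNIV. \<Sum>b\<in>UNIV. h k a * dG k a b * P b i)) * X i) =
    (\<Sum>i\<in>UNIV. (\<Sum>k\<in>UNIV. (\<Sum>j\<in>UNIV. h k j * dQ k j i) - (\<Sum>a\<in>UNIV. \<Sum>b\<in>UNIV. h k a * dG k a b * P b i)) * X i)"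
    by (subst sum.swap) (simp only: sum_distrib_right)
  also have "\<dots> = (\<Sum>i\<in>UNIV. ((\<Sum>j\<in>UNIV. \<Sum>k\<in>UNIV. h j k * dQ k j i) - (\<Sum>b\<in>UNIV. w b * P b i)) * X i)"
    by (simp only: sum_subtractf W H)
  finally have 1: "(\<Sum>k\<in>UNIV. \<Sum>i\<in>UNIV. (\<Sum>j\<in>UNIV. - (\<Sum>a\<in>UNIV. \<Sum>b\<in>UNIV. h k a * dG k a b * h b j) * Q j i + h k j * dQ k j i) * X i
      + P k i * dX k i) = (\<Sum>i\<in>UNIV. ((\<Sum>j\<in>UNIV. \<Sum>k\<in>UNIV. h j k * dQ k j i) - (\<Sum>b\<in>UNIV. w b * P b i)) * X i)
      + (\<Sum>k\<in>UNIV. \<Sum>i\<in>UNIV. P k i * dX k i)" .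
  have 2: "(1/2) * (\<Sum>k\<in>UNIV. m k * (\<Sum>i\<in>UNIV. P k i * X i)) =
      (\<Sum>i\<in>UNIV. (\<Sum>b\<in>UNIV. (1/2) * m b * P b i) * X i)"
    by (simp only: sum_distrib_left sum_distrib_right, subst sum.swap) (simp only: mult_ac)
  have E: "(\<Sum>j\<in>UNIV. \<Sum>k\<in>UNIV. h j k * dQ k j i) - (\<Sum>b\<in>UNIV. w b * P b i) + (\<Sum>b\<in>UNIV. (1/2) * m b * P b i) =
      (1/2) * dt i + (1/2) * (\<Sum>k\<in>UNIV. \<Sum>b\<in>UNIV. R k b * dG i k b)" for i
    using div_expanded[of i] by (simp add: left_diff_distrib sum_subtractf)
  have "(\<Sum>i\<in>UNIV. ((\<Sum>j\<in>UNIV. \<Sum>k\<in>UNIV. h j k * dQ k j i) - (\<Sum>b\<in>UNIV. w b * P b i)) * X i) +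
      (\<Sum>i\<in>UNIV. (\<Sum>b\<in>UNIV. (1/2) * m b * P b i) * X i) =
      (\<Sum>i\<in>UNIV. ((1/2) * dt i + (1/2) * (\<Sum>k\<in>UNIV. \<Sum>b\<in>UNIV. R k b * dG i k b)) * X i)"
    unfolding E[symmetric] by (simp only: sum.distrib distrib_right)
  also have "\<dots> = (1/2) * (\<Sum>i\<in>UNIV. X i * dt i) + (1/2) * (\<Sum>i\<in>UNIV. X i * (\<Sum>k\<in>UNIV. \<Sum>b\<in>UNIV. R k b * dG i k b))"
  proof -
    have "(\<Sum>i\<in>UNIV. ((1/2) * a i + (1/2) * b i) * X i) =
        (1/2) * (\<Sum>i\<in>UNIV. X i * a i) + (1/2) * (\<Sum>i\<in>UNIV. X i * b i)" for a b :: "'n \<Rightarrow> real"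
      by (simp add: sum.distrib sum_distrib_left distrib_left mult_ac)
    then show ?thesis .
  qed
  finally show ?thesis using lie_contract_R unfolding 1 2 by simp
qed

end

section \<open>Extended solitons\<close>

locale closed_soliton = riemannian_atlas M A g
  for M :: "'a topology" and A :: "('a, 'n::finite) chart set" and g :: "('a, 'n) tensor2" +
  fixes q :: "('a, 'n) tensor2" and X :: "('a, 'n) vfield" and \<phi> :: "'a \<Rightarrow> real"
  assumes q: "symmetric_tensor_field A q" and X: "vector_field A X" and \<phi>: "smooth_function A \<phi>"
    and soliton: "extended_soliton A g q X \<phi>"
    and div_q: "\<forall>c\<in>A. \<forall>p\<in>chart_dom c. \<forall>j.
           div_tensor g q c p $ j = (1/2) * chart_deriv c j (tr A g q) p"
begin

abbreviation \<tau> :: "'a \<Rightarrow> real" where "\<tau> \<equiv> tr A g q"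

text \<open>
  The vector field \<open>q\<^sub>0(X, -)\<close> with its index raised, where \<open>q\<^sub>0\<close> is the traceless part of \<open>q\<close>.
\<close>

definition Y :: "('a, 'n) vfield" where
  "Y c p = raise q c p *v X c p - (\<tau> p / real CARD('n)) *\<^sub>R X c p"

text \<open>
  The squared norm \<open>|q\<^sub>0|\<^sup>2 = |q|\<^sup>2 - \<tau>\<^sup>2/n\<close>; as \<open>q\<close> is symmetric, \<open>|q|\<^sup>2\<close> is the trace of the square of the
  endomorphism \<open>g\<^sup>-\<^sup>1 q\<close>.
\<close>

definition sq_norm_q0 :: "'a \<Rightarrow> real" where
  "sq_norm_q0 p = (let c = chart_at A p in trace (raise q c p ** raise q c p)) - (\<tau> p)\<^sup>2 / real CARD('n)"

text \<open>
  The expression that \<open>divergence_Y\<close> identifies as the divergence of \<open>Y\<close>.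
\<close>

definition div_Y :: "'a \<Rightarrow> real" where
  "div_Y p = (1/2 - 1 / real CARD('n)) * lie_fun A X \<tau> p + (1/2) * sq_norm_q0 p"

lemma q_tensor: "tensor_field A q"
  using q by (simp add: symmetric_tensor_field_def)

lemma q_sym: "c \<in> A \<Longrightarrow> p \<in> chart_dom c \<Longrightarrow> q c p $ i $ j = q c p $ j $ i"
  using q by (simp add: symmetric_tensor_field_def vec_eq_iff transpose_def)

lemma q_Ck: "c \<in> A \<Longrightarrow> chart_Ck k c (\<lambda>p. q c p $ i $ j)"
  using q_tensor by (auto simp: tensor_field_def intro: chart_smooth_imp_Ck)

lemma X_Ck: "c \<in> A \<Longrightarrow> chart_Ck k c (\<lambda>p. X c p $ i)"
  using X by (auto simp: vector_field_def intro: chart_smooth_imp_Ck)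

lemma X_transforms: "transforms_as_vector A X"
  using X unfolding vector_field_def transforms_as_vector_def by blast

lemma raise_Ck: "c \<in> A \<Longrightarrow> chart_Ck k c (\<lambda>p. raise q c p $ i $ j)"
  by (simp add: matrix_matrix_mult_def) (intro chart_Ck_sum chart_Ck_mult ginv_Ck q_Ck)

lemma tau_Ck:
  assumes c: "c \<in> A"
  shows "chart_Ck k c \<tau>"
proof (rule chart_Ck_cong[OF c])
  show "chart_Ck k c (\<lambda>p. \<Sum>i\<in>UNIV. raise q c p $ i $ i)"
    by (intro chart_Ck_sum raise_Ck c)
  show "(\<Sum>i\<in>UNIV. raise q c p $ i $ i) = \<tau> p" if "p \<in> chart_dom c" for p
    using tr_eq[OF q c that] by (simp add: trace_def)
qed

lemma sq_norm_q0_eq: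
  assumes c: "c \<in> A" "p \<in> chart_dom c"
  shows "sq_norm_q0 p = trace (raise q c p ** raise q c p) - (\<tau> p)\<^sup>2 / real CARD('n)"
proof -
  let ?d = "chart_at A p"
  have d: "?d \<in> A" "p \<in> chart_dom ?d" using chart_at c dom_subset by blast+
  show ?thesis
    using trace_raise_change(2)[OF q_tensor c(1) d(1) c(2) d(2)] by (simp add: sq_norm_q0_def Let_def)
qed

lemma sq_norm_q0_continuous:
  assumes c: "c \<in> A"
  shows "chart_Ck 0 c sq_norm_q0"
proof (rule chart_Ck_cong[OF c])
  let ?f = "\<lambda>p. (\<Sum>i\<in>UNIV. \<Sum>k\<in>UNIV. raise q c p $ i $ k * raise q c p $ k $ i)
      + (- 1 / real CARD('n)) * (\<tau> p * \<tau> p)"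
  show "chart_Ck 0 c ?f"
    by (intro chart_Ck_add chart_Ck_sum chart_Ck_mult raise_Ck tau_Ck chart_Ck_const c)
  show "?f p = sq_norm_q0 p" if "p \<in> chart_dom c" for p
    by (simp add: sq_norm_q0_eq[OF c that] trace_def matrix_matrix_mult_def power2_eq_square)
qed

text \<open>
  With \<open>t = \<tau>/n\<close>, the trace of \<open>(g\<^sup>-\<^sup>1 q - t)\<^sup>2\<close> is \<open>|q|\<^sup>2 - 2 t \<tau> + n t\<^sup>2\<close>.
\<close>

lemma trace_traceless_part:
  assumes c: "c \<in> A" "p \<in> chart_dom c"
  defines "S \<equiv> q c p - (\<tau> p / real CARD('n)) *\<^sub>R g c p"
  shows "trace (matrix_inv (g c p) ** S ** (matrix_inv (g c p) ** S)) = sq_norm_q0 p" "transpose S = S"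
proof -
  let ?n = "real CARD('n)" and ?P = "raise q c p"
  define t where "t = \<tau> p / ?n"
  have inv: "matrix_inv (g c p) ** g c p = mat 1" using matrix_inv_mult det_g_nz c by blast
  have hS: "(matrix_inv (g c p) ** S) $ i $ j = ?P $ i $ j - (if i = j then t else 0)" for i j
  proof -
    have "(matrix_inv (g c p) ** S) $ i $ j = ?P $ i $ j - t * (matrix_inv (g c p) ** g c p) $ i $ j"
      by (simp add: S_def t_def[symmetric] matrix_matrix_mult_def right_diff_distrib sum_subtractf sum_distrib_left mult_ac)
    then show ?thesis by (simp add: inv mat_def)
  qed
  have tr: "(\<Sum>i\<in>UNIV. ?P $ i $ i) = \<tau> p" using tr_eq[OF q c] by (simp add: trace_def)
  have "trace (matrix_inv (g c p) ** S ** (matrix_inv (g c p) ** S)) =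
      (\<Sum>i\<in>UNIV. \<Sum>k\<in>UNIV. (?P $ i $ k - (if i = k then t else 0)) * (?P $ k $ i - (if k = i then t else 0)))"
    unfolding trace_def by (subst matrix_matrix_mult_def) (simp add: hS)
  also have "\<dots> = (\<Sum>i\<in>UNIV. \<Sum>k\<in>UNIV. ?P $ i $ k * ?P $ k $ i +
      (if i = k then t * t - 2 * t * ?P $ i $ i else 0))"
    by (intro sum.cong refl) (auto simp: algebra_simps)
  also have "\<dots> = (\<Sum>i\<in>UNIV. \<Sum>k\<in>UNIV. ?P $ i $ k * ?P $ k $ i) + ?n * (t * t) - 2 * t * \<tau> p"
    by (simp add: sum.distrib sum_subtractf sum_distrib_left[symmetric] tr mult.assoc)
  also have "(\<Sum>i\<in>UNIV. \<Sum>k\<in>UNIV. ?P $ i $ k * ?P $ k $ i) = trace (?P ** ?P)"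
    by (simp add: trace_def matrix_matrix_mult_def)
  also have "trace (?P ** ?P) + ?n * (t * t) - 2 * t * \<tau> p = sq_norm_q0 p"
    by (simp add: t_def sq_norm_q0_eq[OF c] power2_eq_square field_simps)
  finally show "trace (matrix_inv (g c p) ** S ** (matrix_inv (g c p) ** S)) = sq_norm_q0 p" .
  show "transpose S = S"
    using q_sym[OF c] g_sym[OF c] by (simp add: S_def transpose_def vec_eq_iff)
qed

lemma sq_norm_q0_nonneg:
  assumes "p \<in> topspace M"
  shows "sq_norm_q0 p \<ge> 0"
proof -
  obtain c where c: "c \<in> A" "p \<in> chart_dom c" using assms topspace_M by auto
  show ?thesis
    using trace_inv_sym_square(1)[OF pos_def_g[OF c] trace_traceless_part(2)[OF c]]
    unfolding trace_traceless_part(1)[OF c] .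
qed

lemma sq_norm_q0_zero:
  assumes c: "c \<in> A" "p \<in> chart_dom c" and zero: "sq_norm_q0 p = 0"
  shows "q c p = (\<tau> p / real CARD('n)) *\<^sub>R g c p"
  using trace_inv_sym_square(2)[OF pos_def_g[OF c] trace_traceless_part(2)[OF c]] zero
  unfolding trace_traceless_part(1)[OF c] by simp

lemma Y_transforms: "transforms_as_vector A Y"
  unfolding transforms_as_vector_def
proof (intro ballI allI)
  fix c d p k assume cd: "c \<in> A" "d \<in> A" and "p \<in> chart_dom c \<inter> chart_dom d"
  then have p: "p \<in> chart_dom c" "p \<in> chart_dom d" by auto
  let ?J = "Jac c d p"
  have X: "X d p = ?J *v X c p" by (rule transforms_as_vectorD[OF X_transforms cd p])
  have "raise q d p *v X d p = (raise q d p ** ?J) *v X c p"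
    by (simp add: X matrix_vector_mul_assoc)
  also have "\<dots> = ?J *v (raise q c p *v X c p)"
    by (simp add: raise_change[OF q_tensor cd p] matrix_vector_mul_assoc)
  finally have "Y d p = ?J *v Y c p"
    unfolding Y_def X by (simp add: matrix_vector_mult_diff_distrib matrix_vector_mult_scaleR)
  then show "Y d p $ k = (\<Sum>i\<in>UNIV. jac c d p k i * Y c p $ i)"
    by (simp add: matrix_vector_mult_def Jac_def)
qed

lemma Y_component:
  "Y c p $ k = (\<Sum>i\<in>UNIV. raise q c p $ k $ i * X c p $ i) + (- 1 / real CARD('n)) * (\<tau> p * X c p $ k)"
  by (simp add: Y_def matrix_vector_mult_def)

lemma Y_Ck:
  assumes c: "c \<in> A"
  shows "chart_Ck 1 c (\<lambda>p. Y c p $ k)"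
  unfolding Y_component
  by (intro chart_Ck_add chart_Ck_sum chart_Ck_mult raise_Ck tau_Ck X_Ck chart_Ck_const c)

lemma soliton_index_calculus:
  assumes c: "c \<in> A" "p \<in> chart_dom c"
  shows "index_calculus (\<lambda>i j. matrix_inv (g c p) $ i $ j) (\<lambda>i j. g c p $ i $ j) (\<lambda>i j. q c p $ i $ j)
    (\<lambda>k i j. chart_deriv c k (\<lambda>p. g c p $ i $ j) p) (\<lambda>k i j. chart_deriv c k (\<lambda>p. q c p $ i $ j) p)
    (\<lambda>i. X c p $ i) (\<lambda>k i. chart_deriv c k (\<lambda>p. X c p $ i) p) (\<lambda>k. chart_deriv c k \<tau> p) (\<phi> p)
    (christoffel g c p) (\<lambda>i j. raise q c p $ i $ j)"
proof
  show "matrix_inv (g c p) $ i $ j = matrix_inv (g c p) $ j $ i" for i j by (rule ginv_sym[OF c])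
  show "g c p $ i $ j = g c p $ j $ i" for i j by (rule g_sym[OF c])
  show "q c p $ i $ j = q c p $ j $ i" for i j by (rule q_sym[OF c])
  show "chart_deriv c k (\<lambda>p. g c p $ i $ j) p = chart_deriv c k (\<lambda>p. g c p $ j $ i) p" for k i j
    by (rule chart_deriv_cong[OF c(1) openin_dom[OF c(1)] c(2) c(2)]) (rule g_sym[OF c(1)])
  show "(\<Sum>j\<in>UNIV. matrix_inv (g c p) $ i $ j * g c p $ j $ k) = (if i = k then 1 else 0)" for i k
    using matrix_inv_mult(2)[OF det_g_nz[OF c]] by (simp add: matrix_matrix_mult_def vec_eq_iff mat_def)
  show "(\<Sum>k\<in>UNIV. X c p $ k * chart_deriv c k (\<lambda>p. g c p $ i $ j) p
      + g c p $ k $ j * chart_deriv c i (\<lambda>p. X c p $ k) p + g c p $ i $ k * chart_deriv c j (\<lambda>p. X c p $ k) p) =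
      q c p $ i $ j + 2 * \<phi> p * g c p $ i $ j" for i j
  proof -
    have "(1/2) *\<^sub>R lie_tensor X g c p = (1/2) *\<^sub>R q c p + \<phi> p *\<^sub>R g c p"
      using soliton c by (simp add: extended_soliton_def)
    then have "((1/2) *\<^sub>R lie_tensor X g c p) $ i $ j = ((1/2) *\<^sub>R q c p + \<phi> p *\<^sub>R g c p) $ i $ j" by simp
    then show ?thesis by (simp add: lie_tensor_def field_simps)
  qed
  show "christoffel g c p k i j = 1 / 2 * (\<Sum>l\<in>UNIV. matrix_inv (g c p) $ k $ l *
      (chart_deriv c i (\<lambda>p. g c p $ j $ l) p + chart_deriv c j (\<lambda>p. g c p $ i $ l) p - chart_deriv c l (\<lambda>p. g c p $ i $ j) p))"
    for k i j by (simp add: christoffel_def)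
  show "(\<Sum>i\<in>UNIV. \<Sum>k\<in>UNIV. matrix_inv (g c p) $ i $ k * (chart_deriv c k (\<lambda>p. q c p $ i $ j) p
      - (\<Sum>l\<in>UNIV. christoffel g c p l k i * q c p $ l $ j) - (\<Sum>l\<in>UNIV. christoffel g c p l k j * q c p $ i $ l))) =
      1 / 2 * chart_deriv c j \<tau> p" for j
  proof -
    have "div_tensor g q c p $ j = (1/2) * chart_deriv c j \<tau> p" using div_q c by blast
    then show ?thesis by (simp add: div_tensor_def cov_deriv_def)
  qed
  show "raise q c p $ k $ i = (\<Sum>j\<in>UNIV. matrix_inv (g c p) $ k $ j * q c p $ j $ i)" for k i
    by (simp add: matrix_matrix_mult_def)
qed

lemma chart_deriv_Y:
  assumes c: "c \<in> A" "p \<in> chart_dom c"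
  shows "chart_deriv c k (\<lambda>p. Y c p $ k) p =
    (\<Sum>i\<in>UNIV. (\<Sum>j\<in>UNIV. - (\<Sum>a\<in>UNIV. \<Sum>b\<in>UNIV. matrix_inv (g c p) $ k $ a *
        chart_deriv c k (\<lambda>p. g c p $ a $ b) p * matrix_inv (g c p) $ b $ j) * q c p $ j $ i +
        matrix_inv (g c p) $ k $ j * chart_deriv c k (\<lambda>p. q c p $ j $ i) p) * X c p $ i +
      raise q c p $ k $ i * chart_deriv c k (\<lambda>p. X c p $ i) p)
    - (1 / real CARD('n)) * (X c p $ k * chart_deriv c k \<tau> p + \<tau> p * chart_deriv c k (\<lambda>p. X c p $ k) p)"
proof -
  note C1 = raise_Ck[OF c(1), of 1] X_Ck[OF c(1), of 1] tau_Ck[OF c(1), of 1]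
    ginv_Ck[OF c(1), of 1] q_Ck[OF c(1), of 1] chart_Ck_const
  have dP: "chart_deriv c k (\<lambda>p. raise q c p $ k $ i) p =
      (\<Sum>j\<in>UNIV. - (\<Sum>a\<in>UNIV. \<Sum>b\<in>UNIV. matrix_inv (g c p) $ k $ a *
        chart_deriv c k (\<lambda>p. g c p $ a $ b) p * matrix_inv (g c p) $ b $ j) * q c p $ j $ i +
        matrix_inv (g c p) $ k $ j * chart_deriv c k (\<lambda>p. q c p $ j $ i) p)" for i
  proof -
    have "chart_deriv c k (\<lambda>p. raise q c p $ k $ i) p =
        chart_deriv c k (\<lambda>p. \<Sum>j\<in>UNIV. matrix_inv (g c p) $ k $ j * q c p $ j $ i) p"
      by (simp add: matrix_matrix_mult_def)
    also have "\<dots> = (\<Sum>j\<in>UNIV. chart_deriv c k (\<lambda>p. matrix_inv (g c p) $ k $ j * q c p $ j $ i) p)"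
      by (rule chart_deriv_sum[OF c]) (intro chart_Ck_mult C1 c)
    also have "\<dots> = (\<Sum>j\<in>UNIV. matrix_inv (g c p) $ k $ j * chart_deriv c k (\<lambda>p. q c p $ j $ i) p +
        chart_deriv c k (\<lambda>p. matrix_inv (g c p) $ k $ j) p * q c p $ j $ i)"
      by (intro sum.cong refl chart_deriv_mult[OF c] C1)
    finally show ?thesis by (simp only: chart_deriv_ginv[OF c] add.commute)
  qed
  have 1: "chart_deriv c k (\<lambda>p. \<Sum>i\<in>UNIV. raise q c p $ k $ i * X c p $ i) p =
      (\<Sum>i\<in>UNIV. chart_deriv c k (\<lambda>p. raise q c p $ k $ i) p * X c p $ i +
        raise q c p $ k $ i * chart_deriv c k (\<lambda>p. X c p $ i) p)"
  proof -
    have "chart_deriv c k (\<lambda>p. \<Sum>i\<in>UNIV. raise q c p $ k $ i * X c p $ i) p =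
        (\<Sum>i\<in>UNIV. chart_deriv c k (\<lambda>p. raise q c p $ k $ i * X c p $ i) p)"
      by (rule chart_deriv_sum[OF c]) (intro chart_Ck_mult C1 c)
    also have "\<dots> = (\<Sum>i\<in>UNIV. raise q c p $ k $ i * chart_deriv c k (\<lambda>p. X c p $ i) p +
        chart_deriv c k (\<lambda>p. raise q c p $ k $ i) p * X c p $ i)"
      by (intro sum.cong refl chart_deriv_mult[OF c] C1)
    finally show ?thesis by (simp only: add.commute)
  qed
  have 2: "chart_deriv c k (\<lambda>p. (- 1 / real CARD('n)) * (\<tau> p * X c p $ k)) p =
      (- 1 / real CARD('n)) * (\<tau> p * chart_deriv c k (\<lambda>p. X c p $ k) p + chart_deriv c k \<tau> p * X c p $ k)"
    using chart_deriv_mult[OF c chart_Ck_const chart_Ck_mult[OF c(1) C1(3) C1(2)], of k "- 1 / real CARD('n)" k]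
      chart_deriv_mult[OF c C1(3) C1(2), of k k]
    by (simp add: chart_deriv_const)
  have "chart_deriv c k (\<lambda>p. Y c p $ k) p =
      chart_deriv c k (\<lambda>p. \<Sum>i\<in>UNIV. raise q c p $ k $ i * X c p $ i) p +
      chart_deriv c k (\<lambda>p. (- 1 / real CARD('n)) * (\<tau> p * X c p $ k)) p"
    unfolding Y_component
    by (rule chart_deriv_add[OF c]) (intro chart_Ck_sum chart_Ck_mult C1 c)+
  then show ?thesis unfolding 1 2 dP by (simp add: algebra_simps)
qed

text \<open>
  \<open>Y = V - (\<tau>/n) X\<close> with \<open>V\<^sup>k = q\<^sup>k\<^sub>i X\<^sup>i\<close>. The terms \<open>\<phi> \<tau>\<close> in the divergences of \<open>V\<close> and of \<open>(\<tau>/n) X\<close> cancel,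
  so \<open>\<phi>\<close> does not occur in the result.
\<close>

lemma divergence_Y:
  assumes c: "c \<in> A" "p \<in> chart_dom c"
  shows "vol_dens c p * div_Y p = (\<Sum>k\<in>UNIV. chart_deriv c k (\<lambda>p'. vol_dens c p' * Y c p' $ k) p)"
proof -
  let ?n = "real CARD('n)"
  interpret I: index_calculus "\<lambda>i j. matrix_inv (g c p) $ i $ j" "\<lambda>i j. g c p $ i $ j" "\<lambda>i j. q c p $ i $ j"
    "\<lambda>k i j. chart_deriv c k (\<lambda>p. g c p $ i $ j) p" "\<lambda>k i j. chart_deriv c k (\<lambda>p. q c p $ i $ j) p"
    "\<lambda>i. X c p $ i" "\<lambda>k i. chart_deriv c k (\<lambda>p. X c p $ i) p" "\<lambda>k. chart_deriv c k \<tau> p" "\<phi> p"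
    "christoffel g c p" "\<lambda>i j. raise q c p $ i $ j"
    by (rule soliton_index_calculus[OF c])
  have tr: "(\<Sum>i\<in>UNIV. raise q c p $ i $ i) = \<tau> p" using tr_eq[OF q c] by (simp add: trace_def)
  have PP: "(\<Sum>i\<in>UNIV. \<Sum>k\<in>UNIV. raise q c p $ i $ k * raise q c p $ k $ i) = sq_norm_q0 p + (\<tau> p)\<^sup>2 / ?n"
    by (simp add: sq_norm_q0_eq[OF c] trace_def matrix_matrix_mult_def)
  have lie: "(\<Sum>k\<in>UNIV. X c p $ k * chart_deriv c k \<tau> p) = lie_fun A X \<tau> p"
    using lie_fun_eq[OF X_transforms tau_Ck c] by simp
  define V where "V k = (\<Sum>i\<in>UNIV. raise q c p $ k $ i * X c p $ i)" for k
  define DV where "DV k = (\<Sum>i\<in>UNIV. (\<Sum>j\<in>UNIV. - (\<Sum>a\<in>UNIV. \<Sum>b\<in>UNIV. matrix_inv (g c p) $ k $ a *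
        chart_deriv c k (\<lambda>p. g c p $ a $ b) p * matrix_inv (g c p) $ b $ j) * q c p $ j $ i +
        matrix_inv (g c p) $ k $ j * chart_deriv c k (\<lambda>p. q c p $ j $ i) p) * X c p $ i +
      raise q c p $ k $ i * chart_deriv c k (\<lambda>p. X c p $ i) p)" for k
  have eq1: "(\<Sum>k\<in>UNIV. DV k) + (1/2) * (\<Sum>k\<in>UNIV. I.m k * V k) =
      (1/2) * lie_fun A X \<tau> p + (1/2) * (sq_norm_q0 p + (\<tau> p)\<^sup>2 / ?n) + \<phi> p * \<tau> p"
    using I.divergence_PX unfolding tr PP lie DV_def V_def .
  have eq2: "(\<Sum>k\<in>UNIV. chart_deriv c k (\<lambda>p. X c p $ k) p) + (1/2) * (\<Sum>k\<in>UNIV. I.m k * X c p $ k) =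
      (1/2) * \<tau> p + ?n * \<phi> p"
    using I.divergence_X unfolding tr .
  have YV: "Y c p $ k = V k - (1 / ?n) * (\<tau> p * X c p $ k)" for k
    by (simp add: Y_component V_def)
  have summand: "chart_deriv c k (\<lambda>p'. vol_dens c p' * Y c p' $ k) p = vol_dens c p *
      (DV k - (1 / ?n) * (X c p $ k * chart_deriv c k \<tau> p) - (\<tau> p / ?n) * chart_deriv c k (\<lambda>p. X c p $ k) p
        + (1/2) * (I.m k * V k) - (\<tau> p / ?n) * ((1/2) * (I.m k * X c p $ k)))" for k
  proof -
    have "chart_deriv c k (\<lambda>p'. vol_dens c p' * Y c p' $ k) p =
        vol_dens c p * chart_deriv c k (\<lambda>p'. Y c p' $ k) p + chart_deriv c k (vol_dens c) p * Y c p $ k"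
      by (rule chart_deriv_mult[OF c vol_dens_Ck[OF c(1)] Y_Ck[OF c(1)]])
    also have "chart_deriv c k (\<lambda>p'. Y c p' $ k) p = DV k - (1 / ?n) *
        (X c p $ k * chart_deriv c k \<tau> p + \<tau> p * chart_deriv c k (\<lambda>p. X c p $ k) p)"
      unfolding chart_deriv_Y[OF c] DV_def ..
    also have "chart_deriv c k (vol_dens c) p = vol_dens c p * ((1/2) * I.m k)"
      unfolding chart_deriv_vol_dens[OF c] I.m_def ..
    finally show ?thesis unfolding YV by (simp add: algebra_simps add_divide_distrib diff_divide_distrib)
  qed
  have "(\<Sum>k\<in>UNIV. chart_deriv c k (\<lambda>p'. vol_dens c p' * Y c p' $ k) p) = vol_dens c p *
      ((\<Sum>k\<in>UNIV. DV k) - (1 / ?n) * (\<Sum>k\<in>UNIV. X c p $ k * chart_deriv c k \<tau> p)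
        - (\<tau> p / ?n) * (\<Sum>k\<in>UNIV. chart_deriv c k (\<lambda>p. X c p $ k) p)
        + (1/2) * (\<Sum>k\<in>UNIV. I.m k * V k) - (\<tau> p / ?n) * ((1/2) * (\<Sum>k\<in>UNIV. I.m k * X c p $ k)))"
    unfolding summand by (simp only: sum.distrib sum_subtractf sum_distrib_left[symmetric])
  also have "\<dots> = vol_dens c p * (((\<Sum>k\<in>UNIV. DV k) + (1/2) * (\<Sum>k\<in>UNIV. I.m k * V k))
      - (1 / ?n) * lie_fun A X \<tau> p - (\<tau> p / ?n) * ((\<Sum>k\<in>UNIV. chart_deriv c k (\<lambda>p. X c p $ k) p)
        + (1/2) * (\<Sum>k\<in>UNIV. I.m k * X c p $ k)))"
    unfolding lie by (simp add: algebra_simps)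
  also have "\<dots> = vol_dens c p * div_Y p"
    unfolding eq1 eq2 div_Y_def by (simp add: power2_eq_square field_simps)
  finally show ?thesis by simp
qed

text \<open>
  For \<open>n = 2\<close> the coefficient of the first term of \<open>div_Y\<close> is zero.
\<close>

lemma integral_sq_norm_q0:
  assumes "CARD('n) = 2 \<or> (LINT p|dvol M A g. lie_fun A X \<tau> p) = 0"
  shows "(LINT p|dvol M A g. sq_norm_q0 p) = 0"
proof -
  have "(LINT p|dvol M A g. div_Y p) = 0"
    by (rule divergence_theorem[OF Y_transforms Y_Ck divergence_Y])
  moreover have "(LINT p|dvol M A g. div_Y p) =
      (1/2 - 1 / real CARD('n)) * (LINT p|dvol M A g. lie_fun A X \<tau> p) + (1/2) * (LINT p|dvol M A g. sq_norm_q0 p)"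
    unfolding div_Y_def
    using integrable_dvol_continuous[OF lie_fun_continuous[OF X_transforms X_Ck tau_Ck]]
      integrable_dvol_continuous[OF sq_norm_q0_continuous]
    by simp
  ultimately show ?thesis using assms by auto
qed

lemma conformal:
  assumes "CARD('n) = 2 \<or> (LINT p|dvol M A g. lie_fun A X \<tau> p) = 0"
  shows "conformal_field A g X"
proof -
  have zero: "sq_norm_q0 p = 0" if "p \<in> topspace M" for p
    by (rule continuous_nonneg_integral_zero[OF sq_norm_q0_continuous sq_norm_q0_nonneg integral_sq_norm_q0[OF assms] that])
  define \<sigma> where "\<sigma> p = \<tau> p / (2 * real CARD('n)) + \<phi> p" for p
  have "smooth_function A \<sigma>"
    unfolding smooth_function_def chart_smooth_def smooth_on_def
  proof (intro ballI allI)
    fix c k assume c: "c \<in> A"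
    have "chart_Ck k c \<phi>" using \<phi> c by (auto simp: smooth_function_def intro: chart_smooth_imp_Ck)
    then have "chart_Ck k c \<sigma>"
      unfolding \<sigma>_def by (intro chart_Ck_add chart_Ck_divide tau_Ck chart_Ck_const c) auto
    then show "Ck_on k (coord c ` chart_dom c) (\<lambda>x. \<sigma> (chart_inv c x))" by (simp add: chart_Ck_def)
  qed
  moreover have "lie_tensor X g c p = (2 * \<sigma> p) *\<^sub>R g c p" if c: "c \<in> A" "p \<in> chart_dom c" for c p
  proof -
    have "sq_norm_q0 p = 0" using zero c dom_subset by blast
    from sq_norm_q0_zero[OF c this] have qg: "q c p = (\<tau> p / real CARD('n)) *\<^sub>R g c p" .
    have "(1/2) *\<^sub>R lie_tensor X g c p = (1/2) *\<^sub>R q c p + \<phi> p *\<^sub>R g c p"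
      using soliton c by (simp add: extended_soliton_def)
    then have "2 *\<^sub>R ((1/2) *\<^sub>R lie_tensor X g c p) = 2 *\<^sub>R ((1/2) *\<^sub>R q c p + \<phi> p *\<^sub>R g c p)" by simp
    then have "lie_tensor X g c p = q c p + (2 * \<phi> p) *\<^sub>R g c p" by (simp add: scaleR_add_right)
    then show ?thesis unfolding qg \<sigma>_def by (simp add: scaleR_add_left[symmetric] distrib_left)
  qed
  ultimately show ?thesis unfolding conformal_field_def by blast
qed

end

theorem theorem3p6:
  fixes M :: "'a topology"
    and A :: "('a, 'n::finite) chart set"
    and g q :: "('a, 'n) tensor2"
    and X :: "('a, 'n) vfield"
    and \<phi> :: "'a \<Rightarrow> real"
  assumes "closed_manifold M A"
    and "riemannian_metric A g"
    and "symmetric_tensor_field A q"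
    and "vector_field A X"
    and "smooth_function A \<phi>"
    and "extended_soliton A g q X \<phi>"
    and "\<forall>c\<in>A. \<forall>p\<in>chart_dom c. \<forall>j.
           div_tensor g q c p $ j = (1/2) * chart_deriv c j (tr A g q) p"
  shows "((LINT p|dvol M A g. lie_fun A X (tr A g q) p) = 0 \<longrightarrow> conformal_field A g X) \<and>
         (CARD('n) = 2 \<longrightarrow> conformal_field A g X)"
proof -
  interpret closed_soliton M A g q X \<phi>
    by unfold_locales (use assms in auto)
  show ?thesis using conformal by blast
qed

end
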